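(* Let $\mathfrak g$ be a finite dimensional Lie algebra over a field $\mathbb F$ of characteristic zero. Then $\mathfrak g$ is reductive if and only if it admits a nondegenerate trace form. In this case $\mathfrak g=\mathfrak z(\mathfrak g)\oplus[\mathfrak g,\mathfrak g]$, this direct sum is orthogonal (with respect to a nondegenerate trace form), and $[\mathfrak g,\mathfrak g]\cong \mathrm{ad}(\mathfrak g)=\{D\in\mathrm{der}(\mathfrak g) : D(\mathfrak z(\mathfrak g))=0\}\cong\mathrm{der}([\mathfrak g,\mathfrak g])$ (Lie algebra isomorphisms), and this Lie algebra is semisimple.
   Context: All representations are finite dimensional over $\mathbb F$. A Lie algebra is \emph{reductive} if it has a faithful semisimple (i.e. completely reducible) representation. A Lie algebra is \emph{simple} if it is nonabelian with no proper nontrivial ideals, and \emph{semisimple} if it is a (possibly empty) direct sum of simple ideals. The \emph{trace form} associated to a representation $\rho:\mathfrak g\to\mathfrak{gl}(V)$ is the symmetric bilinear form $(x,y)\mapsto \mathrm{tr}(\rho(x)\rho(y))$; a trace form on $\mathfrak g$ is one arising from some representation. $\mathfrak z(\mathfrak g)$ is the centre of $\mathfrak g$, $\mathrm{der}(\mathfrak g)$ is the Lie algebra of derivations of $\mathfrak g$, and $\mathrm{ad}(\mathfrak g)\subseteq\mathrm{der}(\mathfrak g)$ is the image of the adjoint representation. *)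

theory Defs
  imports Complex_Main "HOL-Library.Function_Algebras"
begin

section \<open>Linear algebra on carrier sets\<close>

text \<open>
  All vector spaces below are linear subspaces, given as sets, of an ambient vector space that is a
  type with a scalar multiplication in the sense of \<^theory>\<open>HOL.Vector_Spaces\<close>.
  The type itself is the special case \<^term>\<open>UNIV\<close>.
\<close>

definition fin_dim :: "('f::field \<Rightarrow> 'v::ab_group_add \<Rightarrow> 'v) \<Rightarrow> 'v set \<Rightarrow> bool" where
  "fin_dim s V \<longleftrightarrow> (\<exists>B. finite B \<and> module.span s B = V)"

definition linear_map_on ::
  "('f::field \<Rightarrow> 'v::ab_group_add \<Rightarrow> 'v) \<Rightarrow> 'v set \<Rightarrow> ('f \<Rightarrow> 'w::ab_group_add \<Rightarrow> 'w) \<Rightarrow> 'w set \<Rightarrow>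
   ('v \<Rightarrow> 'w) \<Rightarrow> bool" where
  "linear_map_on s V t W f \<longleftrightarrow>
     (\<forall>x\<in>V. f x \<in> W) \<and>
     (\<forall>x\<in>V. \<forall>y\<in>V. f (x + y) = f x + f y) \<and>
     (\<forall>c. \<forall>x\<in>V. f (s c x) = t c (f x))"

text \<open>Internal direct sums of finitely many subspaces; the empty sum is \<^term>\<open>{0}\<close>.\<close>

definition direct_sum_of :: "'v::ab_group_add set \<Rightarrow> 'v set set \<Rightarrow> bool" where
  "direct_sum_of V \<W> \<longleftrightarrow>
     finite \<W> \<and>
     V = {sum f \<W> | f. \<forall>W\<in>\<W>. f W \<in> W} \<and>
     (\<forall>f. (\<forall>W\<in>\<W>. f W \<in> W) \<and> sum f \<W> = 0 \<longrightarrow> (\<forall>W\<in>\<W>. f W = 0))"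

definition direct_sum2 :: "'v::ab_group_add set \<Rightarrow> 'v set \<Rightarrow> 'v set \<Rightarrow> bool" where
  "direct_sum2 V U W \<longleftrightarrow> V = {u + w | u w. u \<in> U \<and> w \<in> W} \<and> U \<inter> W = {0}"

definition is_basis :: "('f::field \<Rightarrow> 'v::ab_group_add \<Rightarrow> 'v) \<Rightarrow> 'v set \<Rightarrow> 'v set \<Rightarrow> bool" where
  "is_basis s V B \<longleftrightarrow> finite B \<and> \<not> module.dependent s B \<and> module.span s B = V"

text \<open>
  The value does not depend on the basis chosen, see \<open>trace_on_eq\<close> below.
\<close>

definition trace_on :: "('f::field \<Rightarrow> 'v::ab_group_add \<Rightarrow> 'v) \<Rightarrow> 'v set \<Rightarrow> ('v \<Rightarrow> 'v) \<Rightarrow> 'f" where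
  "trace_on s V f =
     (let B = (SOME B. is_basis s V B) in \<Sum>b\<in>B. module.representation s B (f b) b)"

lemma trace_on_eq:
  assumes "vector_space s" and B: "is_basis s V B" and f: "linear_map_on s V s V f"
  shows "trace_on s V f = (\<Sum>b\<in>B. module.representation s B (f b) b)"
proof -
  interpret vector_space s by fact
  have subV: "subspace V" using B by (auto simp: is_basis_def)
  have lin: "f (\<Sum>i\<in>I. s (c i) (v i)) = (\<Sum>i\<in>I. s (c i) (f (v i)))"
    if "finite I" "\<And>i. i \<in> I \<Longrightarrow> v i \<in> V" for I :: "'b set" and c v
    using that
  proof (induction I)
    case empty
    have "f 0 = f (s 0 0)" by simp
    also have "\<dots> = s 0 (f 0)"
      using f subV unfolding linear_map_on_def by (metis subspace_0)
    finally show ?case by simp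
  next
    case (insert i I)
    have "(\<Sum>i\<in>I. s (c i) (v i)) \<in> V" "s (c i) (v i) \<in> V"
      using insert subV by (auto intro!: subspace_sum subspace_scale)
    then have "f (s (c i) (v i) + (\<Sum>i\<in>I. s (c i) (v i)))
        = f (s (c i) (v i)) + f (\<Sum>i\<in>I. s (c i) (v i))"
      using f unfolding linear_map_on_def by blast
    moreover have "f (s (c i) (v i)) = s (c i) (f (v i))"
      using f insert.prems unfolding linear_map_on_def by blast
    ultimately show ?case using insert by simp
  qed
  have key: "(\<Sum>b\<in>B. representation B (f b) b) = (\<Sum>c\<in>C. representation C (f c) c)"
    if "is_basis s V B" "is_basis s V C" for B C
  proof -
    have B: "finite B" "independent B" "span B = V" and C: "finite C" "independent C" "span C = V"
      using that by (auto simp: is_basis_def)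
    have BV: "b \<in> V" if "b \<in> B" for b using B span_base that by blast
    have CV: "c \<in> V" if "c \<in> C" for c using C span_base that by blast
    have fV: "f v \<in> V" if "v \<in> V" for v using f that by (auto simp: linear_map_on_def)
    have expB: "(\<Sum>b\<in>B. s (representation B v b) b) = v" if "v \<in> V" for v
      using sum_representation_eq[of B v B] B that by auto
    have expC: "(\<Sum>c\<in>C. s (representation C v c) c) = v" if "v \<in> V" for v
      using sum_representation_eq[of C v C] C that by auto
    have repB: "representation B (\<Sum>i\<in>I. s (a i) (v i)) b = (\<Sum>i\<in>I. a i * representation B (v i) b)"
      if "\<And>i. i \<in> I \<Longrightarrow> v i \<in> V" for I :: "'b set" and a v b
    proof -
      have "representation B (\<Sum>i\<in>I. s (a i) (v i)) b
          = (\<Sum>i\<in>I. representation B (s (a i) (v i)) b)"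
        using that B by (subst representation_sum) (auto intro: span_scale)
      also have "\<dots> = (\<Sum>i\<in>I. a i * representation B (v i) b)"
        using that B by (intro sum.cong) (auto simp: representation_scale)
      finally show ?thesis .
    qed
    have repC: "representation C (\<Sum>i\<in>I. s (a i) (v i)) c = (\<Sum>i\<in>I. a i * representation C (v i) c)"
      if "\<And>i. i \<in> I \<Longrightarrow> v i \<in> V" for I :: "'b set" and a v c
    proof -
      have "representation C (\<Sum>i\<in>I. s (a i) (v i)) c
          = (\<Sum>i\<in>I. representation C (s (a i) (v i)) c)"
        using that C by (subst representation_sum) (auto intro: span_scale)
      also have "\<dots> = (\<Sum>i\<in>I. a i * representation C (v i) c)"
        using that C by (intro sum.cong) (auto simp: representation_scale)
      finally show ?thesis .
    qed
    have "(\<Sum>b\<in>B. representation B (f b) b)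
        = (\<Sum>b\<in>B. \<Sum>c\<in>C. representation C (f b) c * representation B c b)"
    proof (intro sum.cong refl)
      fix b assume "b \<in> B"
      then have "representation B (f b) b = representation B (\<Sum>c\<in>C. s (representation C (f b) c) c) b"
        using expC BV fV by simp
      then show "representation B (f b) b = (\<Sum>c\<in>C. representation C (f b) c * representation B c b)"
        using repB[of C "\<lambda>c. c"] CV by simp
    qed
    also have "\<dots> = (\<Sum>c\<in>C. \<Sum>b\<in>B. representation B c b * representation C (f b) c)"
      by (subst sum.swap) (simp add: mult.commute)
    also have "\<dots> = (\<Sum>c\<in>C. representation C (f c) c)"
    proof (intro sum.cong refl)
      fix c assume c: "c \<in> C"
      have "(\<Sum>b\<in>B. representation B c b * representation C (f b) c)
          = representation C (\<Sum>b\<in>B. s (representation B c b) (f b)) c"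
        using repC[of B f] BV fV by simp
      also have "(\<Sum>b\<in>B. s (representation B c b) (f b)) = f (\<Sum>b\<in>B. s (representation B c b) b)"
        using lin[of B "\<lambda>b. b"] B BV by simp
      finally show "(\<Sum>b\<in>B. representation B c b * representation C (f b) c) = representation C (f c) c"
        using expB CV c by simp
    qed
    finally show ?thesis .
  qed
  have "is_basis s V (SOME B. is_basis s V B)"
    using B by (rule someI)
  then show ?thesis
    unfolding trace_on_def Let_def using B by (intro key)
qed

definition pointwise_scale :: "('f \<Rightarrow> 'w \<Rightarrow> 'w) \<Rightarrow> 'f \<Rightarrow> ('v \<Rightarrow> 'w) \<Rightarrow> 'v \<Rightarrow> 'w" where
  "pointwise_scale s c f = (\<lambda>x. s c (f x))"


section \<open>Lie algebras\<close>

record ('f, 'v) lie =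
  lie_carrier :: "'v set"
  lie_scale :: "'f \<Rightarrow> 'v \<Rightarrow> 'v"
  lie_bracket :: "'v \<Rightarrow> 'v \<Rightarrow> 'v"

definition lie_algebra :: "('f::field, 'v::ab_group_add) lie \<Rightarrow> bool" where
  "lie_algebra g \<longleftrightarrow>
     vector_space (lie_scale g) \<and> module.subspace (lie_scale g) (lie_carrier g) \<and>
     (\<forall>x\<in>lie_carrier g. linear_map_on (lie_scale g) (lie_carrier g) (lie_scale g) (lie_carrier g) (lie_bracket g x)) \<and>
     (\<forall>y\<in>lie_carrier g. linear_map_on (lie_scale g) (lie_carrier g) (lie_scale g) (lie_carrier g) (\<lambda>x. lie_bracket g x y)) \<and>
     (\<forall>x\<in>lie_carrier g. lie_bracket g x x = 0) \<and>
     (\<forall>x\<in>lie_carrier g. \<forall>y\<in>lie_carrier g. \<forall>z\<in>lie_carrier g.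
        lie_bracket g x (lie_bracket g y z) + lie_bracket g y (lie_bracket g z x) + lie_bracket g z (lie_bracket g x y) = 0)"

definition sub_lie :: "('f, 'v) lie \<Rightarrow> 'v set \<Rightarrow> ('f, 'v) lie" where
  "sub_lie g S = g\<lparr>lie_carrier := S\<rparr>"

definition lie_hom :: "('f::field, 'v::ab_group_add) lie \<Rightarrow> ('f, 'w::ab_group_add) lie \<Rightarrow> ('v \<Rightarrow> 'w) \<Rightarrow> bool" where
  "lie_hom g h \<phi> \<longleftrightarrow>
     linear_map_on (lie_scale g) (lie_carrier g) (lie_scale h) (lie_carrier h) \<phi> \<and>
     (\<forall>x\<in>lie_carrier g. \<forall>y\<in>lie_carrier g. \<phi> (lie_bracket g x y) = lie_bracket h (\<phi> x) (\<phi> y))"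

definition lie_isomorphic :: "('f::field, 'v::ab_group_add) lie \<Rightarrow> ('f, 'w::ab_group_add) lie \<Rightarrow> bool"
    (infix \<open>\<cong>\<^sub>L\<close> 50) where
  "g \<cong>\<^sub>L h \<longleftrightarrow> (\<exists>\<phi>. lie_hom g h \<phi> \<and> bij_betw \<phi> (lie_carrier g) (lie_carrier h))"

definition lie_ideal :: "('f::field, 'v::ab_group_add) lie \<Rightarrow> 'v set \<Rightarrow> bool" where
  "lie_ideal g I \<longleftrightarrow>
     I \<subseteq> lie_carrier g \<and> module.subspace (lie_scale g) I \<and> (\<forall>x\<in>lie_carrier g. \<forall>y\<in>I. lie_bracket g x y \<in> I)"

definition lie_abelian :: "('f::field, 'v::ab_group_add) lie \<Rightarrow> bool" where
  "lie_abelian g \<longleftrightarrow> (\<forall>x\<in>lie_carrier g. \<forall>y\<in>lie_carrier g. lie_bracket g x y = 0)"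

definition simple_lie :: "('f::field, 'v::ab_group_add) lie \<Rightarrow> bool" where
  "simple_lie g \<longleftrightarrow> \<not> lie_abelian g \<and> (\<forall>I. lie_ideal g I \<longrightarrow> I = {0} \<or> I = lie_carrier g)"

definition semisimple_lie :: "('f::field, 'v::ab_group_add) lie \<Rightarrow> bool" where
  "semisimple_lie g \<longleftrightarrow>
     (\<exists>\<S>. direct_sum_of (lie_carrier g) \<S> \<and> (\<forall>S\<in>\<S>. lie_ideal g S \<and> simple_lie (sub_lie g S)))"

definition lie_centre :: "('f::field, 'v::ab_group_add) lie \<Rightarrow> 'v set" where
  "lie_centre g = {z \<in> lie_carrier g. \<forall>x\<in>lie_carrier g. lie_bracket g z x = 0}"

definition lie_derived :: "('f::field, 'v::ab_group_add) lie \<Rightarrow> 'v set" where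
  "lie_derived g = module.span (lie_scale g) {lie_bracket g x y | x y. x \<in> lie_carrier g \<and> y \<in> lie_carrier g}"

text \<open>
  An endomorphism of the subspace \<open>V\<close> is represented by its extension by \<open>0\<close> outside \<open>V\<close>, so
  that endomorphisms of \<open>V\<close> correspond bijectively to functions, and the vector space operations
  are the pointwise ones.
\<close>

definition gl :: "('f::field \<Rightarrow> 'v::ab_group_add \<Rightarrow> 'v) \<Rightarrow> 'v set \<Rightarrow> ('f, 'v \<Rightarrow> 'v) lie" where
  "gl s V = \<lparr>lie_carrier = {f. linear_map_on s V s V f \<and> (\<forall>x. x \<notin> V \<longrightarrow> f x = 0)},
             lie_scale = pointwise_scale s,
             lie_bracket = (\<lambda>f h. (f \<circ> h) - (h \<circ> f))\<rparr>"

definition der :: "('f::field, 'v::ab_group_add) lie \<Rightarrow> ('f, 'v \<Rightarrow> 'v) lie" where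
  "der g = sub_lie (gl (lie_scale g) (lie_carrier g))
     {D \<in> lie_carrier (gl (lie_scale g) (lie_carrier g)). \<forall>x\<in>lie_carrier g. \<forall>y\<in>lie_carrier g.
        D (lie_bracket g x y) = lie_bracket g (D x) y + lie_bracket g x (D y)}"

definition ad :: "('f::field, 'v::ab_group_add) lie \<Rightarrow> 'v \<Rightarrow> 'v \<Rightarrow> 'v" where
  "ad g x = (\<lambda>y. if y \<in> lie_carrier g then lie_bracket g x y else 0)"

definition ad_lie :: "('f::field, 'v::ab_group_add) lie \<Rightarrow> ('f, 'v \<Rightarrow> 'v) lie" where
  "ad_lie g = sub_lie (der g) (ad g ` lie_carrier g)"


section \<open>Representations\<close>

definition lie_rep ::
  "('f::field, 'g::ab_group_add) lie \<Rightarrow> ('f \<Rightarrow> 'v::ab_group_add \<Rightarrow> 'v) \<Rightarrow> 'v set \<Rightarrow>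
   ('g \<Rightarrow> 'v \<Rightarrow> 'v) \<Rightarrow> bool" where
  "lie_rep g s V \<rho> \<longleftrightarrow>
     vector_space s \<and> module.subspace s V \<and> fin_dim s V \<and> lie_hom g (gl s V) \<rho>"

definition faithful :: "('f::field, 'g::ab_group_add) lie \<Rightarrow> ('g \<Rightarrow> 'v \<Rightarrow> 'v) \<Rightarrow> bool" where
  "faithful g \<rho> \<longleftrightarrow> inj_on \<rho> (lie_carrier g)"

definition subrep ::
  "('f::field, 'g::ab_group_add) lie \<Rightarrow> ('f \<Rightarrow> 'v::ab_group_add \<Rightarrow> 'v) \<Rightarrow> 'v set \<Rightarrow>
   ('g \<Rightarrow> 'v \<Rightarrow> 'v) \<Rightarrow> 'v set \<Rightarrow> bool" where
  "subrep g s V \<rho> W \<longleftrightarrow>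
     W \<subseteq> V \<and> module.subspace s W \<and> (\<forall>x\<in>lie_carrier g. \<forall>w\<in>W. \<rho> x w \<in> W)"

definition irreducible_subrep ::
  "('f::field, 'g::ab_group_add) lie \<Rightarrow> ('f \<Rightarrow> 'v::ab_group_add \<Rightarrow> 'v) \<Rightarrow> 'v set \<Rightarrow>
   ('g \<Rightarrow> 'v \<Rightarrow> 'v) \<Rightarrow> 'v set \<Rightarrow> bool" where
  "irreducible_subrep g s V \<rho> W \<longleftrightarrow>
     subrep g s V \<rho> W \<and> W \<noteq> {0} \<and> (\<forall>U. subrep g s V \<rho> U \<and> U \<subseteq> W \<longrightarrow> U = {0} \<or> U = W)"

definition semisimple_rep ::
  "('f::field, 'g::ab_group_add) lie \<Rightarrow> ('f \<Rightarrow> 'v::ab_group_add \<Rightarrow> 'v) \<Rightarrow> 'v set \<Rightarrow>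
   ('g \<Rightarrow> 'v \<Rightarrow> 'v) \<Rightarrow> bool" where
  "semisimple_rep g s V \<rho> \<longleftrightarrow>
     (\<exists>\<W>. direct_sum_of V \<W> \<and> (\<forall>W\<in>\<W>. irreducible_subrep g s V \<rho> W))"

text \<open>
  A definition cannot quantify over all types that might carry a representation space. The
  existential quantifiers over representations therefore range over the finite dimensional
  subspaces of the space of sequences \<^typ>\<open>nat \<Rightarrow> 'f\<close>. This is no restriction, because every
  finite dimensional space is isomorphic to such a subspace: \<open>reductiveI\<close> and \<open>trace_formI\<close> below
  show that a representation on any other type may be used as well.
\<close>

abbreviation seq_scale :: "'f::field \<Rightarrow> (nat \<Rightarrow> 'f) \<Rightarrow> nat \<Rightarrow> 'f" where
  "seq_scale \<equiv> pointwise_scale (*)"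

definition reductive :: "('f::field, 'g::ab_group_add) lie \<Rightarrow> bool" where
  "reductive g \<longleftrightarrow>
     (\<exists>V \<rho>. lie_rep g seq_scale V \<rho> \<and> faithful g \<rho> \<and> semisimple_rep g seq_scale V \<rho>)"

definition trace_form :: "('f::field, 'g::ab_group_add) lie \<Rightarrow> ('g \<Rightarrow> 'g \<Rightarrow> 'f) \<Rightarrow> bool" where
  "trace_form g \<beta> \<longleftrightarrow>
     (\<exists>V \<rho>. lie_rep g seq_scale V \<rho> \<and>
        (\<forall>x\<in>lie_carrier g. \<forall>y\<in>lie_carrier g. \<beta> x y = trace_on seq_scale V (\<rho> x \<circ> \<rho> y)))"

text \<open>Only used for symmetric forms, for which the left and the right radical agree.\<close>

definition nondegenerate :: "('f::field, 'g::ab_group_add) lie \<Rightarrow> ('g \<Rightarrow> 'g \<Rightarrow> 'f) \<Rightarrow> bool" where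
  "nondegenerate g \<beta> \<longleftrightarrow> (\<forall>x\<in>lie_carrier g. (\<forall>y\<in>lie_carrier g. \<beta> x y = 0) \<longrightarrow> x = 0)"

lemma vector_space_pointwise_scale:
  assumes "vector_space s"
  shows "vector_space (pointwise_scale s)"
proof -
  interpret vector_space s by fact
  show ?thesis
    by unfold_locales (auto simp: pointwise_scale_def fun_eq_iff scale_right_distrib scale_left_distrib)
qed

lemma lie_algebra_gl:
  assumes "vector_space s" "module.subspace s V"
  shows "lie_algebra (gl s V)"
proof -
  interpret V: vector_space s by fact
  interpret E: vector_space "pointwise_scale s :: _ \<Rightarrow> ('b \<Rightarrow> 'b) \<Rightarrow> _"
    by (rule vector_space_pointwise_scale) fact
  define E where "E = lie_carrier (gl s V)"
  have gl: "lie_carrier (gl s V) = E" "lie_scale (gl s V) = pointwise_scale s"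
    "lie_bracket (gl s V) = (\<lambda>f h. (f \<circ> h) - (h \<circ> f))"
    by (simp_all add: gl_def E_def)
  have V: "0 \<in> V" "\<And>x y. x \<in> V \<Longrightarrow> y \<in> V \<Longrightarrow> x + y \<in> V" "\<And>x y. x \<in> V \<Longrightarrow> y \<in> V \<Longrightarrow> x - y \<in> V"
    "\<And>c x. x \<in> V \<Longrightarrow> s c x \<in> V"
    using assms(2) by (auto intro: V.subspace_0 V.subspace_add V.subspace_diff V.subspace_scale)
  have fV: "f x \<in> V" if "f \<in> E" for f x
    using that V(1) by (cases "x \<in> V") (auto simp: E_def gl_def linear_map_on_def)
  have add: "f (x + y) = f x + f y" if "f \<in> E" "x \<in> V" "y \<in> V" for f x y
    using that by (auto simp: E_def gl_def linear_map_on_def)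
  have scl: "f (s c x) = s c (f x)" if "f \<in> E" "x \<in> V" for f x c
    using that by (auto simp: E_def gl_def linear_map_on_def)
  have diff: "f (x - y) = f x - f y" if "f \<in> E" "x \<in> V" "y \<in> V" for f x y
    using add[of f "x - y" y] that V(3) by simp
  have f0: "f 0 = 0" if "f \<in> E" for f
    using add[of f 0 0] that V(1) by simp
  have outside: "f x = 0" if "f \<in> E" "x \<notin> V" for f x
    using that by (auto simp: E_def gl_def)
  have EI: "f \<in> E" if "\<And>x. x \<in> V \<Longrightarrow> f x \<in> V" "\<And>x y. x \<in> V \<Longrightarrow> y \<in> V \<Longrightarrow> f (x + y) = f x + f y"
    "\<And>c x. x \<in> V \<Longrightarrow> f (s c x) = s c (f x)" "\<And>x. x \<notin> V \<Longrightarrow> f x = 0" for f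
    using that by (auto simp: E_def gl_def linear_map_on_def)
  have sub: "E.subspace E"
  proof (rule E.subspaceI)
    show "0 \<in> E" by (rule EI) (simp_all add: V)
    show "f + h \<in> E" if "f \<in> E" "h \<in> E" for f h
      by (rule EI) (simp_all add: that V fV add scl outside V.scale_right_distrib)
    show "pointwise_scale s c f \<in> E" if "f \<in> E" for c f
      by (rule EI) (simp_all add: that V fV add scl outside V.scale_right_distrib
          pointwise_scale_def mult.commute)
  qed
  have br: "(f \<circ> h) - (h \<circ> f) \<in> E" if "f \<in> E" "h \<in> E" for f h
    by (rule EI) (simp_all add: that V fV add scl diff f0 outside V.scale_right_diff_distrib)
  show ?thesis
    unfolding lie_algebra_def gl
  proof (intro conjI ballI)
    show "vector_space (pointwise_scale s :: _ \<Rightarrow> ('b \<Rightarrow> 'b) \<Rightarrow> _)"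
      by (rule E.vector_space_axioms)
    show "E.subspace E" by (rule sub)
    fix f assume f: "f \<in> E"
    show "linear_map_on (pointwise_scale s) E (pointwise_scale s) E (\<lambda>h. (f \<circ> h) - (h \<circ> f))"
      unfolding linear_map_on_def
      by (simp add: f br fun_eq_iff add scl fV pointwise_scale_def V.scale_right_diff_distrib)
    show "linear_map_on (pointwise_scale s) E (pointwise_scale s) E (\<lambda>h. (h \<circ> f) - (f \<circ> h))"
      unfolding linear_map_on_def
      by (simp add: f br fun_eq_iff add scl fV pointwise_scale_def V.scale_right_diff_distrib)
    show "(f \<circ> f) - (f \<circ> f) = 0" by simp
    fix h k assume "h \<in> E" "k \<in> E"
    then show "(f \<circ> ((h \<circ> k) - (k \<circ> h))) - (((h \<circ> k) - (k \<circ> h)) \<circ> f)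
        + ((h \<circ> ((k \<circ> f) - (f \<circ> k))) - (((k \<circ> f) - (f \<circ> k)) \<circ> h))
        + ((k \<circ> ((f \<circ> h) - (h \<circ> f))) - (((f \<circ> h) - (h \<circ> f)) \<circ> k)) = 0"
      using f by (simp add: fun_eq_iff diff fV)
  qed
qed

lemma lie_algebra_sub_lie:
  assumes g: "lie_algebra g" and S: "S \<subseteq> lie_carrier g" "module.subspace (lie_scale g) S"
    and br: "\<And>x y. x \<in> S \<Longrightarrow> y \<in> S \<Longrightarrow> lie_bracket g x y \<in> S"
  shows "lie_algebra (sub_lie g S)"
  using assms unfolding lie_algebra_def sub_lie_def linear_map_on_def
  by (auto simp: subset_iff)

lemma lie_algebra_der:
  assumes g: "lie_algebra g"
  shows "lie_algebra (der g)"
proof -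
  interpret vector_space "lie_scale g" using g by (simp add: lie_algebra_def)
  interpret E: vector_space "pointwise_scale (lie_scale g) :: _ \<Rightarrow> ('b \<Rightarrow> 'b) \<Rightarrow> _"
    by (rule vector_space_pointwise_scale) unfold_locales
  have sub: "subspace (lie_carrier g)" using g by (simp add: lie_algebra_def)
  let ?G = "gl (lie_scale g) (lie_carrier g)"
  have G: "lie_algebra ?G" by (rule lie_algebra_gl[OF vector_space_axioms sub])
  have subE: "E.subspace (lie_carrier ?G)" using G by (simp add: lie_algebra_def gl_def)
  have brE: "(f \<circ> h) - (h \<circ> f) \<in> lie_carrier ?G" if "f \<in> lie_carrier ?G" "h \<in> lie_carrier ?G" for f h
    using G that by (auto simp: lie_algebra_def gl_def linear_map_on_def)
  have brg: "lie_bracket g x y \<in> lie_carrier g" "lie_bracket g (x + y) z = lie_bracket g x z + lie_bracket g y z"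
    "lie_bracket g z (x + y) = lie_bracket g z x + lie_bracket g z y"
    "lie_bracket g (lie_scale g c x) y = lie_scale g c (lie_bracket g x y)"
    "lie_bracket g x (lie_scale g c y) = lie_scale g c (lie_bracket g x y)"
    if "x \<in> lie_carrier g" "y \<in> lie_carrier g" "z \<in> lie_carrier g" for x y z c
    using g that by (auto simp: lie_algebra_def linear_map_on_def)
  have br0: "lie_bracket g 0 z = 0" "lie_bracket g z 0 = 0" if "z \<in> lie_carrier g" for z
    using brg(2)[of 0 0 z] brg(3)[of 0 0 z] that subspace_0[OF sub] by simp_all
  have mG: "f x \<in> lie_carrier g" "f (x + y) = f x + f y"
    if "f \<in> lie_carrier ?G" "x \<in> lie_carrier g" "y \<in> lie_carrier g" for f x y
    using that by (auto simp: gl_def linear_map_on_def)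
  have mdiff: "lie_bracket g (x - y) z = lie_bracket g x z - lie_bracket g y z"
     "lie_bracket g z (x - y) = lie_bracket g z x - lie_bracket g z y"
    if "x \<in> lie_carrier g" "y \<in> lie_carrier g" "z \<in> lie_carrier g" for x y z
    using brg(2)[of "x - y" y z] brg(3)[of "x - y" y z] that subspace_diff[OF sub] by simp_all
  show ?thesis
    unfolding der_def
  proof (rule lie_algebra_sub_lie[OF G], goal_cases)
    case 2
    show ?case
      unfolding module.subspace_def[OF E.module_axioms] gl_def[of "lie_scale g", THEN arg_cong[of _ _ lie_scale], simplified]
      using E.subspace_0[OF subE] E.subspace_add[OF subE] E.subspace_scale[OF subE]
      by (auto simp: br0 mG brg pointwise_scale_def scale_right_distrib)
  next
    case (3 f h)
    then show ?case using brE[of f h]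
      by (auto simp: gl_def[of "lie_scale g", THEN arg_cong[of _ _ lie_bracket], simplified] mG brg mdiff)
  qed auto
qed

lemma linear_map_on_comp:
  "linear_map_on s U t V f \<Longrightarrow> linear_map_on t V u W h \<Longrightarrow> linear_map_on s U u W (h \<circ> f)"
  by (simp add: linear_map_on_def)

lemma lie_rep_transport:
  fixes s :: "'f::field \<Rightarrow> 'v::ab_group_add \<Rightarrow> 'v" and t :: "'f \<Rightarrow> 'w::ab_group_add \<Rightarrow> 'w"
  assumes \<phi>: "Vector_Spaces.linear s t \<phi>" and inj: "inj_on \<phi> V" and rep: "lie_rep g s V \<rho>"
  defines "\<rho>' \<equiv> \<lambda>x w. if w \<in> \<phi> ` V then \<phi> (\<rho> x (inv_into V \<phi> w)) else 0"
  shows "lie_rep g t (\<phi> ` V) \<rho>'"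
    and "faithful g \<rho> \<Longrightarrow> faithful g \<rho>'"
    and "semisimple_rep g s V \<rho> \<Longrightarrow> semisimple_rep g t (\<phi> ` V) \<rho>'"
    and "x \<in> lie_carrier g \<Longrightarrow> y \<in> lie_carrier g \<Longrightarrow>
           trace_on t (\<phi> ` V) (\<rho>' x \<circ> \<rho>' y) = trace_on s V (\<rho> x \<circ> \<rho> y)"
proof -
  interpret Vector_Spaces.linear s t \<phi> by fact
  note \<phi>_sum = sum
  have V: "vs1.subspace V" and fin: "fin_dim s V" and hom: "lie_hom g (gl s V) \<rho>"
    using rep by (auto simp: lie_rep_def)
  have \<psi>[simp]: "inv_into V \<phi> (\<phi> v) = v" if "v \<in> V" for v
    using inj that by simp
  have \<rho>': "\<rho>' x (\<phi> v) = \<phi> (\<rho> x v)" if "v \<in> V" for x v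
    using that by (simp add: \<rho>'_def)
  have \<rho>'_out: "\<rho>' x w = 0" if "w \<notin> \<phi> ` V" for x w
    using that by (simp add: \<rho>'_def)
  have \<rho>_gl: "\<rho> x \<in> lie_carrier (gl s V)" if "x \<in> lie_carrier g" for x
    using hom that by (auto simp: lie_hom_def linear_map_on_def)
  have \<rho>_lin: "linear_map_on s V s V (\<rho> x)" if "x \<in> lie_carrier g" for x
    using \<rho>_gl[OF that] by (simp add: gl_def)
  have \<rho>_V: "\<rho> x v \<in> V" if "x \<in> lie_carrier g" "v \<in> V" for x v
    using \<rho>_lin[OF that(1)] that by (simp add: linear_map_on_def)
  have \<rho>_out: "\<rho> x v = 0" if "x \<in> lie_carrier g" "v \<notin> V" for x v
    using \<rho>_gl[OF that(1)] that by (simp add: gl_def)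
  have eqI: "F = G" if "\<And>v. v \<in> V \<Longrightarrow> F (\<phi> v) = G (\<phi> v)" "\<And>w. w \<notin> \<phi> ` V \<Longrightarrow> F w = G w"
    for F G :: "'w \<Rightarrow> 'w"
    using that by (metis (no_types, lifting) ext imageE)
  have sub_im: "vs2.subspace (\<phi> ` U)" if "vs1.subspace U" for U
    using that by (rule subspace_image)
  have sub_pre: "vs1.subspace {v \<in> V. \<phi> v \<in> U}" if "vs2.subspace U" for U
    using that V by (auto simp: vs1.subspace_def vs2.subspace_def add scale zero)
  show rep': "lie_rep g t (\<phi> ` V) \<rho>'"
    unfolding lie_rep_def
  proof (intro conjI)
    show "vector_space t" by unfold_locales
    show "vs2.subspace (\<phi> ` V)" using V by (rule sub_im)
    show "fin_dim t (\<phi> ` V)"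
      using fin unfolding fin_dim_def by (metis finite_imageI span_image)
    have lin: "linear_map_on t (\<phi> ` V) t (\<phi> ` V) (\<rho>' x)" if x: "x \<in> lie_carrier g" for x
      unfolding linear_map_on_def
    proof (intro conjI ballI allI)
      fix w assume "w \<in> \<phi> ` V"
      then obtain v where v: "w = \<phi> v" "v \<in> V" by auto
      then show "\<rho>' x w \<in> \<phi> ` V" using \<rho>_V x by (auto simp: \<rho>')
      show "\<rho>' x (t c w) = t c (\<rho>' x w)" for c
        using v V \<rho>_lin[OF x]
        by (simp add: \<rho>' scale[symmetric] vs1.subspace_scale linear_map_on_def)
      fix w' assume "w' \<in> \<phi> ` V"
      then obtain v' where "w' = \<phi> v'" "v' \<in> V" by auto
      then show "\<rho>' x (w + w') = \<rho>' x w + \<rho>' x w'"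
        using v V \<rho>_lin[OF x]
        by (simp add: \<rho>' add[symmetric] vs1.subspace_add linear_map_on_def)
    qed
    have add': "\<rho> (x + y) = \<rho> x + \<rho> y" and br': "\<rho> (lie_bracket g x y) = (\<rho> x \<circ> \<rho> y) - (\<rho> y \<circ> \<rho> x)"
      if "x \<in> lie_carrier g" "y \<in> lie_carrier g" for x y
      using hom that by (auto simp: lie_hom_def linear_map_on_def gl_def)
    have sc': "\<rho> (lie_scale g c x) = pointwise_scale s c (\<rho> x)" if "x \<in> lie_carrier g" for x c
      using hom that by (auto simp: lie_hom_def linear_map_on_def gl_def)
    show "lie_hom g (gl t (\<phi> ` V)) \<rho>'"
      unfolding lie_hom_def linear_map_on_def
    proof (intro conjI ballI allI)
      fix x assume x: "x \<in> lie_carrier g"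
      show "\<rho>' x \<in> lie_carrier (gl t (\<phi> ` V))"
        using lin[OF x] by (simp add: gl_def \<rho>'_out)
      show "\<rho>' (lie_scale g c x) = lie_scale (gl t (\<phi> ` V)) c (\<rho>' x)" for c
        by (rule eqI) (simp_all add: gl_def sc' x pointwise_scale_def \<rho>' \<rho>'_out scale)
      fix y assume y: "y \<in> lie_carrier g"
      show "\<rho>' (x + y) = \<rho>' x + \<rho>' y"
        by (rule eqI) (simp_all add: add' x y \<rho>' \<rho>'_out add)
      have z0: "\<rho>' z 0 = 0" if "z \<in> lie_carrier g" for z
        using lin[OF that] vs2.subspace_0[OF sub_im[OF V]]
        unfolding linear_map_on_def by (metis vs2.scale_zero_left)
      have "\<rho>' (lie_bracket g x y) = (\<rho>' x \<circ> \<rho>' y) - (\<rho>' y \<circ> \<rho>' x)"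
      proof (rule eqI)
        fix v assume v: "v \<in> V"
        have "\<rho> (lie_bracket g x y) v = \<rho> x (\<rho> y v) - \<rho> y (\<rho> x v)"
          using br'[OF x y] by simp
        then show "\<rho>' (lie_bracket g x y) (\<phi> v) = ((\<rho>' x \<circ> \<rho>' y) - (\<rho>' y \<circ> \<rho>' x)) (\<phi> v)"
          using v x y by (simp add: \<rho>' \<rho>_V diff)
      next
        fix w assume "w \<notin> \<phi> ` V"
        then show "\<rho>' (lie_bracket g x y) w = ((\<rho>' x \<circ> \<rho>' y) - (\<rho>' y \<circ> \<rho>' x)) w"
          using z0 x y by (simp add: \<rho>'_out)
      qed
      then show "\<rho>' (lie_bracket g x y) = lie_bracket (gl t (\<phi> ` V)) (\<rho>' x) (\<rho>' y)"
        by (simp add: gl_def)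
    qed
  qed
  show "faithful g \<rho>'" if "faithful g \<rho>"
    unfolding faithful_def
  proof (rule inj_onI)
    fix x y assume xy: "x \<in> lie_carrier g" "y \<in> lie_carrier g" and eq: "\<rho>' x = \<rho>' y"
    have "\<rho> x v = \<rho> y v" for v
    proof (cases "v \<in> V")
      case True
      then have "\<phi> (\<rho> x v) = \<phi> (\<rho> y v)" using eq \<rho>' by metis
      then show ?thesis using inj xy True \<rho>_V by (meson inj_onD)
    qed (use xy \<rho>_out in simp)
    then have "\<rho> x = \<rho> y" by (rule ext)
    then show "x = y" using that xy by (auto simp: faithful_def dest: inj_onD)
  qed
  have subrep_im: "subrep g t (\<phi> ` V) \<rho>' (\<phi> ` W)" if "subrep g s V \<rho> W" for W
    unfolding subrep_def
  proof (intro conjI ballI)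
    have W: "W \<subseteq> V" "vs1.subspace W" "\<And>x w. x \<in> lie_carrier g \<Longrightarrow> w \<in> W \<Longrightarrow> \<rho> x w \<in> W"
      using that unfolding subrep_def by blast+
    show "\<phi> ` W \<subseteq> \<phi> ` V" using W(1) by (rule image_mono)
    show "vs2.subspace (\<phi> ` W)" using W(2) by (rule sub_im)
    fix x w assume x: "x \<in> lie_carrier g" and "w \<in> \<phi> ` W"
    then obtain v where v: "v \<in> W" "w = \<phi> v" by blast
    then have "\<rho>' x w = \<phi> (\<rho> x v)" using W(1) \<rho>' by blast
    then show "\<rho>' x w \<in> \<phi> ` W" using W(3)[OF x v(1)] by blast
  qed
  have subrep_pre: "subrep g s V \<rho> {v \<in> V. \<phi> v \<in> U}" if "subrep g t (\<phi> ` V) \<rho>' U" for U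
    unfolding subrep_def
  proof (intro conjI ballI)
    have U: "vs2.subspace U" "\<And>x w. x \<in> lie_carrier g \<Longrightarrow> w \<in> U \<Longrightarrow> \<rho>' x w \<in> U"
      using that unfolding subrep_def by blast+
    show "vs1.subspace {v \<in> V. \<phi> v \<in> U}" using U(1) by (rule sub_pre)
    fix x v assume x: "x \<in> lie_carrier g" and v: "v \<in> {v \<in> V. \<phi> v \<in> U}"
    then have "\<rho>' x (\<phi> v) \<in> U" using U(2) by blast
    then show "\<rho> x v \<in> {v \<in> V. \<phi> v \<in> U}" using v x \<rho>' \<rho>_V by simp
  qed blast
  show "semisimple_rep g t (\<phi> ` V) \<rho>'" if ss: "semisimple_rep g s V \<rho>"
  proof -
    obtain \<W> where ds: "direct_sum_of V \<W>" and irr: "\<And>W. W \<in> \<W> \<Longrightarrow> irreducible_subrep g s V \<rho> W"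
      using ss unfolding semisimple_rep_def by blast
    have subW: "subrep g s V \<rho> W" if "W \<in> \<W>" for W
      using irr[OF that] unfolding irreducible_subrep_def by blast
    have WV: "W \<subseteq> V" and W0: "0 \<in> W" if "W \<in> \<W>" for W
      using subW[OF that] vs1.subspace_0 unfolding subrep_def by blast+
    have finW: "finite \<W>" using ds unfolding direct_sum_of_def by (elim conjE)
    have injW: "inj_on ((`) \<phi>) \<W>"
      using WV inj by (intro inj_onI) (metis inj_on_image_eq_iff)
    have "direct_sum_of (\<phi> ` V) ((`) \<phi> ` \<W>)"
      unfolding direct_sum_of_def
    proof (intro conjI allI impI)
      show "finite ((`) \<phi> ` \<W>)" using finW by simp
      have pull: "\<exists>h. (\<forall>W\<in>\<W>. h W \<in> W \<and> f (\<phi> ` W) = \<phi> (h W)) \<and> sum f ((`) \<phi> ` \<W>) = \<phi> (sum h \<W>)"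
        if "\<forall>W\<in>(`) \<phi> ` \<W>. f W \<in> W" for f
      proof -
        have "\<forall>W\<in>\<W>. \<exists>w. w \<in> W \<and> f (\<phi> ` W) = \<phi> w" using that by auto
        then obtain h where h: "\<forall>W\<in>\<W>. h W \<in> W \<and> f (\<phi> ` W) = \<phi> (h W)" by metis
        then have "sum f ((`) \<phi> ` \<W>) = \<phi> (sum h \<W>)"
          using injW by (simp add: sum.reindex \<phi>_sum)
        with h show ?thesis by blast
      qed
      have V_eq: "V = {sum f \<W> |f. \<forall>W\<in>\<W>. f W \<in> W}"
        using ds unfolding direct_sum_of_def by (elim conjE)
      show "\<phi> ` V = {sum f ((`) \<phi> ` \<W>) |f. \<forall>W\<in>(`) \<phi> ` \<W>. f W \<in> W}"
      proof (intro equalityI subsetI)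
        fix w assume "w \<in> \<phi> ` V"
        then obtain f where f: "\<forall>W\<in>\<W>. f W \<in> W" "w = \<phi> (sum f \<W>)" using V_eq by blast
        let ?f = "\<lambda>U. \<phi> (f (inv_into \<W> ((`) \<phi>) U))"
        have "sum ?f ((`) \<phi> ` \<W>) = w"
          using f injW by (simp add: sum.reindex \<phi>_sum)
        moreover have "\<forall>W\<in>(`) \<phi> ` \<W>. ?f W \<in> W" using f injW by simp
        ultimately show "w \<in> {sum f ((`) \<phi> ` \<W>) |f. \<forall>W\<in>(`) \<phi> ` \<W>. f W \<in> W}" by blast
      next
        fix w assume "w \<in> {sum f ((`) \<phi> ` \<W>) |f. \<forall>W\<in>(`) \<phi> ` \<W>. f W \<in> W}"
        then obtain f where "\<forall>W\<in>(`) \<phi> ` \<W>. f W \<in> W" "w = sum f ((`) \<phi> ` \<W>)" by blast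
        with pull obtain h where "\<forall>W\<in>\<W>. h W \<in> W" "w = \<phi> (sum h \<W>)" by metis
        then show "w \<in> \<phi> ` V" using V_eq by blast
      qed
      fix f assume f: "(\<forall>W\<in>(`) \<phi> ` \<W>. f W \<in> W) \<and> sum f ((`) \<phi> ` \<W>) = 0"
      then obtain h where h: "\<forall>W\<in>\<W>. h W \<in> W \<and> f (\<phi> ` W) = \<phi> (h W)" "\<phi> (sum h \<W>) = 0"
        using pull[of f] by auto
      have "sum h \<W> \<in> V" using h V_eq by blast
      then have "sum h \<W> = 0"
        using h(2) inj_onD[OF inj, of "sum h \<W>" 0] zero vs1.subspace_0[OF V] by simp
      then have "\<forall>W\<in>\<W>. h W = 0" using ds h unfolding direct_sum_of_def by blast
      then show "\<forall>W\<in>(`) \<phi> ` \<W>. f W = 0" using h zero by auto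
    qed
    moreover have "irreducible_subrep g t (\<phi> ` V) \<rho>' (\<phi> ` W)" if WW: "W \<in> \<W>" for W
      unfolding irreducible_subrep_def
    proof (intro conjI allI impI)
      have W: "subrep g s V \<rho> W" "W \<noteq> {0}" "\<And>U. subrep g s V \<rho> U \<Longrightarrow> U \<subseteq> W \<Longrightarrow> U = {0} \<or> U = W"
        using irr[OF WW] unfolding irreducible_subrep_def by blast+
      show "subrep g t (\<phi> ` V) \<rho>' (\<phi> ` W)" using W(1) by (rule subrep_im)
      obtain w where w: "w \<in> W" "w \<noteq> 0" using W(2) W0[OF WW] by blast
      then have "w \<in> V" using WV[OF WW] by blast
      then have "\<phi> w \<noteq> 0"
        using inj_onD[OF inj, of w 0] w(2) zero vs1.subspace_0[OF V] by metis
      then show "\<phi> ` W \<noteq> {0}" using w(1) by blast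
      fix U assume U: "subrep g t (\<phi> ` V) \<rho>' U \<and> U \<subseteq> \<phi> ` W"
      have im: "\<phi> ` {v \<in> V. \<phi> v \<in> U} = U"
      proof -
        have "U \<subseteq> \<phi> ` V" using U unfolding subrep_def by blast
        then show ?thesis by auto
      qed
      have "{v \<in> V. \<phi> v \<in> U} \<subseteq> W"
      proof
        fix v assume v: "v \<in> {v \<in> V. \<phi> v \<in> U}"
        then obtain w where "w \<in> W" "\<phi> v = \<phi> w" using U by blast
        then show "v \<in> W" using inj_onD[OF inj, of v w] v WV[OF WW] by blast
      qed
      then have "{v \<in> V. \<phi> v \<in> U} = {0} \<or> {v \<in> V. \<phi> v \<in> U} = W"
        using U W(3) subrep_pre by blast
      then show "U = {0} \<or> U = \<phi> ` W"
      proof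
        assume "{v \<in> V. \<phi> v \<in> U} = {0}"
        with im have "U = \<phi> ` {0}" by simp
        then show ?thesis using zero by simp
      next
        assume "{v \<in> V. \<phi> v \<in> U} = W"
        with im show ?thesis by simp
      qed
    qed
    ultimately have "direct_sum_of (\<phi> ` V) ((`) \<phi> ` \<W>) \<and>
        (\<forall>W\<in>(`) \<phi> ` \<W>. irreducible_subrep g t (\<phi> ` V) \<rho>' W)" by simp
    then show ?thesis unfolding semisimple_rep_def by (rule exI)
  qed
  show "trace_on t (\<phi> ` V) (\<rho>' x \<circ> \<rho>' y) = trace_on s V (\<rho> x \<circ> \<rho> y)"
    if xy: "x \<in> lie_carrier g" "y \<in> lie_carrier g"
  proof -
    obtain C where C: "finite C" "vs1.span C = V" using fin by (auto simp: fin_dim_def)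
    obtain B where BC: "B \<subseteq> C" and indep: "vs1.independent B" and CB: "C \<subseteq> vs1.span B"
      using vs1.maximal_independent_subset[of C] by blast
    have "vs1.span B = vs1.span C"
      using vs1.span_mono[OF BC] vs1.span_minimal[OF CB] by blast
    with C indep finite_subset[OF BC] have B: "finite B" "vs1.independent B" "vs1.span B = V"
      by simp_all
    then have bB: "is_basis s V B" by (simp add: is_basis_def)
    have injB: "inj_on \<phi> B" using inj B(3) vs1.span_superset[of B] by (metis inj_on_subset)
    have indB: "vs2.independent (\<phi> ` B)" using B inj independent_injective_image by blast
    have bB': "is_basis t (\<phi> ` V) (\<phi> ` B)"
      using B indB by (simp add: is_basis_def span_image)
    have BV: "b \<in> V" if "b \<in> B" for b using that B vs1.span_base by blast
    have rep_\<phi>: "vs2.representation (\<phi> ` B) (\<phi> v) (\<phi> b) = vs1.representation B v b"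
      if "v \<in> V" "b \<in> B" for v b
    proof -
      have v: "\<phi> v \<in> vs2.span (\<phi> ` B)" using that B by (simp add: span_image)
      let ?f = "\<lambda>w. if w \<in> \<phi> ` B then vs1.representation B v (inv_into B \<phi> w) else 0"
      have "vs2.representation (\<phi> ` B) (\<phi> v) = ?f"
      proof (rule vs2.representation_eqI[OF indB v])
        show "finite {b. ?f b \<noteq> 0}"
          by (rule finite_subset[of _ "\<phi> ` B"]) (use B in \<open>auto split: if_splits\<close>)
        have "(\<Sum>b | ?f b \<noteq> 0. t (?f b) b) = (\<Sum>b\<in>\<phi> ` B. t (?f b) b)"
          by (rule sum.mono_neutral_left) (use B in \<open>auto split: if_splits\<close>)
        also have "\<dots> = (\<Sum>b\<in>B. t (vs1.representation B v b) (\<phi> b))"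
          using injB by (simp add: sum.reindex)
        also have "\<dots> = \<phi> (\<Sum>b\<in>B. s (vs1.representation B v b) b)"
          by (simp add: \<phi>_sum scale)
        also have "\<dots> = \<phi> v"
          using vs1.sum_representation_eq[of B v B] B that by simp
        finally show "(\<Sum>b | ?f b \<noteq> 0. t (?f b) b) = \<phi> v" .
      qed (auto split: if_splits)
      then show ?thesis using that injB by simp
    qed
    have \<rho>'_lin: "linear_map_on t (\<phi> ` V) t (\<phi> ` V) (\<rho>' z)" if "z \<in> lie_carrier g" for z
    proof -
      have "\<rho>' z \<in> lie_carrier (gl t (\<phi> ` V))"
        using rep' that unfolding lie_rep_def lie_hom_def linear_map_on_def[of "lie_scale g"] by blast
      then show ?thesis by (simp add: gl_def)
    qed
    have lin1: "linear_map_on s V s V (\<rho> x \<circ> \<rho> y)"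
      using \<rho>_lin xy by (intro linear_map_on_comp)
    have lin2: "linear_map_on t (\<phi> ` V) t (\<phi> ` V) (\<rho>' x \<circ> \<rho>' y)"
      using \<rho>'_lin xy by (intro linear_map_on_comp)
    have "trace_on t (\<phi> ` V) (\<rho>' x \<circ> \<rho>' y)
        = (\<Sum>b\<in>B. vs2.representation (\<phi> ` B) (\<rho>' x (\<rho>' y (\<phi> b))) (\<phi> b))"
      using trace_on_eq[OF vs2.vector_space_axioms bB' lin2] injB by (simp add: sum.reindex)
    also have "\<dots> = (\<Sum>b\<in>B. vs1.representation B (\<rho> x (\<rho> y b)) b)"
      using xy BV by (intro sum.cong) (simp_all add: \<rho>' \<rho>_V rep_\<phi>)
    also have "\<dots> = trace_on s V (\<rho> x \<circ> \<rho> y)"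
      using trace_on_eq[OF vs1.vector_space_axioms bB lin1] by simp
    finally show ?thesis .
  qed
qed

lemma fin_dim_embeds:
  fixes s :: "'f::field \<Rightarrow> 'v::ab_group_add \<Rightarrow> 'v"
  assumes "vector_space s" "fin_dim s V"
  obtains \<phi> :: "'v \<Rightarrow> nat \<Rightarrow> 'f" where "Vector_Spaces.linear s seq_scale \<phi>" "inj_on \<phi> V"
proof -
  interpret vector_space s by fact
  have seq: "vector_space (seq_scale :: 'f \<Rightarrow> _)"
    by (intro vector_space_pointwise_scale) (unfold_locales, auto simp: algebra_simps)
  interpret P: vector_space_pair s "seq_scale :: 'f \<Rightarrow> _"
    by (intro vector_space_pair.intro seq) fact
  obtain C where "finite C" "span C = V" using assms by (auto simp: fin_dim_def)
  then obtain B where B: "finite B" "independent B" "V \<subseteq> span B"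
    using maximal_independent_subset[of C] by (metis finite_subset span_mono span_span)
  obtain e :: "'v \<Rightarrow> nat" where e: "inj_on e B"
    using B(1) finite_imp_inj_to_nat_seg by metis
  define \<phi> where "\<phi> = P.construct B (\<lambda>b i. if i = e b then 1 else 0 :: 'f)"
  have lin: "Vector_Spaces.linear s seq_scale \<phi>" unfolding \<phi>_def using B by (intro P.linear_construct)
  interpret \<phi>: Vector_Spaces.linear s seq_scale \<phi> by fact
  have \<phi>b: "\<phi> b = (\<lambda>i. if i = e b then 1 else 0)" if "b \<in> B" for b
    unfolding \<phi>_def using B that by (simp add: P.construct_basis)
  have "v = 0" if "v \<in> span B" "\<phi> v = 0" for v
  proof -
    have v: "v = (\<Sum>b\<in>B. s (representation B v b) b)"
      using sum_representation_eq[of B v B] B that by simp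
    have "representation B v b = 0" if b: "b \<in> B" for b
    proof -
      have "(\<Sum>b\<in>B. seq_scale (representation B v b) (\<phi> b)) = 0"
        using v \<open>\<phi> v = 0\<close> by (metis (no_types, lifting) \<phi>.scale \<phi>.sum sum.cong)
      then have "(\<Sum>b'\<in>B. seq_scale (representation B v b') (\<phi> b')) (e b) = 0" by simp
      moreover have "(\<Sum>b'\<in>A. F b') i = (\<Sum>b'\<in>A. F b' i)" if "finite A"
        for F :: "'v \<Rightarrow> nat \<Rightarrow> 'f" and A i
        using that by (induction A) auto
      ultimately have "(\<Sum>b'\<in>B. representation B v b' * \<phi> b' (e b)) = 0"
        using B by (simp add: pointwise_scale_def)
      moreover have "(\<Sum>b'\<in>B. representation B v b' * \<phi> b' (e b))
          = (\<Sum>b'\<in>B. if b' = b then representation B v b' else 0)"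
        using e b by (intro sum.cong) (auto simp: \<phi>b dest: inj_onD)
      ultimately show ?thesis using B b by simp
    qed
    then show ?thesis using v by simp
  qed
  then have "inj_on \<phi> (span B)"
    by (intro inj_onI) (metis \<phi>.diff eq_iff_diff_eq_0 span_diff)
  then have "inj_on \<phi> V" using B(3) inj_on_subset by blast
  with lin show ?thesis by (rule that)
qed

lemma reductiveI:
  assumes "lie_rep g s V \<rho>" "faithful g \<rho>" "semisimple_rep g s V \<rho>"
  shows "reductive g"
proof -
  have "vector_space s" "fin_dim s V" using assms by (auto simp: lie_rep_def)
  then obtain \<phi> :: "_ \<Rightarrow> nat \<Rightarrow> 'a" where "Vector_Spaces.linear s seq_scale \<phi>" "inj_on \<phi> V"
    by (rule fin_dim_embeds)
  from lie_rep_transport(1-3)[OF this assms(1)] assms(2,3) show ?thesis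
    unfolding reductive_def by blast
qed

lemma trace_formI:
  assumes "lie_rep g s V \<rho>"
    and "\<And>x y. x \<in> lie_carrier g \<Longrightarrow> y \<in> lie_carrier g \<Longrightarrow> \<beta> x y = trace_on s V (\<rho> x \<circ> \<rho> y)"
  shows "trace_form g \<beta>"
proof -
  have "vector_space s" "fin_dim s V" using assms by (auto simp: lie_rep_def)
  then obtain \<phi> :: "_ \<Rightarrow> nat \<Rightarrow> 'a" where "Vector_Spaces.linear s seq_scale \<phi>" "inj_on \<phi> V"
    by (rule fin_dim_embeds)
  note tr = lie_rep_transport[OF this assms(1)]
  show ?thesis
    unfolding trace_form_def
    by (intro exI conjI ballI) (rule tr(1), simp add: tr(4) assms(2))
qed

end

theory Submission
  imports "HOL-Algebra.Algebraic_Closure_Type" Defs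
begin

text \<open>
  The engine is a form of Cartan's criterion: if \<open>x = \<Sum>i. [a i, b i]\<close> in \<open>gl(V)\<close> and every
  \<open>a i\<close> is orthogonal, for the trace form, to all iterated brackets \<open>(ad x)^k (b i)\<close> with
  \<open>k \<ge> 1\<close>, then \<open>x\<close> is nilpotent. It is proved over the algebraic closure of the field.

  Let \<open>V\<close> be a faithful semisimple representation of \<open>g\<close> with trace form \<open>\<beta>\<close>. By Engel's theorem an
  ideal acting by nilpotent operators is zero. The criterion applies to the ideals \<open>z(g) \<inter> [g, g]\<close> and
  \<open>[C, g]\<close>, where \<open>C\<close> is an ideal with \<open>\<beta> = 0\<close> on \<open>C \<times> C\<close>; so the first one is zero and \<open>C\<close> is
  central. It follows that \<open>z(g)\<close> is the orthogonal complement of \<open>[g, g]\<close>, that \<open>\<beta>\<close> is nondegenerate on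
  \<open>[g, g]\<close> and that every ideal in \<open>[g, g]\<close> meets its orthogonal complement trivially, which
  splits \<open>[g, g]\<close> into simple ideals. The adjoint representation of \<open>[g, g]\<close> is then itself faithful and
  semisimple, so the Killing form of \<open>[g, g]\<close> is nondegenerate and its derivations are inner.
  A nondegenerate trace form on \<open>g\<close> is obtained from \<open>\<beta>\<close> on \<open>[g, g]\<close> and characters of \<open>g\<close>.

  Conversely, the trace form of a representation only depends on its composition factors, so a
  nondegenerate one also comes from a semisimple representation, which is faithful because its kernel
  lies in the radical of the form.
\<close>

section \<open>Finite dimensional subspaces\<close>

text \<open>The criterion asks for \<open>k \<ge> 1\<close> only, and this is what makes it
  applicable. If \<open>x\<close> lies in [C, g] with \<open>\<beta>\<close> zero on
  \<open>C\<close>, then \<open>a i\<close> lies in \<open>C\<close> while \<open>b i\<close> need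
  not; one bracket with \<open>x\<close> carries \<open>b i\<close> into \<open>C\<close>. If
  \<open>x\<close> is central, one bracket kills \<open>b i\<close>. Neither the solvable radical
  nor a complement theorem for representations is involved: the bad ideals are removed directly.

  Only the criterion passes to the algebraic closure. Its hypothesis is about traces and its
  conclusion about the vanishing of a power, and both can be read off matrix entries, so the descent
  is elementary; ideals and irreducible subspaces stay over the given field.

  The form \<open>\<beta>\<close> of a faithful semisimple representation may degenerate on the
  centre. If i is a square root of -1 in the field, the matrix diag(1, i) spans a one-dimensional
  reductive algebra with trace form zero, since 1 + i^2 = 0. Hence the nondegenerate form has to be
  assembled anew, whereas nothing goes wrong on [g, g].\<close>

context vector_space
begin

lemma linear_map_on_mono:
  "linear_map_on scale V scale W f \<Longrightarrow> U \<subseteq> V \<Longrightarrow> (\<And>u. u \<in> U \<Longrightarrow> f u \<in> W') \<Longrightarrow>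
    linear_map_on scale U scale W' f"
  unfolding linear_map_on_def by blast

lemma linear_map_on_zero:
  assumes "linear_map_on scale V t W f" "subspace V" "vector_space t"
  shows "f 0 = 0"
proof -
  interpret t: vector_space t by fact
  have "f (scale 0 0) = t 0 (f 0)"
    using assms subspace_0 unfolding linear_map_on_def by blast
  then show ?thesis by simp
qed

lemma linear_map_on_diff:
  assumes "linear_map_on scale V t W f" "subspace V" "x \<in> V" "y \<in> V"
  shows "f (x - y) = f x - f y"
proof -
  have "f ((x - y) + y) = f (x - y) + f y"
    using assms subspace_diff unfolding linear_map_on_def by blast
  then show ?thesis by simp
qed

lemma linear_map_on_sum:
  assumes "linear_map_on scale V t W f" "subspace V" "vector_space t" "\<And>i. i \<in> I \<Longrightarrow> v i \<in> V"
  shows "f (\<Sum>i\<in>I. v i) = (\<Sum>i\<in>I. f (v i))"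
  using assms(4)
proof (induction I rule: infinite_finite_induct)
  case (insert i I)
  then have "v i \<in> V" "(\<Sum>i\<in>I. v i) \<in> V" using assms(2) by (auto intro: subspace_sum)
  then have "f (v i + (\<Sum>i\<in>I. v i)) = f (v i) + f (\<Sum>i\<in>I. v i)"
    using assms(1) unfolding linear_map_on_def by blast
  then show ?case using insert by simp
qed (use linear_map_on_zero[OF assms(1-3)] in auto)

lemma extend_basis_on:
  assumes V: "fin_dim scale V" and "subspace W" "W \<subseteq> V"
  obtains B C where "is_basis scale W B" "is_basis scale V C" "B \<subseteq> C"
proof -
  obtain T where T: "finite T" "span T = V" using V by (auto simp: fin_dim_def)
  obtain B where B: "B \<subseteq> W" "independent B" "W \<subseteq> span B"
    using maximal_independent_subset by blast
  have spB: "span B = W" using B \<open>subspace W\<close> by (metis span_minimal subset_antisym)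
  have BV: "B \<subseteq> V" using B assms by blast
  obtain C where C: "B \<subseteq> C" "C \<subseteq> V" "independent C" "V \<subseteq> span C"
    using maximal_independent_subset_extend[OF BV B(2)] by blast
  have "subspace V" using T by auto
  then have spC: "span C = V" using C by (metis span_minimal subset_antisym)
  have "finite C" using independent_span_bound[OF T(1) C(3)] C(2) T(2) by blast
  with B C spB spC show ?thesis
    by (intro that[of B C]) (auto simp: is_basis_def finite_subset)
qed

lemma fin_dim_obtain_basis:
  assumes "fin_dim scale V"
  obtains B where "is_basis scale V B"
proof -
  have "subspace V" using assms by (auto simp: fin_dim_def)
  then show ?thesis using extend_basis_on[OF assms, of V] that by blast
qed

lemma is_basis_fin_dim: "is_basis scale V B \<Longrightarrow> fin_dim scale V"
  by (auto simp: is_basis_def fin_dim_def)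

lemma is_basis_in: "is_basis scale V B \<Longrightarrow> b \<in> B \<Longrightarrow> b \<in> V"
  using span_base by (auto simp: is_basis_def)

lemma is_basis_expand:
  "is_basis scale V B \<Longrightarrow> v \<in> V \<Longrightarrow> (\<Sum>b\<in>B. scale (representation B v b) b) = v"
  using sum_representation_eq[of B v B] by (auto simp: is_basis_def)

lemma fin_dim_subspace: "fin_dim scale V \<Longrightarrow> subspace W \<Longrightarrow> W \<subseteq> V \<Longrightarrow> fin_dim scale W"
  by (meson extend_basis_on is_basis_fin_dim)

lemma fin_dim_imp_subspace: "fin_dim scale V \<Longrightarrow> subspace V"
  by (auto simp: fin_dim_def)

lemma dim_less:
  assumes V: "fin_dim scale V" and "subspace W" "W \<subset> V"
  shows "dim W < dim V"
proof -
  obtain B C where BC: "is_basis scale W B" "is_basis scale V C" "B \<subseteq> C"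
    using extend_basis_on[of V W] assms by blast
  then have "B \<noteq> C" using assms by (auto simp: is_basis_def)
  then have "card B < card C" using BC by (auto simp: is_basis_def psubset_card_mono)
  moreover have "dim W = card B" "dim V = card C"
    using BC dim_span_eq_card_independent by (auto simp: is_basis_def)
  ultimately show ?thesis by simp
qed

lemma dim_le: "fin_dim scale V \<Longrightarrow> subspace W \<Longrightarrow> W \<subseteq> V \<Longrightarrow> dim W \<le> dim V"
  using dim_less by (metis less_imp_le order.order_iff_strict)

text \<open>Finite dimension takes the place of Zorn's lemma: a member of largest dimension is
  maximal, because a strict inclusion raises the dimension.\<close>

lemma maximal_subspace:
  assumes "fin_dim scale V" "P W0" "\<And>W. P W \<Longrightarrow> subspace W \<and> W \<subseteq> V"
  obtains W where "P W" "\<And>U. P U \<Longrightarrow> W \<subseteq> U \<Longrightarrow> U = W"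
proof -
  have "\<forall>W. P W \<longrightarrow> dim W < Suc (dim V)"
    using dim_le assms by (metis less_Suc_eq_le)
  then obtain W where W: "P W" "\<And>U. P U \<Longrightarrow> dim U \<le> dim W"
    using ex_has_greatest_nat[of P W0 dim "Suc (dim V)"] assms(2) by blast
  show ?thesis
  proof (rule that[OF W(1)])
    fix U assume U: "P U" "W \<subseteq> U"
    have fU: "fin_dim scale U" using fin_dim_subspace[OF assms(1)] assms(3)[OF U(1)] by blast
    show "U = W"
    proof (rule ccontr)
      assume "U \<noteq> W"
      then have "dim W < dim U" using dim_less[OF fU, of W] U assms(3)[OF W(1)] by blast
      then show False using W(2)[OF U(1)] by simp
    qed
  qed
qed

lemma minimal_subspace:
  assumes "fin_dim scale V" "P W0" "\<And>W. P W \<Longrightarrow> subspace W \<and> W \<subseteq> V"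
  obtains W where "P W" "\<And>U. P U \<Longrightarrow> U \<subseteq> W \<Longrightarrow> U = W"
proof -
  obtain W where W: "P W" "\<And>U. P U \<Longrightarrow> dim W \<le> dim U"
    using ex_has_least_nat[of P W0 dim] assms(2) by blast
  show ?thesis
  proof (rule that[OF W(1)])
    fix U assume U: "P U" "U \<subseteq> W"
    have fW: "fin_dim scale W" using fin_dim_subspace[OF assms(1)] assms(3)[OF W(1)] by blast
    show "U = W"
    proof (rule ccontr)
      assume "U \<noteq> W"
      then have "dim U < dim W" using dim_less[OF fW, of U] U assms(3)[OF U(1)] by blast
      then show False using W(2)[OF U(1)] by simp
    qed
  qed
qed

lemma independent_card_dim_spans:
  assumes "is_basis scale V B" "independent C" "C \<subseteq> V" "card B \<le> card C"
  shows "span C = V"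
proof (rule ccontr)
  assume neq: "span C \<noteq> V"
  have V: "fin_dim scale V" "subspace V" using assms(1) is_basis_fin_dim fin_dim_imp_subspace by blast+
  then have "span C \<subset> V" using assms(3) neq by (metis psubsetI span_minimal)
  from dim_less[OF V(1) _ this] have "dim (span C) < dim V" by simp
  moreover have "dim V = card B" "dim (span C) = card C"
    using dim_span_eq_card_independent assms(1,2) by (auto simp: is_basis_def)
  ultimately show False using assms by simp
qed

text \<open>\<open>p\<close> is the projection onto the complement \<open>p ` V\<close> of \<open>W\<close>.\<close>

lemma projection_along:
  assumes V: "fin_dim scale V" and W: "subspace W" "W \<subseteq> V"
  obtains p where "linear_map_on scale V scale V p" "\<And>v. v \<in> V \<Longrightarrow> p (p v) = p v"
    "\<And>v. v \<in> V \<Longrightarrow> p v = 0 \<longleftrightarrow> v \<in> W"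
proof -
  obtain B C where BC: "is_basis scale W B" "is_basis scale V C" "B \<subseteq> C"
    using extend_basis_on[OF V W] by blast
  have C: "independent C" "finite C" "span C = V" and B: "independent B" "finite B" "span B = W"
    using BC by (auto simp: is_basis_def)
  define p where "p v = (\<Sum>b\<in>C - B. scale (representation C v b) b)" for v
  have subV: "subspace V" using C by auto
  have CV: "b \<in> V" if "b \<in> C" for b using that is_basis_in[OF BC(2)] by blast
  have pV: "p v \<in> V" for v unfolding p_def
    by (intro subspace_sum subspace_scale) (use CV subV in auto)
  have lin: "linear_map_on scale V scale V p"
    unfolding linear_map_on_def
  proof (intro conjI ballI allI)
    fix x y assume "x \<in> V" "y \<in> V"
    then show "p (x + y) = p x + p y"
      using C unfolding p_def by (simp add: representation_add scale_left_distrib sum.distrib)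
  next
    fix x c assume "x \<in> V"
    then show "p (scale c x) = scale c (p x)"
      using C unfolding p_def by (simp add: representation_scale scale_sum_right)
  qed (rule pV)
  have split: "v = (\<Sum>b\<in>B. scale (representation C v b) b) + p v" if "v \<in> V" for v
    using is_basis_expand[OF BC(2) that] sum.subset_diff[OF BC(3) C(2), of "\<lambda>b. scale (representation C v b) b"]
    unfolding p_def by (simp add: add.commute)
  have inW: "(\<Sum>b\<in>B. scale (representation C v b) b) \<in> W" for v
    by (intro subspace_sum subspace_scale) (use is_basis_in[OF BC(1)] W in auto)
  have pW: "p w = 0" if "w \<in> W" for w
  proof -
    have "representation C w c = 0" if "c \<in> C - B" for c
    proof -
      have "representation C w = representation B w"
        using representation_extend[OF C(1) _ BC(3)] \<open>w \<in> W\<close> B by simp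
      then show ?thesis using representation_ne_zero[of B w c] that by auto
    qed
    then show ?thesis unfolding p_def by simp
  qed
  show ?thesis
  proof (rule that[OF lin])
    fix v assume v: "v \<in> V"
    have "v - p v \<in> W" using split[OF v] inW[of v] by (metis add_diff_cancel_right')
    then have "p (v - p v) = 0" by (rule pW)
    then show "p (p v) = p v" using linear_map_on_diff[OF lin subV v pV[of v]] by simp
    show "p v = 0 \<longleftrightarrow> v \<in> W" using pW split[OF v] inW[of v] by auto
  qed
qed

lemma subspace_image_on:
  assumes f: "linear_map_on scale V t W f" and t: "vector_space t" and subV: "subspace V" and U: "subspace U" "U \<subseteq> V"
  shows "module.subspace t (f ` U)"
proof -
  interpret t: vector_space t by fact
  have add: "f (x + y) = f x + f y" and scl: "f (scale c x) = t c (f x)"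
    if "x \<in> U" "y \<in> U" for x y c using f U that by (auto simp: linear_map_on_def subset_iff)
  show ?thesis
  proof (rule t.subspaceI)
    show "0 \<in> f ` U" using linear_map_on_zero[OF f subV t] subspace_0[OF U(1)] by force
    show "x + y \<in> f ` U" if "x \<in> f ` U" "y \<in> f ` U" for x y
      using that add subspace_add[OF U(1)] by (auto simp: image_iff) metis
    show "t c x \<in> f ` U" if "x \<in> f ` U" for c x
      using that scl subspace_scale[OF U(1)] by (auto simp: image_iff) metis
  qed
qed

lemma fin_dim_image_on:
  assumes f: "linear_map_on scale V t W f" and t: "vector_space t" and V: "fin_dim scale V"
  shows "fin_dim t (f ` V)"
proof -
  interpret t: vector_space t by fact
  obtain B where B: "is_basis scale V B" using fin_dim_obtain_basis[OF V] .
  have subV: "subspace V" using V by (rule fin_dim_imp_subspace)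
  have BV: "b \<in> V" if "b \<in> B" for b using is_basis_in[OF B that] .
  have "t.span (f ` B) \<subseteq> f ` V"
    using subspace_image_on[OF f t subV subV] BV by (intro t.span_minimal) auto
  moreover have "f v \<in> t.span (f ` B)" if "v \<in> V" for v
  proof -
    have "f v = f (\<Sum>b\<in>B. scale (representation B v b) b)" using is_basis_expand[OF B that] by simp
    also have "\<dots> = (\<Sum>b\<in>B. f (scale (representation B v b) b))"
      by (rule linear_map_on_sum[OF f subV t]) (use BV subV subspace_scale in auto)
    also have "\<dots> = (\<Sum>b\<in>B. t (representation B v b) (f b))"
      using f BV by (simp add: linear_map_on_def)
    also have "\<dots> \<in> t.span (f ` B)" by (intro t.span_sum t.span_scale t.span_base) auto
    finally show ?thesis .
  qed
  ultimately show ?thesis using B unfolding fin_dim_def is_basis_def by (intro exI[of _ "f ` B"]) auto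
qed

subsection \<open>Traces\<close>

lemma representation_sum_scale:
  assumes "independent B" "\<And>i. i \<in> I \<Longrightarrow> v i \<in> span B"
  shows "representation B (\<Sum>i\<in>I. scale (a i) (v i)) b = (\<Sum>i\<in>I. a i * representation B (v i) b)"
proof -
  have "representation B (\<Sum>i\<in>I. scale (a i) (v i)) b = (\<Sum>i\<in>I. representation B (scale (a i) (v i)) b)"
    using assms by (subst representation_sum) (auto intro: span_scale)
  also have "\<dots> = (\<Sum>i\<in>I. a i * representation B (v i) b)"
    using assms by (intro sum.cong) (auto simp: representation_scale)
  finally show ?thesis .
qed

text \<open>Both traces are computed in the one basis that \<open>trace_on\<close> chooses for
  \<open>V\<close>, so agreement on \<open>V\<close> suffices even for maps that are not
  linear.\<close>

lemma trace_on_cong: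
  assumes "fin_dim scale V" "\<And>v. v \<in> V \<Longrightarrow> f v = h v"
  shows "trace_on scale V f = trace_on scale V h"
proof -
  have "is_basis scale V (SOME B. is_basis scale V B)"
    using fin_dim_obtain_basis[OF assms(1)] by (metis someI_ex)
  then show ?thesis
    unfolding trace_on_def Let_def using assms(2) is_basis_in by (intro sum.cong) auto
qed

lemma trace_on_add:
  assumes V: "fin_dim scale V" and "linear_map_on scale V scale V f" "linear_map_on scale V scale V h"
  shows "trace_on scale V (\<lambda>x. f x + h x) = trace_on scale V f + trace_on scale V h"
proof -
  obtain B where B: "is_basis scale V B" using fin_dim_obtain_basis[OF V] .
  have lin: "linear_map_on scale V scale V (\<lambda>x. f x + h x)"
    using assms fin_dim_imp_subspace[OF V] subspace_add
    unfolding linear_map_on_def by (auto simp: scale_right_distrib)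
  show ?thesis
    using B assms is_basis_in[OF B]
    unfolding trace_on_eq[OF vector_space_axioms B lin] trace_on_eq[OF vector_space_axioms B assms(2)]
      trace_on_eq[OF vector_space_axioms B assms(3)]
    by (simp add: is_basis_def linear_map_on_def representation_add sum.distrib)
qed

lemma trace_on_scale:
  assumes V: "fin_dim scale V" and "linear_map_on scale V scale V f"
  shows "trace_on scale V (\<lambda>x. scale c (f x)) = c * trace_on scale V f"
proof -
  obtain B where B: "is_basis scale V B" using fin_dim_obtain_basis[OF V] .
  have lin: "linear_map_on scale V scale V (\<lambda>x. scale c (f x))"
    using assms fin_dim_imp_subspace[OF V] subspace_scale
    unfolding linear_map_on_def by (auto simp: scale_right_distrib mult.commute)
  show ?thesis
    using B assms is_basis_in[OF B]
    unfolding trace_on_eq[OF vector_space_axioms B lin] trace_on_eq[OF vector_space_axioms B assms(2)]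
    by (simp add: is_basis_def linear_map_on_def representation_scale sum_distrib_left)
qed

lemma trace_on_diff:
  assumes V: "fin_dim scale V" and "linear_map_on scale V scale V f" "linear_map_on scale V scale V h"
  shows "trace_on scale V (\<lambda>x. f x - h x) = trace_on scale V f - trace_on scale V h"
proof -
  have lin: "linear_map_on scale V scale V (\<lambda>x. f x - h x)"
    using assms fin_dim_imp_subspace[OF V] subspace_diff
    unfolding linear_map_on_def by (auto simp: scale_right_diff_distrib)
  show ?thesis using trace_on_add[OF V lin assms(3)] by simp
qed

lemma trace_on_zero: "trace_on scale V (\<lambda>x. 0) = 0"
  by (simp add: trace_on_def Let_def representation_zero)

lemma trace_on_sum:
  assumes V: "fin_dim scale V" and f: "\<And>i. i \<in> I \<Longrightarrow> linear_map_on scale V scale V (f i)"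
  shows "trace_on scale V (\<lambda>x. \<Sum>i\<in>I. f i x) = (\<Sum>i\<in>I. trace_on scale V (f i))"
  using f
proof (induction I rule: infinite_finite_induct)
  case (insert i I)
  have "linear_map_on scale V scale V (\<lambda>x. \<Sum>i\<in>I. f i x)"
    using insert.prems fin_dim_imp_subspace[OF V]
    unfolding linear_map_on_def by (auto intro!: subspace_sum simp: sum.distrib scale_sum_right)
  then show ?case using insert by (simp add: trace_on_add[OF V])
qed (auto simp: trace_on_zero)

text \<open>Allowing two different spaces gives more than cyclicity: the trace of a map that factors
  through a smaller space can be computed on that space.\<close>

lemma trace_on_comp_commute:
  assumes V: "fin_dim scale V" and W: "fin_dim scale W"
    and f: "linear_map_on scale V scale W f" and h: "linear_map_on scale W scale V h"
  shows "trace_on scale V (h \<circ> f) = trace_on scale W (f \<circ> h)"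
proof -
  obtain B where B: "is_basis scale V B" using fin_dim_obtain_basis[OF V] .
  obtain C where C: "is_basis scale W C" using fin_dim_obtain_basis[OF W] .
  have half: "(\<Sum>b\<in>B. representation B (h (f b)) b)
      = (\<Sum>b\<in>B. \<Sum>c\<in>C. representation C (f b) c * representation B (h c) b)"
    if B: "is_basis scale V B" and C: "is_basis scale W C"
      and f: "linear_map_on scale V scale W f" and h: "linear_map_on scale W scale V h"
    for B C f h V W
  proof (intro sum.cong refl)
    fix b assume "b \<in> B"
    then have fb: "f b \<in> W" using f is_basis_in[OF B] by (auto simp: linear_map_on_def)
    have subW: "subspace W" using C by (auto simp: is_basis_def)
    have CW: "c \<in> W" if "c \<in> C" for c using that is_basis_in[OF C] by blast
    have "h (f b) = h (\<Sum>c\<in>C. scale (representation C (f b) c) c)"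
      using is_basis_expand[OF C fb] by simp
    also have "\<dots> = (\<Sum>c\<in>C. h (scale (representation C (f b) c) c))"
      by (rule linear_map_on_sum[OF h subW vector_space_axioms]) (use CW subW subspace_scale in auto)
    also have "\<dots> = (\<Sum>c\<in>C. scale (representation C (f b) c) (h c))"
      using h CW unfolding linear_map_on_def by simp
    finally show "representation B (h (f b)) b = (\<Sum>c\<in>C. representation C (f b) c * representation B (h c) b)"
      using B h CW by (simp add: representation_sum_scale is_basis_def linear_map_on_def)
  qed
  have "trace_on scale V (h \<circ> f) = (\<Sum>b\<in>B. representation B (h (f b)) b)"
    using trace_on_eq[OF vector_space_axioms B linear_map_on_comp[OF f h]] by simp
  also have "\<dots> = (\<Sum>b\<in>B. \<Sum>c\<in>C. representation B (h c) b * representation C (f b) c)"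
    using half[OF B C f h] by (simp add: mult.commute)
  also have "\<dots> = (\<Sum>c\<in>C. \<Sum>b\<in>B. representation B (h c) b * representation C (f b) c)"
    by (rule sum.swap)
  also have "\<dots> = (\<Sum>c\<in>C. representation C (f (h c)) c)"
    using half[OF C B h f] by simp
  also have "\<dots> = trace_on scale W (f \<circ> h)"
    using trace_on_eq[OF vector_space_axioms C linear_map_on_comp[OF h f]] by simp
  finally show ?thesis .
qed

text \<open>With \<open>q v = v - p v\<close>, the projection to \<open>W\<close>, the map is the
  sum of \<open>f \<circ> q\<close> and \<open>f \<circ> p\<close>. The first factors through
  \<open>W\<close>, the second through the range of \<open>p\<close>, a model of V / W, and each
  trace moves there by commuting the two factors.\<close>

lemma trace_on_split:
  assumes V: "fin_dim scale V" and f: "linear_map_on scale V scale V f"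
    and W: "subspace W" "W \<subseteq> V" "\<And>w. w \<in> W \<Longrightarrow> f w \<in> W"
    and p: "linear_map_on scale V scale V p" "\<And>v. v \<in> V \<Longrightarrow> p (p v) = p v"
      "\<And>v. v \<in> V \<Longrightarrow> p v = 0 \<longleftrightarrow> v \<in> W"
  shows "trace_on scale V f = trace_on scale W f + trace_on scale (p ` V) (p \<circ> f)"
proof -
  have subV: "subspace V" using V by (rule fin_dim_imp_subspace)
  have pV: "p v \<in> V" if "v \<in> V" for v using p(1) that by (simp add: linear_map_on_def)
  have padd: "p (x + y) = p x + p y" and pscale: "p (scale c x) = scale c (p x)"
    if "x \<in> V" "y \<in> V" for x y c using p(1) that by (auto simp: linear_map_on_def)
  have subC: "subspace (p ` V)" using subspace_image_on[OF p(1) vector_space_axioms subV subV] by simp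
  have CV: "p ` V \<subseteq> V" using pV by blast
  have fW: "fin_dim scale W" and fC: "fin_dim scale (p ` V)"
    using fin_dim_subspace[OF V] W subC CV by blast+
  define q where "q v = v - p v" for v
  have q: "linear_map_on scale V scale W q"
    unfolding linear_map_on_def q_def
  proof (intro conjI ballI allI)
    fix x assume x: "x \<in> V"
    then have "p (x - p x) = 0" using linear_map_on_diff[OF p(1) subV] pV p(2) by simp
    then show "x - p x \<in> W" using p(3) x pV subspace_diff[OF subV] by blast
    show "scale c x - p (scale c x) = scale c (x - p x)" for c
      using x by (simp add: pscale scale_right_diff_distrib)
    fix y assume "y \<in> V"
    then show "x + y - p (x + y) = x - p x + (y - p y)" using x by (simp add: padd)
  qed
  have fp: "linear_map_on scale V scale V (f \<circ> p)" using linear_map_on_comp[OF p(1) f] .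
  have qV: "linear_map_on scale V scale V q" using linear_map_on_mono[OF q, of V V] q W by (auto simp: linear_map_on_def)
  have fq: "linear_map_on scale V scale V (f \<circ> q)" using linear_map_on_comp[OF qV f] .
  have "f v = (f \<circ> q) v + (f \<circ> p) v" if "v \<in> V" for v
    using linear_map_on_diff[OF f subV that pV[OF that]] by (simp add: q_def)
  then have "trace_on scale V f = trace_on scale V (f \<circ> q) + trace_on scale V (f \<circ> p)"
    using trace_on_cong[OF V, of f "\<lambda>v. (f \<circ> q) v + (f \<circ> p) v"] trace_on_add[OF V fq fp] by simp
  also have "trace_on scale V (f \<circ> q) = trace_on scale W (q \<circ> f)"
    by (rule trace_on_comp_commute[OF V fW q]) (rule linear_map_on_mono[OF f], use W f in \<open>auto simp: linear_map_on_def\<close>)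
  also have "\<dots> = trace_on scale W f"
    by (rule trace_on_cong[OF fW]) (use W p(3) in \<open>auto simp: q_def subset_iff\<close>)
  also have "trace_on scale V (f \<circ> p) = trace_on scale (p ` V) (p \<circ> f)"
    by (rule trace_on_comp_commute[OF V fC linear_map_on_mono[OF p(1)] linear_map_on_mono[OF f CV]])
       (use CV f in \<open>auto simp: linear_map_on_def\<close>)
  finally show ?thesis .
qed

end

section \<open>Polynomials in an operator\<close>

definition poly_op :: "('a::field \<Rightarrow> 'b::ab_group_add \<Rightarrow> 'b) \<Rightarrow> 'a poly \<Rightarrow> ('b \<Rightarrow> 'b) \<Rightarrow> 'b \<Rightarrow> 'b" where
  "poly_op s p T v = (\<Sum>k\<le>degree p. s (coeff p k) ((T ^^ k) v))"

context vector_space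
begin

lemma poly_op_bound:
  assumes "degree p \<le> n"
  shows "poly_op scale p T v = (\<Sum>k\<le>n. scale (coeff p k) ((T ^^ k) v))"
  unfolding poly_op_def
  by (rule sum.mono_neutral_left) (use assms in \<open>auto simp: coeff_eq_0 not_le\<close>)

lemma poly_op_0 [simp]: "poly_op scale 0 T v = 0"
  by (simp add: poly_op_def)

lemma poly_op_add: "poly_op scale (p + q) T v = poly_op scale p T v + poly_op scale q T v"
proof -
  let ?n = "max (degree p) (degree q)"
  have "poly_op scale (p + q) T v = (\<Sum>k\<le>?n. scale (coeff (p + q) k) ((T ^^ k) v))"
    by (rule poly_op_bound) (rule degree_add_le_max)
  also have "\<dots> = poly_op scale p T v + poly_op scale q T v"
    by (simp add: poly_op_bound[of p ?n] poly_op_bound[of q ?n] scale_left_distrib sum.distrib)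
  finally show ?thesis .
qed

lemma poly_op_smult: "poly_op scale (smult c p) T v = scale c (poly_op scale p T v)"
  by (subst poly_op_bound[OF degree_smult_le]) (simp add: poly_op_def scale_sum_right)

lemma poly_op_diff: "poly_op scale (p - q) T v = poly_op scale p T v - poly_op scale q T v"
  using poly_op_add[of "p - q" q T v] by simp

lemma poly_op_sum: "poly_op scale (\<Sum>i\<in>I. p i) T v = (\<Sum>i\<in>I. poly_op scale (p i) T v)"
  by (induction I rule: infinite_finite_induct) (simp_all add: poly_op_add)

lemma poly_op_pCons: "poly_op scale (pCons c q) T v = scale c v + poly_op scale q T (T v)"
proof -
  have "poly_op scale (pCons c q) T v = (\<Sum>k\<le>Suc (degree q). scale (coeff (pCons c q) k) ((T ^^ k) v))"
    by (rule poly_op_bound) (simp add: degree_pCons_le)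
  also have "\<dots> = scale c v + (\<Sum>k\<le>degree q. scale (coeff q k) ((T ^^ k) (T v)))"
    by (simp add: sum.atMost_Suc_shift funpow_swap1 del: sum.atMost_Suc)
  finally show ?thesis by (simp add: poly_op_def)
qed

lemma poly_op_const: "poly_op scale [:c:] T v = scale c v"
  by (simp add: poly_op_pCons)

lemma poly_op_1 [simp]: "poly_op scale 1 T v = v"
  by (simp add: one_pCons poly_op_const)

lemma poly_op_root: "poly_op scale [:-c, 1:] T v = T v - scale c v"
  by (simp add: poly_op_pCons)

lemma poly_op_in:
  assumes "subspace U" "\<And>k. (T ^^ k) v \<in> U"
  shows "poly_op scale p T v \<in> U"
  unfolding poly_op_def using assms by (intro subspace_sum subspace_scale)

lemma funpow_in: "(\<And>u. u \<in> U \<Longrightarrow> T u \<in> U) \<Longrightarrow> v \<in> U \<Longrightarrow> (T ^^ k) v \<in> U"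
  by (induction k) auto

lemma poly_op_invariant:
  "subspace U \<Longrightarrow> (\<And>u. u \<in> U \<Longrightarrow> T u \<in> U) \<Longrightarrow> v \<in> U \<Longrightarrow> poly_op scale p T v \<in> U"
  by (intro poly_op_in funpow_in)

lemma linear_map_on_funpow:
  "linear_map_on scale V scale V T \<Longrightarrow> linear_map_on scale V scale V (T ^^ k)"
  by (induction k) (auto simp: linear_map_on_def)

context
  fixes V T
  assumes subV: "subspace V" and T: "linear_map_on scale V scale V T"
begin

lemma poly_op_in_V: "v \<in> V \<Longrightarrow> poly_op scale p T v \<in> V"
  using poly_op_invariant[OF subV] T by (simp add: linear_map_on_def)

lemma linear_map_on_poly_op: "linear_map_on scale V scale V (poly_op scale p T)"
  unfolding linear_map_on_def
proof (intro conjI ballI allI)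
  have pow: "(T ^^ k) (x + y) = (T ^^ k) x + (T ^^ k) y" "(T ^^ k) (scale c x) = scale c ((T ^^ k) x)"
    if "x \<in> V" "y \<in> V" for k x y c
    using linear_map_on_funpow[OF T, of k] that by (auto simp: linear_map_on_def)
  fix x assume x: "x \<in> V"
  then show "poly_op scale p T x \<in> V" by (rule poly_op_in_V)
  show "poly_op scale p T (scale c x) = scale c (poly_op scale p T x)" for c
    using x by (simp add: poly_op_def pow scale_sum_right mult.commute)
  fix y assume "y \<in> V"
  then show "poly_op scale p T (x + y) = poly_op scale p T x + poly_op scale p T y"
    using x by (simp add: poly_op_def pow scale_right_distrib sum.distrib)
qed

lemma poly_op_commute:
  assumes "v \<in> V"
  shows "poly_op scale p T (T v) = T (poly_op scale p T v)"
proof -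
  have inV: "(T ^^ k) v \<in> V" for k
    using funpow_in[of V T v k] T assms by (simp add: linear_map_on_def)
  have "T (poly_op scale p T v) = (\<Sum>k\<le>degree p. T (scale (coeff p k) ((T ^^ k) v)))"
    unfolding poly_op_def
    by (rule linear_map_on_sum[OF T subV vector_space_axioms]) (use inV subV subspace_scale in auto)
  also have "\<dots> = (\<Sum>k\<le>degree p. scale (coeff p k) (T ((T ^^ k) v)))"
    using T inV by (simp add: linear_map_on_def)
  finally show ?thesis by (simp add: poly_op_def funpow_swap1)
qed

text \<open>Composing the two evaluations moves \<open>T\<close> past sums and scalars, which is
  legitimate on \<open>V\<close> only; hence the restriction on \<open>v\<close>.\<close>

lemma poly_op_mult:
  "v \<in> V \<Longrightarrow> poly_op scale (p * q) T v = poly_op scale p T (poly_op scale q T v)"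
proof (induction p arbitrary: v)
  case (pCons c p)
  have "T v \<in> V" using pCons.prems T by (simp add: linear_map_on_def)
  then show ?case
    using pCons.prems
    by (simp add: pCons.IH poly_op_add poly_op_smult poly_op_pCons poly_op_commute[symmetric] poly_op_in_V)
qed simp

lemma poly_op_dvd:
  assumes "p dvd q" "poly_op scale p T v = 0" "v \<in> V"
  shows "poly_op scale q T v = 0"
proof -
  obtain r where "q = r * p" using assms(1) by (metis dvdE mult.commute)
  then show ?thesis
    using assms linear_map_on_zero[OF linear_map_on_poly_op subV vector_space_axioms]
    by (simp add: poly_op_mult)
qed

lemma poly_op_power_root:
  "v \<in> V \<Longrightarrow> poly_op scale ([:-c, 1:] ^ m) T v = ((\<lambda>w. T w - scale c w) ^^ m) v"
proof (induction m arbitrary: v)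
  case (Suc m)
  have "T v - scale c v \<in> V"
    using Suc.prems T subV by (auto simp: linear_map_on_def intro!: subspace_diff subspace_scale)
  then have "poly_op scale ([:-c, 1:] ^ m) T (T v - scale c v) = ((\<lambda>w. T w - scale c w) ^^ Suc m) v"
    by (simp only: Suc.IH funpow_Suc_right o_apply)
  moreover have "poly_op scale ([:-c, 1:] ^ Suc m) T v = poly_op scale ([:-c, 1:] ^ m * [:-c, 1:]) T v"
    by (simp only: power_Suc mult.commute)
  ultimately show ?case by (simp only: poly_op_mult[OF Suc.prems] poly_op_root)
qed simp

end

end

section \<open>The Chinese remainder theorem for powers of linear polynomials\<close>

lemma coprime_root_powers:
  fixes a c :: "'k::field_gcd"
  assumes "a \<noteq> c"
  shows "coprime ([:-c, 1:] ^ m) ([:-a, 1:] ^ n)"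
proof -
  have unit: "is_unit [:a - c:]"
    using assms by (simp add: is_unit_const_poly_iff dvd_field_iff)
  have "coprime [:-c, 1:] [:-a, 1:]"
  proof (rule coprimeI)
    fix d assume "d dvd [:-c, 1:]" "d dvd [:-a, 1:]"
    then have "d dvd [:-c, 1:] - [:-a, 1:]" by (rule dvd_diff)
    then have "d dvd [:a - c:]" by simp
    then show "is_unit d" using unit by (rule dvd_trans)
  qed
  then show ?thesis by simp
qed

text \<open>Evaluated at an operator, such a \<open>p\<close> acts as the scalar \<open>f a\<close>
  on the vectors killed by the m-th power of the operator minus \<open>a\<close>. All operators that
  have to be prescribed on generalised eigenspaces are obtained from it.\<close>

lemma chinese_remainder_constants:
  fixes f :: "'k::field_gcd \<Rightarrow> 'k"
  assumes "finite S"
  shows "\<exists>p. \<forall>a\<in>S. [:-a, 1:] ^ m dvd p - [:f a:]"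
  using assms
proof (induction S)
  case (insert c S)
  then obtain p where p: "\<forall>a\<in>S. [:-a, 1:] ^ m dvd p - [:f a:]" by blast
  define q where "q = (\<Prod>a\<in>S. [:-a, 1:] ^ m)"
  have "coprime ([:-c, 1:] ^ m) ([:-a, 1:] ^ m)" if "a \<in> S" for a
    using insert that by (intro coprime_root_powers) auto
  then have "coprime ([:-c, 1:] ^ m) q"
    unfolding q_def by (intro prod_coprime_right) auto
  then obtain u v where uv: "u * [:-c, 1:] ^ m + v * q = 1"
    by (metis bezout_coefficients_fst_snd coprime_imp_gcd_eq_1)
  \<comment> \<open>\<open>v * q\<close> is 1 modulo the new factor and 0 modulo all old ones, so
    this multiple corrects the value at \<open>c\<close> and leaves the others alone.\<close>
  define r where "r = p + v * q * ([:f c:] - p)"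
  have "r - [:f c:] = (p - [:f c:]) * (1 - v * q)" unfolding r_def by (simp add: algebra_simps)
  also have "1 - v * q = u * [:-c, 1:] ^ m" using uv by (simp add: algebra_simps)
  finally have "[:-c, 1:] ^ m dvd r - [:f c:]" by simp
  moreover have "[:-a, 1:] ^ m dvd r - [:f a:]" if "a \<in> S" for a
  proof -
    have "[:-a, 1:] ^ m dvd q" unfolding q_def using insert that by (intro dvd_prodI) auto
    then have "[:-a, 1:] ^ m dvd (p - [:f a:]) + v * q * ([:f c:] - p)"
      using p that by (intro dvd_add dvd_mult2 dvd_mult) auto
    also have "(p - [:f a:]) + v * q * ([:f c:] - p) = r - [:f a:]" unfolding r_def by simp
    finally show ?thesis .
  qed
  ultimately show ?case by blast
qed simp

section \<open>Operators over an algebraically closed field\<close>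

lemma (in vector_space) annihilating_poly_exists:
  assumes V: "fin_dim scale V" and T: "\<And>u. u \<in> V \<Longrightarrow> T u \<in> V" and v: "v \<in> V"
  shows "\<exists>p. p \<noteq> 0 \<and> poly_op scale p T v = 0"
proof -
  obtain B where B: "finite B" "span B = V" using V by (auto simp: fin_dim_def)
  define n where "n = card B"
  have inV: "(T ^^ k) v \<in> V" for k using funpow_in[of V T v k] T v by blast
  \<comment> \<open>There are more iterates of \<open>T\<close> on \<open>v\<close> than spanning
    vectors. Dependence is a property of sets, so a coincidence between two iterates has to be
    treated apart from a linear relation among distinct ones.\<close>
  show ?thesis
  proof (cases "inj_on (\<lambda>k. (T ^^ k) v) {..n}")
    case False
    then obtain i j where ij: "i \<noteq> j" "(T ^^ i) v = (T ^^ j) v" unfolding inj_on_def by blast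
    have mon: "poly_op scale (monom 1 k) T v = (T ^^ k) v" for k
    proof -
      have "poly_op scale (monom 1 k) T v = (\<Sum>i\<le>k. if i = k then (T ^^ k) v else 0)"
        by (subst poly_op_bound[OF degree_monom_le]) (rule sum.cong, simp_all)
      then show ?thesis by simp
    qed
    have "coeff (monom (1::'a) i - monom 1 j) i \<noteq> 0" using ij by simp
    then have "monom (1::'a) i - monom 1 j \<noteq> 0" by (metis coeff_0)
    moreover have "poly_op scale (monom 1 i - monom 1 j) T v = 0" using ij by (simp add: poly_op_diff mon)
    ultimately show ?thesis by blast
  next
    case True
    define F where "F = (\<lambda>k. (T ^^ k) v) ` {..n}"
    have cF: "card F = Suc n" unfolding F_def using True by (simp add: card_image)
    have "dependent F"
    proof (rule ccontr)
      assume "independent F"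
      moreover have "F \<subseteq> span B" using inV B unfolding F_def by auto
      ultimately have "card F \<le> card B" using independent_span_bound[OF B(1)] by blast
      then show False using cF n_def by simp
    qed
    then obtain u w where u: "w \<in> F" "u w \<noteq> 0" "(\<Sum>w\<in>F. scale (u w) w) = 0"
      using dependent_finite[of F] unfolding F_def by auto
    define p where "p = (\<Sum>k\<le>n. monom (u ((T ^^ k) v)) k)"
    have cp: "coeff p k = (if k \<le> n then u ((T ^^ k) v) else 0)" for k
      unfolding p_def by (simp add: coeff_sum)
    have "degree p \<le> n" by (rule degree_le) (simp add: cp)
    then have "poly_op scale p T v = (\<Sum>k\<le>n. scale (u ((T ^^ k) v)) ((T ^^ k) v))"
      by (simp add: poly_op_bound cp)
    also have "\<dots> = (\<Sum>w\<in>F. scale (u w) w)"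
      unfolding F_def using True by (simp add: sum.reindex)
    finally have "poly_op scale p T v = 0" using u by simp
    moreover obtain k where "k \<le> n" "w = (T ^^ k) v" using u(1) unfolding F_def by auto
    then have "coeff p k \<noteq> 0" using u(2) cp by simp
    then have "p \<noteq> 0" by auto
    ultimately show ?thesis by blast
  qed
qed

lemma (in vector_space) poly_op_eigen:
  "T v = scale c v \<Longrightarrow> linear_map_on scale V scale V T \<Longrightarrow> v \<in> V \<Longrightarrow> subspace V \<Longrightarrow>
    poly_op scale p T v = scale (poly p c) v"
proof (induction p)
  case (pCons a p)
  have "poly_op scale p T (scale c v) = scale c (poly_op scale p T v)"
    using linear_map_on_poly_op[OF pCons.prems(4,2)] pCons.prems(3) by (simp add: linear_map_on_def)
  then show ?case using pCons by (simp add: poly_op_pCons scale_left_distrib mult.commute)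
qed simp

text \<open>If \<open>p\<close> has least degree among the polynomials that annihilate
  \<open>v\<close> and \<open>c\<close> is a root of \<open>p\<close>, then the cofactor of
  \<open>X - c\<close> does not annihilate \<open>v\<close>, and its value at \<open>v\<close> is an
  eigenvector for \<open>c\<close>.\<close>

lemma eigenvector_exists:
  fixes s :: "'k::alg_closed_field \<Rightarrow> 'v::ab_group_add \<Rightarrow> 'v"
  assumes "vector_space s" "fin_dim s V" and T: "linear_map_on s V s V T" and "V \<noteq> {0}"
  obtains v c where "v \<in> V" "v \<noteq> 0" "T v = s c v"
proof -
  interpret vector_space s by fact
  have subV: "subspace V" using assms(2) by (rule fin_dim_imp_subspace)
  obtain v where v: "v \<in> V" "v \<noteq> 0" using \<open>V \<noteq> {0}\<close> subspace_0[OF subV] by blast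
  have TV: "T u \<in> V" if "u \<in> V" for u using T that by (simp add: linear_map_on_def)
  obtain p0 where p0: "p0 \<noteq> 0 \<and> poly_op s p0 T v = 0"
    using annihilating_poly_exists[of V T v, OF assms(2) TV v(1)] by blast
  obtain p where p: "p \<noteq> 0 \<and> poly_op s p T v = 0"
    and min: "\<And>q. q \<noteq> 0 \<and> poly_op s q T v = 0 \<Longrightarrow> degree p \<le> degree q"
    using ex_has_least_nat[of "\<lambda>p. p \<noteq> 0 \<and> poly_op s p T v = 0", OF p0, of degree] by metis
  have "degree p \<noteq> 0"
  proof
    assume "degree p = 0"
    then obtain a where "p = [:a:]" by (rule degree_eq_zeroE)
    then show False using p v by (simp add: poly_op_const)
  qed
  then obtain c where "poly p c = 0" using alg_closed_imp_poly_has_root[of p] by auto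
  then obtain q where q: "p = [:-c, 1:] * q" using poly_eq_0_iff_dvd by (metis dvdE)
  then have q0: "q \<noteq> 0" using p by auto
  have "degree p = Suc (degree q)" using q0 unfolding q by (subst degree_mult_eq) auto
  then have "poly_op s q T v \<noteq> 0" using min[of q] q0 by auto
  moreover have "T (poly_op s q T v) = s c (poly_op s q T v)"
    using p poly_op_mult[OF subV T v(1), of "[:-c, 1:]" q] unfolding q by (simp add: poly_op_root)
  ultimately show ?thesis using that poly_op_in_V[OF subV T v(1)] by blast
qed

text \<open>\<open>cs\<close> is the diagonal of a triangular form of \<open>T\<close>. No
  triangular basis is built; the induction splits off an eigenline and carries only the two
  consequences that are used later: the traces of polynomials in \<open>T\<close>, and
  Cayley-Hamilton.\<close>

lemma triangular_eigenvalues: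
  fixes s :: "'k::alg_closed_field \<Rightarrow> 'v::ab_group_add \<Rightarrow> 'v"
  assumes "vector_space s" "fin_dim s V" "linear_map_on s V s V T"
  shows "\<exists>cs. (\<forall>q. trace_on s V (poly_op s q T) = (\<Sum>c\<leftarrow>cs. poly q c)) \<and>
    (\<forall>v\<in>V. poly_op s (\<Prod>c\<leftarrow>cs. [:-c, 1:]) T v = 0)"
  using assms(2,3)
proof (induction "vector_space.dim s V" arbitrary: V T rule: less_induct)
  case (less V T)
  interpret vector_space s by fact
  note V = less.prems(1) and T = less.prems(2)
  have subV: "subspace V" using V by (rule fin_dim_imp_subspace)
  show ?case
  proof (cases "V = {0}")
    case True
    have "poly_op s q T 0 = 0" for q
      using linear_map_on_zero[OF linear_map_on_poly_op[OF subV T] subV vector_space_axioms] .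
    then have "trace_on s V (poly_op s q T) = 0" for q
      using trace_on_cong[OF V, of "poly_op s q T" "\<lambda>_. 0"] True by (simp add: trace_on_zero)
    then show ?thesis using True by (intro exI[of _ "[]"]) simp
  next
    case False
    obtain w c0 where w: "w \<in> V" "w \<noteq> 0" "T w = s c0 w"
      using eigenvector_exists[OF assms(1) V T False] .
    have WV: "span {w} \<subseteq> V" using w subV by (intro span_minimal) auto
    obtain p where p: "linear_map_on s V s V p" "\<And>v. v \<in> V \<Longrightarrow> p (p v) = p v"
        "\<And>v. v \<in> V \<Longrightarrow> p v = 0 \<longleftrightarrow> v \<in> span {w}"
      using projection_along[OF V subspace_span WV] by blast
    define C where "C = p ` V"
    define T' where "T' = p \<circ> T"
    have TV: "T u \<in> V" if "u \<in> V" for u using T that by (simp add: linear_map_on_def)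
    have pV: "p u \<in> V" if "u \<in> V" for u using p(1) that by (simp add: linear_map_on_def)
    have W: "poly_op s q T u = s (poly q c0) u" if "u \<in> span {w}" for q u
    proof -
      obtain a where "u = s a w" using \<open>u \<in> span {w}\<close> by (auto simp: span_singleton)
      then have "T u = s c0 u" using T w by (simp add: linear_map_on_def mult.commute)
      then show ?thesis using poly_op_eigen[OF _ T _ subV] WV that by blast
    qed
    have CV: "C \<subseteq> V" unfolding C_def using pV by blast
    have subC: "subspace C" unfolding C_def using subspace_image_on[OF p(1) vector_space_axioms subV subV] by simp
    have pC: "p u = u" if "u \<in> C" for u using that p(2) unfolding C_def by auto
    have "w \<notin> C" using pC p(3)[OF w(1)] w(2) by (auto intro: span_base)
    then have "dim C < dim V" using dim_less[OF V subC] CV w(1) by blast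
    moreover have "linear_map_on s C s C T'"
      unfolding T'_def
      by (rule linear_map_on_mono[OF linear_map_on_comp[OF T p(1)] CV]) (use CV TV in \<open>auto simp: C_def\<close>)
    ultimately obtain cs where cs: "\<And>q. trace_on s C (poly_op s q T') = (\<Sum>c\<leftarrow>cs. poly q c)"
        "\<And>v. v \<in> C \<Longrightarrow> poly_op s (\<Prod>c\<leftarrow>cs. [:-c, 1:]) T' v = 0"
      using less.hyps[OF _ fin_dim_subspace[OF V subC CV]] by blast
    \<comment> \<open>\<open>p\<close> models the quotient by the eigenline. Since \<open>T\<close>
      maps \<open>span {w}\<close> into itself, \<open>p (T v)\<close> depends on \<open>p v\<close>
      alone, and this passes to polynomials.\<close>
    have conj: "poly_op s q T' (p v) = p (poly_op s q T v)" if "v \<in> V" for q v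
      using that
    proof (induction q arbitrary: v)
      case (pCons a q)
      have "p (v - p v) = 0"
        using linear_map_on_diff[OF p(1) subV pCons.prems pV[OF pCons.prems]] p(2) pCons.prems by simp
      then have vW: "v - p v \<in> span {w}" using p(3) subspace_diff[OF subV] pCons.prems pV by blast
      then have "T (v - p v) = s c0 (v - p v)" using W[OF vW, of "[:0, 1:]"] by (simp add: poly_op_pCons poly_op_const)
      then have "T (v - p v) \<in> span {w}" using span_scale[OF vW] by simp
      then have "p (T (v - p v)) = 0" using p(3) WV by blast
      moreover have "T (v - p v) = T v - T (p v)"
        using linear_map_on_diff[OF T subV pCons.prems pV[OF pCons.prems]] .
      ultimately have "p (T (p v)) = p (T v)"
        using linear_map_on_diff[OF p(1) subV TV[OF pCons.prems] TV[OF pV[OF pCons.prems]]] by simp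
      then have "T' (p v) = p (T v)" by (simp add: T'_def)
      then have "poly_op s (pCons a q) T' (p v) = s a (p v) + p (poly_op s q T (T v))"
        using pCons.IH[OF TV[OF pCons.prems]] by (simp add: poly_op_pCons)
      also have "\<dots> = p (s a v + poly_op s q T (T v))"
        using p(1) pCons.prems TV poly_op_in_V[OF subV T] subspace_scale[OF subV]
        by (simp add: linear_map_on_def)
      finally show ?case by (simp add: poly_op_pCons)
    qed (use linear_map_on_zero[OF p(1) subV vector_space_axioms] in simp)
    have "trace_on s V (poly_op s q T) = poly q c0 + (\<Sum>c\<leftarrow>cs. poly q c)" for q
    proof -
      have fW: "fin_dim s (span {w})" by (auto simp: fin_dim_def)
      have bw: "is_basis s (span {w}) {w}" using w by (auto simp: is_basis_def)
      have lw: "linear_map_on s (span {w}) s (span {w}) (s (poly q c0))"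
        by (auto simp: linear_map_on_def scale_right_distrib mult.commute intro: span_scale)
      have "trace_on s V (poly_op s q T)
          = trace_on s (span {w}) (poly_op s q T) + trace_on s C (p \<circ> poly_op s q T)"
        unfolding C_def
        by (rule trace_on_split[OF V linear_map_on_poly_op[OF subV T] _ WV _ p]) (simp_all add: W span_scale)
      also have "trace_on s (span {w}) (poly_op s q T) = trace_on s (span {w}) (s (poly q c0))"
        by (rule trace_on_cong[OF fW]) (rule W)
      also have "\<dots> = poly q c0"
        unfolding trace_on_eq[OF vector_space_axioms bw lw]
        using bw representation_scale[of "{w}" w "poly q c0"] representation_basis[of "{w}" w]
        by (simp add: is_basis_def span_base)
      also have "trace_on s C (p \<circ> poly_op s q T) = trace_on s C (poly_op s q T')"
      proof (rule trace_on_cong[OF fin_dim_subspace[OF V subC CV]])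
        fix v assume v: "v \<in> C"
        then show "(p \<circ> poly_op s q T) v = poly_op s q T' v"
          using conj[of v q] CV pC[OF v] by auto
      qed
      finally show ?thesis using cs(1) by simp
    qed
    moreover have "poly_op s (\<Prod>c\<leftarrow>c0 # cs. [:-c, 1:]) T v = 0" if v: "v \<in> V" for v
    proof -
      define u where "u = poly_op s (\<Prod>c\<leftarrow>cs. [:-c, 1:]) T v"
      have uV: "u \<in> V" unfolding u_def using poly_op_in_V[OF subV T v] .
      have "p u = 0" unfolding u_def using conj[OF v] cs(2)[of "p v"] v by (simp add: C_def)
      then have "u \<in> span {w}" using p(3) uV by blast
      then have "poly_op s [:-c0, 1:] T u = 0" by (simp add: W)
      then show ?thesis unfolding u_def list.map prod_list.Cons poly_op_mult[OF subV T v] .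
    qed
    ultimately show ?thesis by (intro exI[of _ "c0 # cs"]) auto
  qed
qed

text \<open>A field of characteristic zero is a vector space over the rationals, and
  \<open>{a}\<close> extends to a basis of it. The functional takes the part that complex
  conjugation plays in the argument over the complex numbers.\<close>

lemma rational_functional_exists:
  fixes a :: "'k::field_char_0"
  assumes "a \<noteq> 0"
  obtains f :: "'k \<Rightarrow> rat" where "\<And>x y. f (x + y) = f x + f y" "\<And>q x. f (x * of_rat q) = f x * q" "f a = 1"
proof -
  define s :: "rat \<Rightarrow> 'k \<Rightarrow> 'k" where "s q x = x * of_rat q" for q x
  define t :: "rat \<Rightarrow> rat \<Rightarrow> rat" where "t = (*)"
  interpret P: vector_space_pair s t
    by unfold_locales (auto simp: s_def t_def algebra_simps of_rat_add of_rat_mult)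
  have ind: "P.vs1.independent {a}" using assms by simp
  define f where "f = P.construct {a} (\<lambda>_. 1)"
  have "Vector_Spaces.linear s t f" unfolding f_def by (rule P.linear_construct[OF ind])
  then interpret f: Vector_Spaces.linear s t f .
  show ?thesis
  proof (rule that[of f])
    show "f a = 1" unfolding f_def by (rule P.construct_basis[OF ind]) simp
    show "f (x * of_rat q) = f x * q" for q x using f.scale[of q x] by (simp add: s_def t_def)
  qed (rule f.add)
qed

text \<open>This replaces the binomial formula. Applying \<open>L - R\<close> once to
  \<open>y\<close> yields \<open>L y\<close> and \<open>R y\<close>; by commutation
  \<open>L y\<close> is killed by one power of \<open>L\<close> less and the same power of
  \<open>R\<close>, and symmetrically for \<open>R y\<close>, so induction on \<open>p + q\<close>
  applies.\<close>

lemma funpow_commuting_diff: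
  fixes L R :: "'w::ab_group_add \<Rightarrow> 'w"
  assumes E: "\<And>y z. y \<in> E \<Longrightarrow> z \<in> E \<Longrightarrow> y - z \<in> E" "\<And>y. y \<in> E \<Longrightarrow> L y \<in> E" "\<And>y. y \<in> E \<Longrightarrow> R y \<in> E"
    and L: "\<And>y z. y \<in> E \<Longrightarrow> z \<in> E \<Longrightarrow> L (y - z) = L y - L z"
    and R: "\<And>y z. y \<in> E \<Longrightarrow> z \<in> E \<Longrightarrow> R (y - z) = R y - R z"
    and comm: "\<And>y. y \<in> E \<Longrightarrow> L (R y) = R (L y)"
    and y: "y \<in> E" "(L ^^ p) y = 0" "(R ^^ q) y = 0"
  shows "((\<lambda>z. L z - R z) ^^ (p + q)) y = 0"
  using y
proof (induction "p + q" arbitrary: p q y)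
  case 0
  then show ?case by simp
next
  case (Suc n)
  define A where "A = (\<lambda>z. L z - R z)"
  have zero: "0 \<in> E" using E(1) Suc.prems by force
  have L0: "L 0 = 0" and R0: "R 0 = 0" using L[OF zero zero] R[OF zero zero] by simp_all
  have Adiff: "A y - A z = A (y - z)" and AE: "A y \<in> E" if "y \<in> E" "z \<in> E" for y z
    using that E unfolding A_def by (auto simp: L R)
  have Ain: "(A ^^ k) y \<in> E" if "y \<in> E" for k y
    using that AE by (induction k) auto
  have Apow: "(A ^^ k) (y - z) = (A ^^ k) y - (A ^^ k) z" if "y \<in> E" "z \<in> E" for k y z
    using that by (induction k) (auto simp: Adiff Ain)
  have A0: "(A ^^ k) 0 = 0" for k by (induction k) (simp_all add: A_def L0 R0)
  have LR: "(R ^^ k) (L z) = L ((R ^^ k) z) \<and> (R ^^ k) z \<in> E" "(L ^^ k) (R z) = R ((L ^^ k) z) \<and> (L ^^ k) z \<in> E"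
    if "z \<in> E" for k z using that by (induction k) (auto simp: comm E)
  show ?case
  proof (cases "p = 0 \<or> q = 0")
    case True
    then have "y = 0" using Suc.prems by auto
    then show ?thesis using A0 unfolding A_def by simp
  next
    case False
    then obtain p' q' where pq: "p = Suc p'" "q = Suc q'" by (metis not0_implies_Suc)
    have "(R ^^ q) (L y) = 0" using LR(1)[of y q] Suc.prems L0 by simp
    moreover have "(L ^^ p') (L y) = 0" using Suc.prems unfolding pq by (simp add: funpow_swap1)
    ultimately    have 1: "(A ^^ n) (L y) = 0"
      using Suc.hyps(1)[of p' q "L y"] Suc.hyps(2) Suc.prems E pq unfolding A_def by simp
    have "(L ^^ p) (R y) = 0" using LR(2)[of y p] Suc.prems R0 by simp
    moreover have "(R ^^ q') (R y) = 0" using Suc.prems unfolding pq by (simp add: funpow_swap1)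
    ultimately have 2: "(A ^^ n) (R y) = 0"
      using Suc.hyps(1)[of p q' "R y"] Suc.hyps(2) Suc.prems E pq unfolding A_def by simp
    have "(A ^^ Suc n) y = (A ^^ n) (L y - R y)" by (simp only: funpow_Suc_right o_apply A_def)
    also have "\<dots> = 0" using Apow[of "L y" "R y"] 1 2 E Suc.prems by simp
    finally show ?thesis using Suc.hyps(2) unfolding A_def by simp
  qed
qed

lemma prod_dvd_of_pairwise_coprime:
  fixes g :: "'i \<Rightarrow> 'a::semiring_gcd"
  assumes "finite S" "\<And>i j. i \<in> S \<Longrightarrow> j \<in> S \<Longrightarrow> i \<noteq> j \<Longrightarrow> coprime (g i) (g j)"
    "\<And>i. i \<in> S \<Longrightarrow> g i dvd r"
  shows "(\<Prod>i\<in>S. g i) dvd r"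
  using assms
proof (induction S)
  case (insert i S)
  have "coprime (g i) (\<Prod>i\<in>S. g i)" using insert by (intro prod_coprime_right) auto
  then show ?case using insert by (simp add: divides_mult)
qed simp

section \<open>Closure properties of gl(V)\<close>

context vector_space
begin

lemma gl_carrier_iff:
  "f \<in> lie_carrier (gl scale V) \<longleftrightarrow> linear_map_on scale V scale V f \<and> (\<forall>v. v \<notin> V \<longrightarrow> f v = 0)"
  by (simp add: gl_def)

lemma gl_subspace:
  "subspace V \<Longrightarrow> module.subspace (pointwise_scale scale) (lie_carrier (gl scale V))"
  using lie_algebra_gl[OF vector_space_axioms, of V] by (simp add: lie_algebra_def gl_def)

context
  fixes V
  assumes subV: "subspace V"
begin

lemma gl_in_V: "f \<in> lie_carrier (gl scale V) \<Longrightarrow> f v \<in> V"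
  using subspace_0[OF subV] by (cases "v \<in> V") (auto simp: gl_carrier_iff linear_map_on_def)

lemma gl_zero: "f \<in> lie_carrier (gl scale V) \<Longrightarrow> f 0 = 0"
  using linear_map_on_zero[OF _ subV vector_space_axioms] by (auto simp: gl_carrier_iff)

lemma gl_comp:
  "f \<in> lie_carrier (gl scale V) \<Longrightarrow> h \<in> lie_carrier (gl scale V) \<Longrightarrow> f \<circ> h \<in> lie_carrier (gl scale V)"
  using gl_zero[of f] by (auto simp: gl_carrier_iff intro: linear_map_on_comp)

lemma gl_diff:
  assumes "f \<in> lie_carrier (gl scale V)" "h \<in> lie_carrier (gl scale V)"
  shows "f - h \<in> lie_carrier (gl scale V)"
proof -
  interpret P: vector_space "pointwise_scale scale :: _ \<Rightarrow> ('b \<Rightarrow> 'b) \<Rightarrow> _"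
    by (rule vector_space_pointwise_scale) unfold_locales
  show ?thesis using P.subspace_diff[OF gl_subspace[OF subV]] assms by blast
qed

end

end

text \<open>The proof tests \<open>x\<close> against the operator \<open>D\<close> acting as the scalar \<open>\<phi> c\<close> on the generalised
  eigenspace of \<open>c\<close>, where \<open>\<phi>\<close> is additive with rational values: \<open>[D, b]\<close> is a polynomial without
  constant term in \<open>ad x\<close> applied to \<open>b\<close>, so \<open>tr (x D) = 0\<close>. Applying \<open>\<phi>\<close> to this trace gives a sum
  of squares of rationals.\<close>

lemma trace_condition_imp_nilpotent_alg_closed:
  fixes s :: "'k::{alg_closed_field,field_gcd,field_char_0} \<Rightarrow> 'v::ab_group_add \<Rightarrow> 'v"
  assumes vs: "vector_space s" and V: "fin_dim s V"
    and x: "x \<in> lie_carrier (gl s V)"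
    and ab: "\<And>i. i \<in> I \<Longrightarrow> a i \<in> lie_carrier (gl s V)" "\<And>i. i \<in> I \<Longrightarrow> b i \<in> lie_carrier (gl s V)"
    and x_eq: "\<And>v. x v = (\<Sum>i\<in>I. a i (b i v) - b i (a i v))"
    and tr: "\<And>i k. i \<in> I \<Longrightarrow> trace_on s V (a i \<circ> ((\<lambda>y. (x \<circ> y) - (y \<circ> x)) ^^ Suc k) (b i)) = 0"
  shows "\<exists>m. \<forall>v\<in>V. (x ^^ m) v = 0"
proof -
  interpret vector_space s by fact
  define ps where "ps = (pointwise_scale s :: _ \<Rightarrow> ('v \<Rightarrow> 'v) \<Rightarrow> _)"
  interpret E: vector_space ps
    unfolding ps_def by (rule vector_space_pointwise_scale) unfold_locales
  define E where "E = lie_carrier (gl s V)"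
  define A where "A = (\<lambda>y. (x \<circ> y) - (y \<circ> x))"
  have subV: "subspace V" using V by (rule fin_dim_imp_subspace)
  have subE: "E.subspace E" unfolding E_def ps_def by (rule gl_subspace[OF subV])
  have Elin: "linear_map_on s V s V f" if "f \<in> E" for f using that by (simp add: E_def gl_carrier_iff)
  have Eout: "f v = 0" if "f \<in> E" "v \<notin> V" for f v using that by (simp add: E_def gl_carrier_iff)
  have Eadd: "f (u + v) = f u + f v" if "f \<in> E" "u \<in> V" "v \<in> V" for f u v
    using Elin[OF that(1)] that by (auto simp: linear_map_on_def)
  have Escale: "f (s c u) = s c (f u)" if "f \<in> E" "u \<in> V" for f u c
    using Elin[OF that(1)] that by (auto simp: linear_map_on_def)
  have Ediff: "f (u - v) = f u - f v" if "f \<in> E" "u \<in> V" "v \<in> V" for f u v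
    using linear_map_on_diff[OF Elin[OF that(1)] subV] that by blast
  have EI: "(\<lambda>v. if v \<in> V then f v else 0) \<in> E" if "linear_map_on s V s V f" for f
    using that subV unfolding E_def gl_carrier_iff
    by (auto simp: linear_map_on_def subspace_add subspace_scale)
  note Ein = gl_in_V[OF subV, folded E_def] and E0 = gl_zero[OF subV, folded E_def]
    and Ecomp = gl_comp[OF subV, folded E_def] and Eminus = gl_diff[OF subV, folded E_def]
  have xE: "x \<in> E" and aE: "\<And>i. i \<in> I \<Longrightarrow> a i \<in> E" and bE: "\<And>i. i \<in> I \<Longrightarrow> b i \<in> E"
    using x ab by (simp_all add: E_def)
  note xlin = Elin[OF xE]
  have AE: "A y \<in> E" if "y \<in> E" for y unfolding A_def using that xE Ecomp Eminus by blast
  have Alin: "linear_map_on ps E ps E A"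
    unfolding linear_map_on_def
  proof (intro conjI ballI allI)
    fix y c assume y: "y \<in> E"
    show "A y \<in> E" using y by (rule AE)
    show "A (ps c y) = ps c (A y)"
    proof
      fix v
      have "A (ps c y) v = x (s c (y v)) - s c (y (x v))" by (simp add: A_def ps_def pointwise_scale_def)
      also have "x (s c (y v)) = s c (x (y v))" by (rule Escale[OF xE Ein[OF y]])
      also have "s c (x (y v)) - s c (y (x v)) = ps c (A y) v"
        by (simp add: A_def ps_def pointwise_scale_def scale_right_diff_distrib)
      finally show "A (ps c y) v = ps c (A y) v" .
    qed
    fix z assume z: "z \<in> E"
    show "A (y + z) = A y + A z"
      by (rule ext) (simp add: A_def Eadd[OF xE Ein[OF y] Ein[OF z]])
  qed

  obtain cs where cs: "\<And>q. trace_on s V (poly_op s q x) = (\<Sum>c\<leftarrow>cs. poly q c)"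
      "\<And>v. v \<in> V \<Longrightarrow> poly_op s (\<Prod>c\<leftarrow>cs. [:-c, 1:]) x v = 0"
    using triangular_eigenvalues[OF vs V xlin] by blast
  \<comment> \<open>One exponent for all eigenvalues, the length of the whole list, makes
    \<open>\<mu>\<close> a multiple of the characteristic polynomial without any counting of
    multiplicities.\<close>
  define m where "m = length cs"
  define S where "S = set cs"
  define \<mu> where "\<mu> = (\<Prod>c\<in>S. [:-c, 1:] ^ m)"
  have "finite S" by (simp add: S_def)
  have "(\<Prod>c\<leftarrow>ds. [:-c, 1:]) dvd (\<Prod>c\<in>S. [:-c, 1:]) ^ length ds" if "set ds \<subseteq> S" for ds
    using that
  proof (induction ds)
    case (Cons d ds)
    then have "[:-d, 1:] dvd (\<Prod>c\<in>S. [:-c, 1:])" using \<open>finite S\<close> by (intro dvd_prodI) auto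
    then have "[:-d, 1:] * (\<Prod>c\<leftarrow>ds. [:-c, 1:]) dvd
        (\<Prod>c\<in>S. [:-c, 1:]) * (\<Prod>c\<in>S. [:-c, 1:]) ^ length ds"
      using Cons by (intro mult_dvd_mono) auto
    then show ?case by (simp only: list.map prod_list.Cons list.size power_Suc Nat.add_Suc_right Nat.add_0_right)
  qed simp
  then have "(\<Prod>c\<leftarrow>cs. [:-c, 1:]) dvd \<mu>"
    by (simp add: \<mu>_def m_def S_def prod_power_distrib)
  then have \<mu>: "poly_op s \<mu> x v = 0" if "v \<in> V" for v
    using poly_op_dvd[OF subV xlin] cs(2) that by blast
  show ?thesis
  proof (cases "S \<subseteq> {0}")
    case True
    have "\<mu> dvd [:-0, 1:] ^ m"
      using True by (cases "S = {}") (auto simp: \<mu>_def subset_singleton_iff)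
    then have "poly_op s ([:-0, 1:] ^ m) x v = 0" if "v \<in> V" for v
      using poly_op_dvd[OF subV xlin _ \<mu>[OF that] that] by blast
    then have "\<forall>v\<in>V. (x ^^ m) v = 0"
      using poly_op_power_root[OF subV xlin, of _ 0 m] by simp
    then show ?thesis by blast
  next
    case False
    then obtain c0 where c0: "c0 \<in> S" "c0 \<noteq> 0" by blast
    then have "m > 0" by (auto simp: S_def m_def)
    \<comment> \<open>A nonzero eigenvalue has to be refuted. Normalising \<open>f c0 = 1\<close>
      makes sure that the final sum of squares has a nonzero term.\<close>
    obtain f :: "'k \<Rightarrow> rat" where f: "\<And>x y. f (x + y) = f x + f y" "\<And>q x. f (x * of_rat q) = f x * q" "f c0 = 1"
      using rational_functional_exists[OF c0(2)] by blast
    define \<phi> where "\<phi> c = (of_rat (f c) :: 'k)" for c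
    have f0: "f 0 = 0" using f(1)[of 0 0] by simp
    have fdiff: "f (c - d) = f c - f d" for c d using f(1)[of "c - d" d] by simp
    obtain Q where Q: "\<And>c. c \<in> S \<Longrightarrow> [:-c, 1:] ^ m dvd Q - [:\<phi> c:]"
      using chinese_remainder_constants[OF \<open>finite S\<close>, of m \<phi>] by blast
    \<comment> \<open>The differences are the possible eigenvalues of \<open>A\<close>, the bracket
      with \<open>x\<close>. The exponent is \<open>m + m\<close> because on a block
      \<open>A\<close> is, up to a scalar, a difference of two commuting operators whose m-th powers
      vanish there.\<close>
    define S2 where "S2 = (\<lambda>(c, d). c - d) ` (S \<times> S)"
    have "finite S2" unfolding S2_def using \<open>finite S\<close> by simp
    obtain P where P: "\<And>\<nu>. \<nu> \<in> S2 \<Longrightarrow> [:-\<nu>, 1:] ^ (m + m) dvd P - [:\<phi> \<nu>:]"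
      using chinese_remainder_constants[OF \<open>finite S2\<close>, of "m + m" \<phi>] by blast
    \<comment> \<open>\<open>\<phi> 0 = 0\<close> removes the constant term of \<open>P\<close>.
      This is why the trace hypothesis can start at \<open>Suc k\<close> instead of the zeroth
      power.\<close>
    have "0 \<in> S2" unfolding S2_def using c0(1) by force
    from P[OF this] have "[:-0, 1:] ^ (m + m) dvd P" by (simp add: \<phi>_def f0)
    then have "[:-0, 1:] dvd P" using \<open>m > 0\<close> by (metis dvd_power dvd_trans add_pos_pos)
    then have "poly P 0 = 0" by (simp add: poly_eq_0_iff_dvd)
    then obtain P' where P': "P = pCons 0 P'" by (cases P) simp
    define D where "D = (\<lambda>v. if v \<in> V then poly_op s Q x v else 0)"
    have DE: "D \<in> E" unfolding D_def by (rule EI[OF linear_map_on_poly_op[OF subV xlin]])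
    define \<Phi> where "\<Phi> = poly_op ps P A"
    define \<Psi> where "\<Psi> y = (D \<circ> y) - (y \<circ> D)" for y
    have \<Phi>lin: "linear_map_on ps E ps E \<Phi>"
      unfolding \<Phi>_def by (rule E.linear_map_on_poly_op[OF subE Alin])
    \<comment> \<open>Such a \<open>y\<close> has its image in the generalised eigenspace of
      \<open>c\<close> and kills the range of the m-th power of \<open>x - d\<close>. Bracketing it
      with \<open>x\<close> involves the single eigenvalue \<open>c - d\<close>, so \<open>P\<close>
      of that bracket acts on \<open>y\<close> as \<open>\<phi> (c - d)\<close>; by additivity of
      \<open>\<phi>\<close> so does the bracket with \<open>D\<close>.\<close>
    have block: "\<Phi> y = \<Psi> y"
      if "c \<in> S" "d \<in> S" and y: "y \<in> E" and c: "\<And>v. v \<in> V \<Longrightarrow> poly_op s ([:-c, 1:] ^ m) x (y v) = 0"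
        and d: "\<And>v. v \<in> V \<Longrightarrow> y (poly_op s ([:-d, 1:] ^ m) x v) = 0" for c d y
    proof -
      \<comment> \<open>\<open>L\<close> and \<open>R\<close> are left and right multiplication by
        \<open>x\<close>, shifted by \<open>c\<close> and \<open>d\<close>. They commute, they are
        nilpotent on \<open>y\<close>, and \<open>L - R\<close> is \<open>A\<close> minus the scalar
        \<open>c - d\<close>.\<close>
      define L where "L = (\<lambda>y. (x \<circ> y) - ps c y)"
      define R where "R = (\<lambda>y. (y \<circ> x) - ps d y)"
      have LE: "L z \<in> E" and RE: "R z \<in> E" if "z \<in> E" for z
        unfolding L_def R_def using that xE Ecomp Eminus E.subspace_scale[OF subE] by blast+
      have Lv: "L z v = x (z v) - s c (z v)" and Rv: "R z v = z (x v) - s d (z v)" for z v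
        by (simp_all add: L_def R_def ps_def pointwise_scale_def)
      have Lpow: "(L ^^ k) y v = ((\<lambda>w. x w - s c w) ^^ k) (y v)" for k v
        by (induction k) (simp_all add: Lv)
      have "(L ^^ m) y = 0"
      proof
        fix v show "(L ^^ m) y v = 0 v"
        proof (cases "v \<in> V")
          case True
          then show ?thesis using c[OF True] Lpow poly_op_power_root[OF subV xlin Ein[OF y]] by simp
        next
          case False
          then have "y v = y 0" using Eout[OF y] E0[OF y] by simp
          then show ?thesis using c[OF subspace_0[OF subV]] Lpow poly_op_power_root[OF subV xlin Ein[OF y]] by simp
        qed
      qed
      moreover have Rpow: "(R ^^ k) z v = z (((\<lambda>w. x w - s d w) ^^ k) v)" if "z \<in> E" "v \<in> V" for k z v
        using that
      proof (induction k arbitrary: z)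
        case (Suc k)
        have xd: "x u - s d u \<in> V" if "u \<in> V" for u
          using that xE Ein subV by (intro subspace_diff subspace_scale) auto
        have w: "((\<lambda>w. x w - s d w) ^^ k) v \<in> V" by (rule funpow_in[OF xd Suc.prems(2)])
        have "(R ^^ Suc k) z v = (R ^^ k) (R z) v" by (simp add: funpow_swap1)
        also have "\<dots> = R z (((\<lambda>w. x w - s d w) ^^ k) v)" by (rule Suc.IH[OF RE Suc.prems(2)]) (rule Suc.prems)
        also have "\<dots> = z (x (((\<lambda>w. x w - s d w) ^^ k) v) - s d (((\<lambda>w. x w - s d w) ^^ k) v))"
          using Ediff[OF Suc.prems(1) Ein[OF xE] subspace_scale[OF subV w]] Escale[OF Suc.prems(1) w] w
          by (simp add: Rv)
        finally show ?case by simp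
      qed simp
      have "(R ^^ m) y = 0"
      proof
        fix v show "(R ^^ m) y v = 0 v"
        proof (cases "v \<in> V")
          case True
          then show ?thesis using d[OF True] Rpow[OF y True] poly_op_power_root[OF subV xlin True] by simp
        next
          case False
          have "(R ^^ m) y \<in> E" using y RE by (induction m) auto
          then show ?thesis using Eout False by simp
        qed
      qed
      ultimately have "((\<lambda>z. L z - R z) ^^ (m + m)) y = 0"
      proof (intro funpow_commuting_diff[of E L R y m m])
        show "L (u - v) = L u - L v" if "u \<in> E" "v \<in> E" for u v
          using Ein[OF that(1)] Ein[OF that(2)]
          by (simp add: fun_eq_iff Lv Ediff[OF xE] scale_right_diff_distrib)
        show "R (u - v) = R u - R v" if "u \<in> E" "v \<in> E" for u v
          by (simp add: fun_eq_iff Rv scale_right_diff_distrib)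
        show "L (R z) = R (L z)" if "z \<in> E" for z
          using Ein[OF that] subspace_scale[OF subV]
          by (simp add: fun_eq_iff Lv Rv Ediff[OF xE] Escale[OF xE] scale_right_diff_distrib mult.commute)
      qed (use Eminus LE RE y in auto)
      moreover have "(\<lambda>z. L z - R z) = (\<lambda>z. A z - ps (c - d) z)"
        by (simp add: fun_eq_iff Lv Rv A_def ps_def pointwise_scale_def scale_left_diff_distrib)
      ultimately have "poly_op ps ([:-(c - d), 1:] ^ (m + m)) A y = 0"
        using E.poly_op_power_root[OF subE Alin y, of "c - d" "m + m"] by simp
      moreover have "c - d \<in> S2" unfolding S2_def using that(1,2) by force
      ultimately have "poly_op ps (P - [:\<phi> (c - d):]) A y = 0"
        using E.poly_op_dvd[OF subE Alin P] y by blast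
      then have \<Phi>y: "\<Phi> y = ps (\<phi> (c - d)) y"
        by (simp add: E.poly_op_diff E.poly_op_const \<Phi>_def)
      have "\<Psi> y v = ps (\<phi> (c - d)) y v" for v
      proof (cases "v \<in> V")
        case True
        have "poly_op s (Q - [:\<phi> c:]) x (y v) = 0"
          using poly_op_dvd[OF subV xlin Q[OF \<open>c \<in> S\<close>] c[OF True]] Ein[OF y] by blast
        then have 1: "D (y v) = s (\<phi> c) (y v)"
          using Ein[OF y] by (simp add: D_def poly_op_diff poly_op_const)
        obtain r where r: "Q - [:\<phi> d:] = [:-d, 1:] ^ m * r" using Q[OF \<open>d \<in> S\<close>] by (elim dvdE)
        have "y (poly_op s (Q - [:\<phi> d:]) x v) = 0"
          unfolding r poly_op_mult[OF subV xlin True] by (rule d[OF poly_op_in_V[OF subV xlin True]])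
        moreover have "poly_op s (Q - [:\<phi> d:]) x v = D v - s (\<phi> d) v"
          using True by (simp add: D_def poly_op_diff poly_op_const)
        ultimately have 2: "y (D v) = s (\<phi> d) (y v)"
          using Ediff[OF y Ein[OF DE] subspace_scale[OF subV True]] Escale[OF y True] True by simp
        show ?thesis using 1 2
          by (simp add: \<Psi>_def ps_def pointwise_scale_def \<phi>_def fdiff of_rat_diff scale_left_diff_distrib)
      next
        case False
        then show ?thesis
          using Eout[OF y False] Eout[OF DE False] E0[OF y] E0[OF DE]
          by (simp add: \<Psi>_def ps_def pointwise_scale_def)
      qed
      then show ?thesis unfolding \<Phi>y by (simp add: fun_eq_iff)
    qed

    \<comment> \<open>\<open>e c\<close> is 1 modulo the power of \<open>X - c\<close> and 0 modulo
      the other powers. The operator \<open>pr c\<close> made from it is the projection to the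
      generalised eigenspace of \<open>c\<close>.\<close>
    have "\<exists>e. \<forall>d\<in>S. [:-d, 1:] ^ m dvd e - [:if d = c then 1 else 0:]" for c
      using chinese_remainder_constants[OF \<open>finite S\<close>, of m "\<lambda>d. if d = c then 1 else 0"] by simp
    then obtain e where e: "\<And>c d. d \<in> S \<Longrightarrow> [:-d, 1:] ^ m dvd e c - [:if d = c then 1 else 0:]" by metis
    have root_e: "[:-d, 1:] ^ m dvd e c" if "d \<in> S" "d \<noteq> c" for c d
      using e[OF that(1), of c] that(2) by simp
    have e_sum: "\<mu> dvd (\<Sum>c\<in>S. e c) - 1"
      unfolding \<mu>_def
    proof (rule prod_dvd_of_pairwise_coprime[OF \<open>finite S\<close>])
      fix d assume d: "d \<in> S"
      have "(\<Sum>c\<in>S. e c) - 1 = (e d - [:1:]) + (\<Sum>c\<in>S - {d}. e c)"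
        using sum.remove[OF \<open>finite S\<close> d, of e] by (simp add: one_pCons)
      moreover have "[:-d, 1:] ^ m dvd e d - [:1:]" using e[OF d, of d] by simp
      moreover have "[:-d, 1:] ^ m dvd (\<Sum>c\<in>S - {d}. e c)" using root_e d by (intro dvd_sum) auto
      ultimately show "[:-d, 1:] ^ m dvd (\<Sum>c\<in>S. e c) - 1" by (simp only: dvd_add)
    qed (rule coprime_root_powers, blast)
    have e_kill: "\<mu> dvd [:-c, 1:] ^ m * e c" if "c \<in> S" for c
      unfolding \<mu>_def
    proof (rule prod_dvd_of_pairwise_coprime[OF \<open>finite S\<close>])
      fix d assume "d \<in> S"
      then show "[:-d, 1:] ^ m dvd [:-c, 1:] ^ m * e c" using root_e[of d c] by (cases "d = c") auto
    qed (rule coprime_root_powers, blast)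
    define pr where "pr c = (\<lambda>v. if v \<in> V then poly_op s (e c) x v else 0)" for c
    have prE: "pr c \<in> E" for c unfolding pr_def by (rule EI[OF linear_map_on_poly_op[OF subV xlin]])
    have pr_sum: "(\<Sum>c\<in>S. pr c v) = v" if "v \<in> V" for v
      using poly_op_dvd[OF subV xlin e_sum \<mu>[OF that] that] that
      by (simp add: pr_def poly_op_diff poly_op_sum)
    have pr_kill: "poly_op s ([:-c, 1:] ^ m) x (pr c v) = 0" "pr c (poly_op s ([:-c, 1:] ^ m) x v) = 0"
      if "c \<in> S" "v \<in> V" for c v
    proof -
      have z: "poly_op s ([:-c, 1:] ^ m * e c) x v = 0"
        using poly_op_dvd[OF subV xlin e_kill[OF that(1)] \<mu>[OF that(2)] that(2)] .
      show "poly_op s ([:-c, 1:] ^ m) x (pr c v) = 0"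
        using z that(2) by (simp add: poly_op_mult[OF subV xlin] pr_def)
      show "pr c (poly_op s ([:-c, 1:] ^ m) x v) = 0"
        using z that(2) poly_op_in_V[OF subV xlin that(2)]
        by (simp add: poly_op_mult[OF subV xlin, symmetric] pr_def mult.commute)
    qed
    have \<Phi>\<Psi>: "\<Phi> y = \<Psi> y" if y: "y \<in> E" for y
    proof -
      \<comment> \<open>\<open>Y c d\<close> is the block of \<open>y\<close> from the generalised
        eigenspace of \<open>d\<close> to that of \<open>c\<close>; the blocks add up to
        \<open>y\<close>, and \<open>\<Phi>\<close> and \<open>\<Psi>\<close> are linear.\<close>
      define Y where "Y c d = pr c \<circ> y \<circ> pr d" for c d
      have YE: "Y c d \<in> E" for c d unfolding Y_def using prE y Ecomp by blast
      have fsum: "(\<Sum>c\<in>J. F c) v = (\<Sum>c\<in>J. F c v)" for J :: "'k set" and F :: "'k \<Rightarrow> 'v \<Rightarrow> 'v" and v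
        by (induction J rule: infinite_finite_induct) auto
      have ysum: "y (\<Sum>d\<in>S. pr d v) = (\<Sum>d\<in>S. y (pr d v))" for v
        by (rule linear_map_on_sum[OF Elin[OF y] subV vs]) (rule Ein[OF prE])
      have y_eq: "y = (\<Sum>c\<in>S. \<Sum>d\<in>S. Y c d)"
      proof
        fix v
        have "(\<Sum>c\<in>S. \<Sum>d\<in>S. Y c d) v = (\<Sum>d\<in>S. \<Sum>c\<in>S. pr c (y (pr d v)))"
          by (subst sum.swap) (simp add: fsum Y_def)
        also have "\<dots> = (\<Sum>d\<in>S. y (pr d v))" using pr_sum Ein[OF y] by simp
        also have "\<dots> = y v"
          using ysum[of v] pr_sum Eout[OF y] Eout[OF prE] E0[OF y] by (cases "v \<in> V") simp_all
        finally show "y v = (\<Sum>c\<in>S. \<Sum>d\<in>S. Y c d) v" by simp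
      qed
      have \<Psi>lin: "linear_map_on ps E ps E \<Psi>"
        unfolding linear_map_on_def
      proof (intro conjI ballI allI)
        fix u c assume u: "u \<in> E"
        show "\<Psi> u \<in> E" unfolding \<Psi>_def using u DE Ecomp Eminus by blast
        show "\<Psi> (ps c u) = ps c (\<Psi> u)"
          by (rule ext) (simp add: \<Psi>_def ps_def pointwise_scale_def Escale[OF DE Ein[OF u]] scale_right_diff_distrib)
        fix z assume z: "z \<in> E"
        show "\<Psi> (u + z) = \<Psi> u + \<Psi> z"
          by (rule ext) (simp add: \<Psi>_def Eadd[OF DE Ein[OF u] Ein[OF z]])
      qed
      have YY: "(\<Sum>d\<in>S. Y c d) \<in> E" for c using YE by (intro E.subspace_sum[OF subE])
      have split: "F y = (\<Sum>c\<in>S. \<Sum>d\<in>S. F (Y c d))" if F: "linear_map_on ps E ps E F" for F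
      proof -
        have "F y = (\<Sum>c\<in>S. F (\<Sum>d\<in>S. Y c d))"
          by (subst y_eq) (rule E.linear_map_on_sum[OF F subE E.vector_space_axioms YY])
        also have "\<dots> = (\<Sum>c\<in>S. \<Sum>d\<in>S. F (Y c d))"
          by (intro sum.cong refl E.linear_map_on_sum[OF F subE E.vector_space_axioms] YE)
        finally show ?thesis .
      qed
      have "\<Phi> (Y c d) = \<Psi> (Y c d)" if "c \<in> S" "d \<in> S" for c d
      proof (rule block[OF that YE])
        fix v assume v: "v \<in> V"
        show "poly_op s ([:-c, 1:] ^ m) x (Y c d v) = 0"
          unfolding Y_def using pr_kill(1)[OF that(1)] Ein[OF y] by simp
        show "Y c d (poly_op s ([:-d, 1:] ^ m) x v) = 0"
          unfolding Y_def using pr_kill(2)[OF that(2) v] E0[OF y] E0[OF prE] by simp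
      qed
      then show ?thesis unfolding split[OF \<Phi>lin] split[OF \<Psi>lin] by simp
    qed

    have tr_diff: "trace_on s V (\<lambda>v. g v - h v) = trace_on s V g - trace_on s V h" if "g \<in> E" "h \<in> E" for g h
      by (rule trace_on_diff[OF V Elin[OF that(1)] Elin[OF that(2)]])
    have tr_comm: "trace_on s V (g \<circ> h) = trace_on s V (h \<circ> g)" if "g \<in> E" "h \<in> E" for g h
      by (rule trace_on_comp_commute[OF V V Elin[OF that(2)] Elin[OF that(1)]])
    have tr_\<Phi>: "trace_on s V (a i \<circ> \<Phi> (b i)) = 0" if i: "i \<in> I" for i
    proof -
      \<comment> \<open>The operators orthogonal to \<open>a i\<close> form a subspace that contains
        all \<open>(A ^^ Suc k) (b i)\<close>. As \<open>P\<close> is X times \<open>P'\<close>, the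
        operator \<open>\<Phi> (b i)\<close> is a combination of these.\<close>
      define U where "U = {y \<in> E. trace_on s V (a i \<circ> y) = 0}"
      have "E.subspace U"
      proof (rule E.subspaceI)
        have zero: "a i \<circ> 0 = (\<lambda>_. 0)" using E0[OF aE[OF i]] by (simp add: fun_eq_iff)
        have "trace_on s V (a i \<circ> 0) = 0" by (simp only: zero trace_on_zero)
        then show "0 \<in> U" using E.subspace_0[OF subE] by (simp add: U_def)
        show "y + z \<in> U" if "y \<in> U" "z \<in> U" for y z
        proof -
          have yz: "y \<in> E" "z \<in> E" using that by (auto simp: U_def)
          then have "a i \<circ> (y + z) = (\<lambda>v. (a i \<circ> y) v + (a i \<circ> z) v)"
            using Ein by (simp add: fun_eq_iff Eadd[OF aE[OF i]])
          then show ?thesis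
            using that trace_on_add[OF V Elin[OF Ecomp[OF aE[OF i] yz(1)]] Elin[OF Ecomp[OF aE[OF i] yz(2)]]]
              E.subspace_add[OF subE] by (simp add: U_def)
        qed
        show "ps c y \<in> U" if "y \<in> U" for c y
        proof -
          have y: "y \<in> E" using that by (auto simp: U_def)
          then have "a i \<circ> ps c y = (\<lambda>v. s c ((a i \<circ> y) v))"
            using Ein by (simp add: fun_eq_iff ps_def pointwise_scale_def Escale[OF aE[OF i]])
          then show ?thesis
            using that trace_on_scale[OF V Elin[OF Ecomp[OF aE[OF i] y]]] E.subspace_scale[OF subE]
            by (simp add: U_def)
        qed
      qed
      moreover have "(A ^^ k) (A (b i)) \<in> U" for k
      proof -
        have "(A ^^ Suc k) (b i) \<in> E" using E.funpow_in[of E A "b i" "Suc k"] AE bE[OF i] by blast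
        then show ?thesis using tr[OF i, of k] by (simp add: U_def A_def[symmetric] funpow_swap1)
      qed
      ultimately have "poly_op ps P' A (A (b i)) \<in> U" by (rule E.poly_op_in)
      then show ?thesis by (simp add: U_def \<Phi>_def P' E.poly_op_pCons)
    qed
    \<comment> \<open>tr(x D) is the sum of the tr([a i, b i] D), which by cyclicity equal - tr(a i
      [D, b i]). Here [D, b i] is \<open>\<Psi> (b i) = \<Phi> (b i)\<close>, to which
      \<open>a i\<close> is orthogonal.\<close>
    have "trace_on s V (\<lambda>v. x (D v)) = (\<Sum>i\<in>I. trace_on s V (\<lambda>v. a i (b i (D v)) - b i (a i (D v))))"
    proof -
      have "(\<lambda>v. a i (b i (D v)) - b i (a i (D v))) = ((a i \<circ> b i) \<circ> D) - ((b i \<circ> a i) \<circ> D)" for i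
        by (simp add: fun_eq_iff)
      then have "linear_map_on s V s V (\<lambda>v. a i (b i (D v)) - b i (a i (D v)))" if "i \<in> I" for i
        using Elin[OF Eminus] Ecomp DE aE[OF that] bE[OF that] by simp
      then show ?thesis unfolding x_eq by (rule trace_on_sum[OF V])
    qed
    also have "\<dots> = 0"
    proof (rule sum.neutral, rule ballI)
      fix i assume i: "i \<in> I"
      note ai = aE[OF i] and bi = bE[OF i]
      have "trace_on s V (\<lambda>v. a i (b i (D v)) - b i (a i (D v)))
          = trace_on s V (a i \<circ> (b i \<circ> D)) - trace_on s V (b i \<circ> (a i \<circ> D))"
        using tr_diff[of "a i \<circ> (b i \<circ> D)" "b i \<circ> (a i \<circ> D)"] ai bi DE Ecomp by simp
      also have "trace_on s V (b i \<circ> (a i \<circ> D)) = trace_on s V (a i \<circ> (D \<circ> b i))"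
        using tr_comm[of "b i" "a i \<circ> D"] ai bi DE Ecomp by (simp add: comp_assoc)
      also have "trace_on s V (a i \<circ> (b i \<circ> D)) - trace_on s V (a i \<circ> (D \<circ> b i)) = - trace_on s V (a i \<circ> \<Phi> (b i))"
      proof -
        have "a i \<circ> \<Phi> (b i) = (\<lambda>v. (a i \<circ> (D \<circ> b i)) v - (a i \<circ> (b i \<circ> D)) v)"
          using Ein[OF bi] Ein[OF DE] by (simp add: \<Phi>\<Psi>[OF bi] \<Psi>_def fun_eq_iff Ediff[OF ai])
        then show ?thesis
          using tr_diff[of "a i \<circ> (D \<circ> b i)" "a i \<circ> (b i \<circ> D)"] ai bi DE Ecomp by simp
      qed
      finally show "trace_on s V (\<lambda>v. a i (b i (D v)) - b i (a i (D v))) = 0" using tr_\<Phi>[OF i] by simp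
    qed
    finally have "trace_on s V (\<lambda>v. x (D v)) = 0" .
    \<comment> \<open>The same trace computed a second way: on \<open>V\<close> the product of
      \<open>x\<close> and \<open>D\<close> is the polynomial X Q in \<open>x\<close>, so its trace
      is the sum of the \<open>c * poly Q c\<close> over \<open>cs\<close>.\<close>
    moreover have "trace_on s V (\<lambda>v. x (D v)) = trace_on s V (poly_op s (pCons 0 Q) x)"
      by (rule trace_on_cong[OF V]) (simp add: D_def poly_op_pCons poly_op_commute[OF subV xlin])
    ultimately have "(\<Sum>c\<leftarrow>cs. c * poly Q c) = 0" using cs(1)[of "pCons 0 Q"] by simp
    moreover have "poly Q c = \<phi> c" if "c \<in> S" for c
    proof -
      have "[:-c, 1:] dvd Q - [:\<phi> c:]" using Q[OF that] \<open>m > 0\<close> by (metis dvd_power dvd_trans)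
      then show ?thesis by (simp add: poly_eq_0_iff_dvd[symmetric])
    qed
    then have "(\<Sum>c\<leftarrow>cs. c * poly Q c) = (\<Sum>c\<leftarrow>cs. c * of_rat (f c))"
      by (intro arg_cong[of _ _ sum_list] map_cong) (auto simp: S_def \<phi>_def)
    ultimately have "f (\<Sum>c\<leftarrow>cs. c * of_rat (f c)) = 0" using f0 by simp
    \<comment> \<open>The weights \<open>of_rat (f c)\<close> are rational and come out of
      \<open>f\<close>, which turns every term into a square.\<close>
    moreover have "f (\<Sum>c\<leftarrow>ds. c * of_rat (f c)) = (\<Sum>c\<leftarrow>ds. f c * f c)" for ds
      by (induction ds) (simp_all add: f0 f)
    ultimately have "(\<Sum>c\<leftarrow>cs. f c * f c) = 0" by simp
    then have "\<forall>r\<in>set (map (\<lambda>c. f c * f c) cs). r = 0"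
      by (subst (asm) sum_list_nonneg_eq_0_iff) auto
    then show ?thesis using c0(1) f(3) by (auto simp: S_def)
  qed
qed

section \<open>Extension of scalars\<close>

text \<open>Coefficients in this class make the polynomials over the closure a ring with Bezout
  coefficients, as the Chinese remainder argument requires.\<close>

instance alg_closure :: (field) field_gcd ..

lemma sum_fun_apply: "(\<Sum>i\<in>I. F i) x = (\<Sum>i\<in>I. F i x)"
  for F :: "'i \<Rightarrow> 'a \<Rightarrow> 'b::comm_monoid_add"
  by (induction I rule: infinite_finite_induct) auto

text \<open>For a basis \<open>B\<close> of \<open>V\<close> and values in a larger field, these are
  the coordinate vectors of the scalar extension of \<open>V\<close>; no tensor product is
  formed.\<close>

definition supported_on :: "'v set \<Rightarrow> ('v \<Rightarrow> 'k::zero) set" where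
  "supported_on B = {g. \<forall>v. v \<notin> B \<longrightarrow> g v = 0}"

definition delta :: "'v \<Rightarrow> 'v \<Rightarrow> 'k::zero_neq_one" where
  "delta b = (\<lambda>c. if c = b then 1 else 0)"

lemma inj_on_delta: "inj_on (delta :: 'v \<Rightarrow> 'v \<Rightarrow> 'k::zero_neq_one) B"
proof (rule inj_onI)
  fix b c :: 'v assume eq: "(delta b :: 'v \<Rightarrow> 'k) = delta c"
  have "delta c b = (1 :: 'k)" unfolding eq[symmetric] by (simp add: delta_def)
  then show "b = c" by (simp add: delta_def split: if_splits)
qed

lemma vector_space_function_scale: "vector_space (pointwise_scale (*) :: 'k::field \<Rightarrow> ('v \<Rightarrow> 'k) \<Rightarrow> _)"
  by (intro vector_space_pointwise_scale) (unfold_locales, auto simp: algebra_simps)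

lemma delta_basis:
  fixes B :: "'v set"
  assumes B: "finite B"
  shows "is_basis (pointwise_scale (*)) (supported_on B :: ('v \<Rightarrow> 'k::field) set) (delta ` B)"
    and "g \<in> supported_on B \<Longrightarrow> b \<in> B \<Longrightarrow>
      module.representation (pointwise_scale (*)) (delta ` B) g (delta b) = (g b :: 'k)"
proof -
  define sK where "sK = (pointwise_scale (*) :: 'k \<Rightarrow> ('v \<Rightarrow> 'k) \<Rightarrow> _)"
  interpret vector_space sK unfolding sK_def by (rule vector_space_function_scale)
  have comb: "(\<Sum>d\<in>delta ` B. sK (u d) d) c = (if c \<in> B then u (delta c) else 0)" for u c
  proof -
    have "(\<Sum>d\<in>delta ` B. sK (u d) d) c = (\<Sum>b\<in>B. sK (u (delta b)) (delta b) c)"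
      by (simp add: sum.reindex[OF inj_on_delta] sum_fun_apply)
    also have "\<dots> = (\<Sum>b\<in>B. if b = c then u (delta b) else 0)"
      by (rule sum.cong) (auto simp: sK_def pointwise_scale_def delta_def)
    finally show ?thesis using B by simp
  qed
  have ind: "independent (delta ` B)"
  proof
    assume "dependent (delta ` B)"
    then obtain u d where u: "d \<in> delta ` B" "u d \<noteq> 0" "(\<Sum>d\<in>delta ` B. sK (u d) d) = 0"
      using dependent_finite[of "delta ` B"] B by auto
    then obtain b where "b \<in> B" "d = delta b" by blast
    then show False using comb[of u b] u by simp
  qed
  have expand: "(\<Sum>d\<in>delta ` B. sK ((\<lambda>d. g (inv_into B delta d)) d) d) = g" if "g \<in> supported_on B" for g
    unfolding fun_eq_iff comb using that by (auto simp: supported_on_def inv_into_f_f[OF inj_on_delta])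
  have "subspace (supported_on B)"
    by (rule subspaceI) (auto simp: supported_on_def sK_def pointwise_scale_def)
  then have "span (delta ` B) \<subseteq> supported_on B"
    by (intro span_minimal) (auto simp: supported_on_def delta_def)
  moreover have "supported_on B \<subseteq> span (delta ` B)"
  proof
    fix g :: "'v \<Rightarrow> 'k" assume g: "g \<in> supported_on B"
    have "(\<Sum>d\<in>delta ` B. sK (g (inv_into B delta d)) d) \<in> span (delta ` B)"
      by (intro span_sum span_scale span_base)
    then show "g \<in> span (delta ` B)" using expand[OF g] by simp
  qed
  ultimately have sp: "span (delta ` B) = supported_on B" by blast
  show "is_basis (pointwise_scale (*)) (supported_on B :: ('v \<Rightarrow> 'k) set) (delta ` B)"
    using ind sp B unfolding is_basis_def sK_def by blast
  show "module.representation (pointwise_scale (*)) (delta ` B) g (delta b) = g b"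
    if g: "g \<in> supported_on B" and b: "b \<in> B"
  proof -
    have "g b = (\<Sum>d\<in>delta ` B. sK (representation (delta ` B) g d) d) b"
      using sum_representation_eq[OF ind, of g "delta ` B"] g sp B by simp
    then show ?thesis using b comb unfolding sK_def by simp
  qed
qed

text \<open>The matrix of \<open>f\<close> in the basis \<open>B\<close>, with its entries mapped
  into the closure, acting on coordinate vectors. The value 0 off the space is what membership in
  \<open>gl\<close> demands.\<close>

definition scalar_ext ::
  "('f::field \<Rightarrow> 'v::ab_group_add \<Rightarrow> 'v) \<Rightarrow> 'v set \<Rightarrow> ('v \<Rightarrow> 'v) \<Rightarrow> ('v \<Rightarrow> 'f alg_closure) \<Rightarrow> 'v \<Rightarrow> 'f alg_closure" where
  "scalar_ext s B f g =
     (if g \<in> supported_on B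
      then \<lambda>c. if c \<in> B then \<Sum>b\<in>B. to_ac (module.representation s B (f b) c) * g b else 0
      else 0)"

context vector_space
begin

context
  fixes V B
  assumes B: "is_basis scale V B"
begin

abbreviation (input) "ext \<equiv> scalar_ext scale B"
abbreviation (input) "VK \<equiv> supported_on B :: ('b \<Rightarrow> 'a alg_closure) set"
abbreviation (input) "sK \<equiv> pointwise_scale (*) :: 'a alg_closure \<Rightarrow> ('b \<Rightarrow> 'a alg_closure) \<Rightarrow> 'b \<Rightarrow> 'a alg_closure"

lemma basis_props: "finite B" "independent B" "span B = V" "subspace V"
  using B by (auto simp: is_basis_def)

lemma scalar_ext_supported: "scalar_ext scale B f g \<in> supported_on B"
  by (simp add: scalar_ext_def supported_on_def)

lemma scalar_ext_in_gl: "ext f \<in> lie_carrier (gl sK VK)"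
proof -
  interpret K: vector_space sK by (rule vector_space_function_scale)
  have VK: "g + h \<in> VK" "sK c g \<in> VK" if "g \<in> VK" "h \<in> VK" for g h c
    using that by (auto simp: supported_on_def pointwise_scale_def)
  show ?thesis
    unfolding K.gl_carrier_iff linear_map_on_def
  proof (intro conjI ballI allI impI)
    fix g :: "'b \<Rightarrow> 'a alg_closure"
    show "ext f g \<in> VK" by (rule scalar_ext_supported)
    show "ext f g = 0" if "g \<notin> VK" using that by (simp add: scalar_ext_def)
    assume g: "g \<in> VK"
    show "ext f (sK c g) = sK c (ext f g)" for c
      using g VK(2)[OF g g]
      by (auto simp: scalar_ext_def fun_eq_iff pointwise_scale_def sum_distrib_left mult.left_commute)
    fix h assume h: "h \<in> VK"
    show "ext f (g + h) = ext f g + ext f h"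
      using g h VK(1)[OF g h]
      by (auto simp: scalar_ext_def fun_eq_iff distrib_left sum.distrib)
  qed
qed

lemma scalar_ext_comp:
  assumes f: "linear_map_on scale V scale V f" and h: "linear_map_on scale V scale V h"
  shows "ext (f \<circ> h) = ext f \<circ> ext h"
proof
  fix g :: "'b \<Rightarrow> 'a alg_closure"
  show "ext (f \<circ> h) g = (ext f \<circ> ext h) g"
  proof (cases "g \<in> VK")
    case True
    have rep: "representation B (f (h b)) c = (\<Sum>d\<in>B. representation B (h b) d * representation B (f d) c)"
      if "b \<in> B" for b c
    proof -
      have hb: "h b \<in> V" using h is_basis_in[OF B that] by (simp add: linear_map_on_def)
      have "f (h b) = f (\<Sum>d\<in>B. scale (representation B (h b) d) d)"
        using is_basis_expand[OF B hb] by simp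
      also have "\<dots> = (\<Sum>d\<in>B. f (scale (representation B (h b) d) d))"
        by (rule linear_map_on_sum[OF f basis_props(4) vector_space_axioms])
          (use is_basis_in[OF B] basis_props(4) subspace_scale in auto)
      also have "\<dots> = (\<Sum>d\<in>B. scale (representation B (h b) d) (f d))"
        using f is_basis_in[OF B] by (simp add: linear_map_on_def)
      finally show ?thesis
        using f is_basis_in[OF B] basis_props by (simp add: representation_sum_scale linear_map_on_def)
    qed
    have "ext (f \<circ> h) g c = ext f (ext h g) c" for c
    proof (cases "c \<in> B")
      case c: True
      have "ext f (ext h g) c = (\<Sum>d\<in>B. to_ac (representation B (f d) c) * ext h g d)"
        using c scalar_ext_supported[of h g] by (simp add: scalar_ext_def)
      also have "\<dots> = (\<Sum>d\<in>B. \<Sum>b\<in>B. to_ac (representation B (f d) c) * (to_ac (representation B (h b) d) * g b))"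
        using True by (simp add: scalar_ext_def sum_distrib_left)
      also have "\<dots> = (\<Sum>b\<in>B. (\<Sum>d\<in>B. to_ac (representation B (h b) d * representation B (f d) c)) * g b)"
        by (subst sum.swap) (simp add: sum_distrib_left sum_distrib_right mult_ac)
      also have "\<dots> = ext (f \<circ> h) g c"
        using True c by (simp add: scalar_ext_def rep to_ac_sum)
      finally show ?thesis by simp
    qed (use scalar_ext_supported[of f "ext h g"] scalar_ext_supported[of "f \<circ> h" g] in \<open>simp add: supported_on_def\<close>)
    then show ?thesis by (simp add: fun_eq_iff)
  next
    case False
    have "ext f 0 = 0" by (simp add: scalar_ext_def fun_eq_iff)
    then show ?thesis using False by (simp add: scalar_ext_def[of _ _ _ g])
  qed
qed

lemma scalar_ext_diff:
  assumes f: "linear_map_on scale V scale V f" and h: "linear_map_on scale V scale V h"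
  shows "ext (f - h) = ext f - ext h"
proof -
  have "representation B ((f - h) b) c = representation B (f b) c - representation B (h b) c" if "b \<in> B" for b c
    using f h is_basis_in[OF B that] basis_props by (simp add: representation_diff linear_map_on_def)
  then show ?thesis
    by (auto simp: fun_eq_iff scalar_ext_def left_diff_distrib sum_subtractf)
qed

lemma scalar_ext_sum:
  assumes f: "\<And>i. i \<in> I \<Longrightarrow> linear_map_on scale V scale V (f i)"
  shows "ext (\<lambda>v. \<Sum>i\<in>I. f i v) g = (\<Sum>i\<in>I. ext (f i) g)"
proof
  fix c
  have "representation B (\<Sum>i\<in>I. f i b) c = (\<Sum>i\<in>I. representation B (f i b) c)" if "b \<in> B" for b
    using f is_basis_in[OF B that] basis_props by (subst representation_sum) (auto simp: linear_map_on_def)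
  then show "ext (\<lambda>v. \<Sum>i\<in>I. f i v) g c = (\<Sum>i\<in>I. ext (f i) g) c"
    by (auto simp: sum_fun_apply scalar_ext_def to_ac_sum sum_distrib_right intro: sum.swap)
qed

lemma trace_on_scalar_ext:
  assumes f: "linear_map_on scale V scale V f"
  shows "trace_on sK VK (ext f) = to_ac (trace_on scale V f)"
proof -
  interpret K: vector_space sK by (rule vector_space_function_scale)
  have lin: "linear_map_on sK VK sK VK (ext f)" using scalar_ext_in_gl K.gl_carrier_iff by blast
  have "ext f (delta b) b = to_ac (representation B (f b) b)" if b: "b \<in> B" for b
  proof -
    have "delta b \<in> VK" using b by (auto simp: supported_on_def delta_def)
    then have "ext f (delta b) b = (\<Sum>c\<in>B. if c = b then to_ac (representation B (f b) b) else 0)"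
      using b by (simp add: scalar_ext_def) (rule sum.cong, auto simp: delta_def)
    then show ?thesis using b basis_props by simp
  qed
  then show ?thesis
    unfolding trace_on_eq[OF vector_space_axioms B f]
      trace_on_eq[OF K.vector_space_axioms delta_basis(1)[OF basis_props(1)] lin]
    by (simp add: sum.reindex[OF inj_on_delta] delta_basis(2)[OF basis_props(1)] scalar_ext_supported to_ac_sum)
qed

text \<open>On the unit vectors the extension displays the matrix entries of \<open>f\<close>, and
  \<open>to_ac\<close> is injective. This is the step back from the closure to the given
  field.\<close>

lemma scalar_ext_eq_0:
  assumes f: "linear_map_on scale V scale V f" and "\<And>g. g \<in> VK \<Longrightarrow> ext f g = 0" and v: "v \<in> V"
  shows "f v = 0"
proof -
  have fb: "f b = 0" if b: "b \<in> B" for b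
  proof -
    have "representation B (f b) c = 0" if c: "c \<in> B" for c
    proof -
      have d: "delta b \<in> VK" using b by (auto simp: supported_on_def delta_def)
      have "ext f (delta b) c = (\<Sum>d\<in>B. if d = b then to_ac (representation B (f b) c) else 0)"
        using c d by (simp add: scalar_ext_def) (rule sum.cong, auto simp: delta_def)
      then show ?thesis using assms(2)[OF d] b basis_props by simp
    qed
    moreover have "f b \<in> V" using f is_basis_in[OF B b] by (simp add: linear_map_on_def)
    ultimately show ?thesis using is_basis_expand[OF B, of "f b"] by simp
  qed
  have "f v = f (\<Sum>b\<in>B. scale (representation B v b) b)" using is_basis_expand[OF B v] by simp
  also have "\<dots> = (\<Sum>b\<in>B. f (scale (representation B v b) b))"
    by (rule linear_map_on_sum[OF f basis_props(4) vector_space_axioms])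
      (use is_basis_in[OF B] basis_props(4) subspace_scale in auto)
  also have "\<dots> = 0" using f is_basis_in[OF B] fb by (simp add: linear_map_on_def)
  finally show ?thesis .
qed

end

end

text \<open>Extension of scalars respects products, differences, sums and traces, so the hypotheses
  go up to the closure; the conclusion is that a power vanishes, which comes down again.\<close>

lemma trace_condition_imp_nilpotent:
  fixes s :: "'f::field_char_0 \<Rightarrow> 'v::ab_group_add \<Rightarrow> 'v"
  assumes vs: "vector_space s" and V: "fin_dim s V"
    and x: "x \<in> lie_carrier (gl s V)"
    and ab: "\<And>i. i \<in> I \<Longrightarrow> a i \<in> lie_carrier (gl s V)" "\<And>i. i \<in> I \<Longrightarrow> b i \<in> lie_carrier (gl s V)"
    and x_eq: "\<And>v. x v = (\<Sum>i\<in>I. a i (b i v) - b i (a i v))"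
    and tr: "\<And>i k. i \<in> I \<Longrightarrow> trace_on s V (a i \<circ> ((\<lambda>y. (x \<circ> y) - (y \<circ> x)) ^^ Suc k) (b i)) = 0"
  shows "\<exists>m. \<forall>v\<in>V. (x ^^ m) v = 0"
proof -
  interpret vector_space s by fact
  obtain B where B: "is_basis s V B" using fin_dim_obtain_basis[OF V] .
  define E where "E = lie_carrier (gl s V)"
  define e where "e = scalar_ext s B"
  define sK where "sK = (pointwise_scale (*) :: 'f alg_closure \<Rightarrow> ('v \<Rightarrow> 'f alg_closure) \<Rightarrow> _)"
  define VK where "VK = (supported_on B :: ('v \<Rightarrow> 'f alg_closure) set)"
  interpret K: vector_space sK unfolding sK_def by (rule vector_space_function_scale)
  have subV: "subspace V" using V by (rule fin_dim_imp_subspace)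
  have lin: "linear_map_on s V s V f" if "f \<in> E" for f using that by (simp add: E_def gl_carrier_iff)
  note Ecomp = gl_comp[OF subV, folded E_def] and Eminus = gl_diff[OF subV, folded E_def]
  have xE: "x \<in> E" and aE: "\<And>i. i \<in> I \<Longrightarrow> a i \<in> E" and bE: "\<And>i. i \<in> I \<Longrightarrow> b i \<in> E"
    using x ab by (simp_all add: E_def)
  have comp: "e (f \<circ> h) = e f \<circ> e h" if "f \<in> E" "h \<in> E" for f h
    unfolding e_def by (rule scalar_ext_comp[OF B lin[OF that(1)] lin[OF that(2)]])
  have diff: "e (f - h) = e f - e h" if "f \<in> E" "h \<in> E" for f h
    unfolding e_def by (rule scalar_ext_diff[OF B lin[OF that(1)] lin[OF that(2)]])
  define A where "A = (\<lambda>y. (x \<circ> y) - (y \<circ> x))"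
  define AK where "AK = (\<lambda>y. (e x \<circ> y) - (y \<circ> e x))"
  have AE: "A y \<in> E" if "y \<in> E" for y unfolding A_def using that xE by (intro Eminus Ecomp)
  have Apow: "(A ^^ k) y \<in> E \<and> e ((A ^^ k) y) = (AK ^^ k) (e y)" if "y \<in> E" for k y
  proof (induction k)
    case (Suc k)
    define z where "z = (A ^^ k) y"
    have z: "z \<in> E" "e z = (AK ^^ k) (e y)" using Suc unfolding z_def by auto
    then have "e (A z) = AK (e z)" unfolding A_def AK_def using xE by (simp add: diff comp Ecomp)
    then show ?case using z AE[OF z(1)] by (simp add: z_def[symmetric])
  qed (use that in simp)
  have "\<exists>m. \<forall>g\<in>VK. (e x ^^ m) g = 0"
  proof (rule trace_condition_imp_nilpotent_alg_closed[of sK VK "e x" I "\<lambda>i. e (a i)" "\<lambda>i. e (b i)"])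
    show "vector_space sK" by (rule K.vector_space_axioms)
    show "fin_dim sK VK"
      unfolding sK_def VK_def
      by (rule vector_space.is_basis_fin_dim[OF vector_space_function_scale])
         (rule delta_basis(1), use B in \<open>simp add: is_basis_def\<close>)
    have inK: "e f \<in> lie_carrier (gl sK VK)" for f
      unfolding e_def sK_def VK_def by (rule scalar_ext_in_gl[OF B])
    then show "e x \<in> lie_carrier (gl sK VK)" "e (a i) \<in> lie_carrier (gl sK VK)"
      "e (b i) \<in> lie_carrier (gl sK VK)" for i by blast+
    show "e x g = (\<Sum>i\<in>I. e (a i) (e (b i) g) - e (b i) (e (a i) g))" for g
    proof -
      have in_E: "(a i \<circ> b i) - (b i \<circ> a i) \<in> E" if "i \<in> I" for i
        using that by (intro Eminus Ecomp aE bE)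
      have "e x g = e (\<lambda>v. \<Sum>i\<in>I. ((a i \<circ> b i) - (b i \<circ> a i)) v) g"
        by (rule arg_cong[of _ _ "\<lambda>y. e y g"]) (simp add: x_eq fun_eq_iff)
      also have "\<dots> = (\<Sum>i\<in>I. e ((a i \<circ> b i) - (b i \<circ> a i)) g)"
        unfolding e_def by (rule scalar_ext_sum[OF B lin[OF in_E]])
      also have "\<dots> = (\<Sum>i\<in>I. e (a i) (e (b i) g) - e (b i) (e (a i) g))"
        using aE bE by (intro sum.cong) (simp_all add: diff comp Ecomp)
      finally show ?thesis .
    qed
    show "trace_on sK VK (e (a i) \<circ> ((\<lambda>y. (e x \<circ> y) - (y \<circ> e x)) ^^ Suc k) (e (b i))) = 0" if i: "i \<in> I" for i k
    proof -
      have inE: "(A ^^ Suc k) (b i) \<in> E" and eq: "e ((A ^^ Suc k) (b i)) = (AK ^^ Suc k) (e (b i))"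
        using Apow[OF bE[OF i], of "Suc k"] by blast+
      have "trace_on sK VK (e (a i \<circ> (A ^^ Suc k) (b i))) = to_ac (trace_on s V (a i \<circ> (A ^^ Suc k) (b i)))"
        unfolding e_def sK_def VK_def
        by (rule trace_on_scalar_ext[OF B lin[OF Ecomp[OF aE[OF i] inE]]])
      then show ?thesis
        unfolding comp[OF aE[OF i] inE] eq AK_def[symmetric] using tr[OF i, of k] unfolding A_def[symmetric] by simp
    qed
  qed
  then obtain m where m: "\<And>g. g \<in> VK \<Longrightarrow> (e x ^^ m) g = 0" by blast
  \<comment> \<open>Powers start at \<open>Suc\<close>: the zeroth power is the identity of the
    whole type, which need not vanish outside \<open>V\<close> and so need not lie in
    \<open>E\<close>.\<close>
  have pow: "x ^^ Suc k \<in> E \<and> e (x ^^ Suc k) = e x ^^ Suc k" for k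
  proof (induction k)
    case (Suc k)
    then have IH: "x ^^ Suc k \<in> E" "e (x ^^ Suc k) = e x ^^ Suc k" by blast+
    have pow2: "f ^^ Suc (Suc k) = f \<circ> (f ^^ Suc k)" for f :: "'c \<Rightarrow> 'c" by (rule funpow.simps(2))
    show ?case unfolding pow2 comp[OF xE IH(1)] IH(2) using Ecomp[OF xE IH(1)] by blast
  qed (use xE in simp)
  have "(x ^^ Suc m) v = 0" if "v \<in> V" for v
  proof (rule scalar_ext_eq_0[OF B lin _ that])
    show "x ^^ Suc m \<in> E" using pow by blast
    fix g :: "'v \<Rightarrow> 'f alg_closure" assume "g \<in> supported_on B"
    then have "(e x ^^ m) g = 0" using m by (simp add: VK_def)
    moreover have "e x 0 = 0" by (simp add: e_def scalar_ext_def fun_eq_iff)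
    ultimately have "(e x ^^ Suc m) g = 0" by simp
    then show "scalar_ext s B (x ^^ Suc m) g = 0" using pow[of m] unfolding e_def by simp
  qed
  then show ?thesis by blast
qed

text \<open>Nondegeneracy on \<open>S\<close> makes the map from \<open>S\<close> to its dual
  injective, hence surjective by dimension; so the functional that \<open>x\<close> induces on
  \<open>S\<close> is induced by some \<open>u\<close> in \<open>S\<close>. A functional is recorded
  by its values on a basis, which is the map \<open>T\<close> of the proof.\<close>

lemma (in vector_space) orthogonal_split:
  assumes S: "fin_dim scale S" "S \<subseteq> L"
    and add: "\<And>u v w. u \<in> L \<Longrightarrow> v \<in> L \<Longrightarrow> w \<in> L \<Longrightarrow> \<beta> (u + v) w = \<beta> u w + \<beta> v w"
      "\<And>u v w. u \<in> L \<Longrightarrow> v \<in> L \<Longrightarrow> w \<in> L \<Longrightarrow> \<beta> w (u + v) = \<beta> w u + \<beta> w v"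
    and scl: "\<And>c u w. u \<in> L \<Longrightarrow> w \<in> L \<Longrightarrow> \<beta> (scale c u) w = c * \<beta> u w"
      "\<And>c u w. u \<in> L \<Longrightarrow> w \<in> L \<Longrightarrow> \<beta> w (scale c u) = c * \<beta> w u"
    and nondeg: "\<And>u. u \<in> S \<Longrightarrow> (\<And>w. w \<in> S \<Longrightarrow> \<beta> u w = 0) \<Longrightarrow> u = 0"
    and L: "subspace L" and x: "x \<in> L"
  shows "\<exists>u\<in>S. \<forall>w\<in>S. \<beta> (x - u) w = 0"
proof -
  have subS: "subspace S" using S(1) by (rule fin_dim_imp_subspace)
  obtain B where B: "is_basis scale S B" using fin_dim_obtain_basis[OF S(1)] .
  have fB: "finite B" using B by (simp add: is_basis_def)
  have BS: "b \<in> S" if "b \<in> B" for b using is_basis_in[OF B that] .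
  have BL: "b \<in> L" if "b \<in> B" for b using BS[OF that] S(2) by blast
  define sF where "sF = (pointwise_scale (*) :: 'a \<Rightarrow> ('b \<Rightarrow> 'a) \<Rightarrow> _)"
  interpret F: vector_space sF unfolding sF_def by (rule vector_space_function_scale)
  define T where "T u = (\<lambda>b. if b \<in> B then \<beta> u b else 0)" for u
  have lin1: "linear_map_on scale L (*) UNIV (\<lambda>u. \<beta> u w)" if "w \<in> L" for w
    using add scl that by (auto simp: linear_map_on_def)
  have lin2: "linear_map_on scale L (*) UNIV (\<beta> w)" if "w \<in> L" for w
    using add scl that by (auto simp: linear_map_on_def)
  have vsF: "vector_space ((*) :: 'a \<Rightarrow> 'a \<Rightarrow> 'a)" by unfold_locales (auto simp: algebra_simps)
  have comb: "\<beta> (\<Sum>b\<in>B. scale (r b) b) w = (\<Sum>b\<in>B. r b * \<beta> b w)" if "w \<in> L" for r w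
  proof -
    have "\<beta> (\<Sum>b\<in>B. scale (r b) b) w = (\<Sum>b\<in>B. \<beta> (scale (r b) b) w)"
      by (rule linear_map_on_sum[OF lin1[OF that] L vsF]) (use BL L subspace_scale in auto)
    then show ?thesis using BL scl(1) that by simp
  qed
  have test: "\<beta> u w = 0" if "u \<in> L" "w \<in> S" "\<And>b. b \<in> B \<Longrightarrow> \<beta> u b = 0" for u w
  proof -
    have "\<beta> u w = \<beta> u (\<Sum>b\<in>B. scale (representation B w b) b)"
      using is_basis_expand[OF B that(2)] by simp
    also have "\<dots> = (\<Sum>b\<in>B. \<beta> u (scale (representation B w b) b))"
      by (rule linear_map_on_sum[OF lin2[OF that(1)] L vsF]) (use BL L subspace_scale in auto)
    also have "\<dots> = 0" using BL scl(2) that(1,3) by simp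
    finally show ?thesis .
  qed
  have S_comb: "(\<Sum>b\<in>B. scale (r b) b) \<in> S" for r
    by (intro subspace_sum[OF subS] subspace_scale[OF subS] BS)
  have T_comb: "(\<Sum>b\<in>B. sF (r b) (T b)) = T (\<Sum>b\<in>B. scale (r b) b)" for r
    by (auto simp: fun_eq_iff sum_fun_apply sF_def pointwise_scale_def T_def comb[OF BL])
  have zero: "r b = 0" if "(\<Sum>b\<in>B. sF (r b) (T b)) = 0" "b \<in> B" for r b
  proof -
    define u where "u = (\<Sum>b\<in>B. scale (r b) b)"
    have uS: "u \<in> S" unfolding u_def by (rule S_comb)
    have Tu: "T u = 0" using that(1) unfolding T_comb u_def .
    have "\<beta> u b = 0" if "b \<in> B" for b using that fun_cong[OF Tu, of b] by (simp add: T_def)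
    then have "u = 0" using nondeg[OF uS] test[of u] uS S(2) by blast
    then show "r b = 0"
      using independentD[of B B r b] B that(2) unfolding u_def is_basis_def by blast
  qed
  \<comment> \<open>Independence is about the image set of \<open>B\<close>, so repetitions among
    the \<open>T b\<close> have to be excluded first. Two equal images would give a relation with
    coefficients 1 and -1.\<close>
  have injT: "inj_on T B"
  proof (rule inj_onI, rule ccontr)
    fix b c assume bc: "b \<in> B" "c \<in> B" "T b = T c" "b \<noteq> c"
    define r where "r d = (if d = b then 1 else if d = c then - 1 else (0::'a))" for d
    have "(\<Sum>d\<in>B. sF (r d) (T d)) = (\<Sum>d\<in>B. (if d = b then T b else 0) + (if d = c then - T c else 0))"
      using bc(4) by (intro sum.cong) (auto simp: r_def)
    also have "\<dots> = 0" using bc fB by (simp add: sum.distrib)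
    finally show False using zero[of r b] bc(1) by (simp add: r_def)
  qed
  have "F.independent (T ` B)"
  proof
    assume "F.dependent (T ` B)"
    then obtain r d where r: "d \<in> T ` B" "r d \<noteq> 0" "(\<Sum>d\<in>T ` B. sF (r d) d) = 0"
      using F.dependent_finite[of "T ` B"] fB by auto
    then show False using zero[of "\<lambda>b. r (T b)"] injT by (auto simp: sum.reindex)
  qed
  moreover have "T ` B \<subseteq> supported_on B" by (auto simp: T_def supported_on_def)
  moreover have "card (delta ` B :: ('b \<Rightarrow> 'a) set) \<le> card (T ` B)"
    by (simp add: card_image[OF injT] card_image[OF inj_on_delta])
  moreover have "is_basis sF (supported_on B) (delta ` B)"
    unfolding sF_def by (rule delta_basis(1)[OF fB])
  ultimately have span: "F.span (T ` B) = supported_on B"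
    using F.independent_card_dim_spans by blast
  have "T x \<in> F.span (T ` B)" unfolding span by (simp add: T_def supported_on_def)
  then obtain r where "T x = (\<Sum>d\<in>T ` B. sF (r d) d)" using fB by (auto simp: F.span_finite)
  then have Tx: "T x = T (\<Sum>b\<in>B. scale (r (T b)) b)"
    using T_comb[of "\<lambda>b. r (T b)"] injT by (simp add: sum.reindex)
  define u where "u = (\<Sum>b\<in>B. scale (r (T b)) b)"
  have uS: "u \<in> S" unfolding u_def by (rule S_comb)
  have xu: "x - u \<in> L" using x uS S(2) L subspace_diff by blast
  have "\<beta> (x - u) b = 0" if b: "b \<in> B" for b
  proof -
    have "\<beta> x b = \<beta> u b" using fun_cong[OF Tx, of b] b unfolding u_def[symmetric] by (simp add: T_def)
    moreover have "\<beta> x b = \<beta> (x - u) b + \<beta> u b" using add(1)[OF xu _ BL[OF b], of u] uS S(2) by auto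
    ultimately show ?thesis by simp
  qed
  then show ?thesis using uS test[OF xu] by blast
qed

section \<open>Lie algebras and their representations\<close>

locale fin_lie =
  fixes g :: "('f::field_char_0, 'g::ab_group_add) lie"
  assumes lie: "lie_algebra g" and fin: "fin_dim (lie_scale g) (lie_carrier g)"
begin

sublocale vector_space "lie_scale g"
  using lie by (simp add: lie_algebra_def)

abbreviation "L \<equiv> lie_carrier g"
abbreviation "br \<equiv> lie_bracket g"
abbreviation "sc \<equiv> lie_scale g"
abbreviation "Z \<equiv> lie_centre g"
abbreviation "S \<equiv> lie_derived g"

lemma subL: "subspace L"
  using lie by (simp add: lie_algebra_def)

lemma br_in: "x \<in> L \<Longrightarrow> y \<in> L \<Longrightarrow> br x y \<in> L"
  using lie by (simp add: lie_algebra_def linear_map_on_def)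

lemma br_linear: "x \<in> L \<Longrightarrow> linear_map_on sc L sc L (br x)" "y \<in> L \<Longrightarrow> linear_map_on sc L sc L (\<lambda>x. br x y)"
  using lie by (simp_all add: lie_algebra_def)

lemma br_add:
  "x \<in> L \<Longrightarrow> y \<in> L \<Longrightarrow> z \<in> L \<Longrightarrow> br (x + y) z = br x z + br y z"
  "x \<in> L \<Longrightarrow> y \<in> L \<Longrightarrow> z \<in> L \<Longrightarrow> br z (x + y) = br z x + br z y"
  using br_linear by (auto simp: linear_map_on_def)

lemma br_scale:
  "x \<in> L \<Longrightarrow> y \<in> L \<Longrightarrow> br (sc c x) y = sc c (br x y)"
  "x \<in> L \<Longrightarrow> y \<in> L \<Longrightarrow> br x (sc c y) = sc c (br x y)"
  using br_linear by (auto simp: linear_map_on_def)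

lemma br_diff:
  "x \<in> L \<Longrightarrow> y \<in> L \<Longrightarrow> z \<in> L \<Longrightarrow> br (x - y) z = br x z - br y z"
  "x \<in> L \<Longrightarrow> y \<in> L \<Longrightarrow> z \<in> L \<Longrightarrow> br z (x - y) = br z x - br z y"
  using linear_map_on_diff[OF br_linear(1) subL] linear_map_on_diff[OF br_linear(2) subL] by blast+

lemma br_zero: "x \<in> L \<Longrightarrow> br x 0 = 0" "x \<in> L \<Longrightarrow> br 0 x = 0"
  using br_diff[of x x x] subspace_0[OF subL] by simp_all

lemma br_self: "x \<in> L \<Longrightarrow> br x x = 0"
  using lie by (simp add: lie_algebra_def)

lemma br_anti: "x \<in> L \<Longrightarrow> y \<in> L \<Longrightarrow> br x y = - br y x"
  using br_self[of "x + y"] br_self[of x] br_self[of y] subspace_add[OF subL]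
  by (simp add: br_add eq_neg_iff_add_eq_0 add.commute)

text \<open>The cyclic identity rewritten so that \<open>br x\<close> is a derivation, the shape
  that inductions over brackets use.\<close>

lemma jacobi: "x \<in> L \<Longrightarrow> y \<in> L \<Longrightarrow> z \<in> L \<Longrightarrow> br x (br y z) = br (br x y) z + br y (br x z)"
proof -
  assume xyz: "x \<in> L" "y \<in> L" "z \<in> L"
  then have "br x (br y z) + br y (br z x) + br z (br x y) = 0"
    using lie by (simp add: lie_algebra_def)
  moreover have "br y (br z x) = - br y (br x z)"
    using br_anti[of z x] br_scale(2)[of y "br x z" "- 1"] xyz br_in by simp
  moreover have "br z (br x y) = - br (br x y) z" using br_anti[of z "br x y"] xyz br_in by simp
  ultimately show ?thesis by (simp add: algebra_simps eq_diff_eq)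
qed

lemma idealD:
  assumes "lie_ideal g I"
  shows "I \<subseteq> L" "subspace I" "\<And>x y. x \<in> L \<Longrightarrow> y \<in> I \<Longrightarrow> br x y \<in> I" "\<And>x y. x \<in> L \<Longrightarrow> y \<in> I \<Longrightarrow> br y x \<in> I"
proof -
  show *: "I \<subseteq> L" "subspace I" "\<And>x y. x \<in> L \<Longrightarrow> y \<in> I \<Longrightarrow> br x y \<in> I"
    using assms by (auto simp: lie_ideal_def)
  show "br y x \<in> I" if "x \<in> L" "y \<in> I" for x y
    using br_anti[of y x] *(3)[OF that] subspace_neg[OF *(2)] *(1) that by auto
qed

lemma ideal_Int: "lie_ideal g I \<Longrightarrow> lie_ideal g J \<Longrightarrow> lie_ideal g (I \<inter> J)"
  by (auto simp: lie_ideal_def subspace_inter)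

lemma centre_ideal: "lie_ideal g Z"
  unfolding lie_ideal_def
proof (intro conjI ballI)
  show "subspace Z"
    by (rule subspaceI) (auto simp: lie_centre_def subspace_0[OF subL] subspace_add[OF subL]
        subspace_scale[OF subL] br_zero br_add br_scale)
  show "br x y \<in> Z" if "x \<in> L" "y \<in> Z" for x y
  proof -
    have "br x y = 0" using br_anti[of x y] that by (simp add: lie_centre_def)
    then show ?thesis by (simp add: lie_centre_def subspace_0[OF subL] br_zero)
  qed
qed (auto simp: lie_centre_def)

lemma centreD: "z \<in> Z \<Longrightarrow> x \<in> L \<Longrightarrow> br z x = 0" "z \<in> Z \<Longrightarrow> x \<in> L \<Longrightarrow> br x z = 0" "z \<in> Z \<Longrightarrow> z \<in> L"
  using br_anti[of x z] by (auto simp: lie_centre_def)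

definition commutator :: "'g set \<Rightarrow> 'g set" where
  "commutator C = span {br x y | x y. x \<in> C \<and> y \<in> L}"

lemma derived_eq: "S = commutator L"
  by (simp add: lie_derived_def commutator_def)

lemma commutator_sub:
  assumes "lie_ideal g C"
  shows "commutator C \<subseteq> C"
  unfolding commutator_def using idealD[OF assms] by (intro span_minimal) auto

lemma commutator_in: "x \<in> C \<Longrightarrow> y \<in> L \<Longrightarrow> br x y \<in> commutator C"
  unfolding commutator_def by (rule span_base) blast

lemma commutator_ideal:
  assumes "lie_ideal g C"
  shows "lie_ideal g (commutator C)"
  unfolding lie_ideal_def
proof (intro conjI ballI)
  show "commutator C \<subseteq> L" using commutator_sub[OF assms] idealD[OF assms] by blast
  show "subspace (commutator C)" by (simp add: commutator_def)
  fix x y assume x: "x \<in> L" and y: "y \<in> commutator C"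
  have "br x y \<in> commutator C \<and> y \<in> L" using y unfolding commutator_def
  proof (induction y rule: span_induct_alt)
    case base
    then show ?case using x by (simp add: br_zero span_zero subspace_0[OF subL])
  next
    case (step c u y)
    then obtain a b where u: "u = br a b" "a \<in> C" "b \<in> L" by blast
    then have uL: "u \<in> L" and aL: "a \<in> L" using br_in idealD(1)[OF assms] by blast+
    have "br x u = br (br x a) b + br a (br x b)" unfolding u(1) by (rule jacobi[OF x aL u(3)])
    then have "br x u \<in> commutator C"
      using commutator_in[of "br x a" C b] commutator_in[of a C "br x b"] u(2,3) x br_in idealD(3)[OF assms x u(2)]
      unfolding commutator_def by (simp add: span_add)
    then show ?case
      using step.IH x uL by (simp add: commutator_def br_add br_scale span_add span_scale subspace_add[OF subL] subspace_scale[OF subL])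
  qed
  then show "br x y \<in> commutator C" ..
qed

lemma L_ideal: "lie_ideal g L"
  by (simp add: lie_ideal_def subL br_in)

lemma derived_ideal: "lie_ideal g S"
  unfolding derived_eq by (rule commutator_ideal[OF L_ideal])

text \<open>Scalars are absorbed into the left factors, which stay in \<open>C\<close>. The result
  is a plain sum of brackets, as the nilpotency criterion expects.\<close>

lemma commutator_sum:
  assumes C: "subspace C" "C \<subseteq> L" and x: "x \<in> commutator C"
  obtains I :: "'g set" and a b where "finite I" "x = (\<Sum>i\<in>I. br (a i) (b i))" "\<And>i. i \<in> I \<Longrightarrow> a i \<in> C" "\<And>i. i \<in> I \<Longrightarrow> b i \<in> L"
proof -
  obtain t r where t: "finite t" "t \<subseteq> {br x y | x y. x \<in> C \<and> y \<in> L}" "x = (\<Sum>v\<in>t. sc (r v) v)"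
    using x unfolding commutator_def span_explicit by blast
  have "\<forall>v\<in>t. \<exists>a b. v = br a b \<and> a \<in> C \<and> b \<in> L" using t(2) by blast
  then obtain a b where ab: "\<And>v. v \<in> t \<Longrightarrow> v = br (a v) (b v) \<and> a v \<in> C \<and> b v \<in> L" by metis
  show ?thesis
  proof (rule that[of t "\<lambda>v. sc (r v) (a v)" b])
    show "x = (\<Sum>i\<in>t. br (sc (r i) (a i)) (b i))"
      unfolding t(3) using ab C(2) by (intro sum.cong refl) (metis br_scale(1) subsetD)
  qed (use t(1) ab C(1) subspace_scale in auto)
qed

end

section \<open>The trace form of a representation and its invariance\<close>

locale fin_rep = fin_lie g for g :: "('f::field_char_0, 'g::ab_group_add) lie" +
  fixes s :: "'f \<Rightarrow> 'v::ab_group_add \<Rightarrow> 'v" and V and \<rho>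
  assumes rep: "lie_rep g s V \<rho>"
begin

sublocale V: vector_space s
  using rep by (simp add: lie_rep_def)

lemma finV: "fin_dim s V" and subV: "V.subspace V"
  using rep by (auto simp: lie_rep_def)

definition \<beta> :: "'g \<Rightarrow> 'g \<Rightarrow> 'f" where
  "\<beta> x y = trace_on s V (\<rho> x \<circ> \<rho> y)"

lemma \<rho>_gl: "x \<in> L \<Longrightarrow> \<rho> x \<in> lie_carrier (gl s V)"
  using rep by (simp add: lie_rep_def lie_hom_def linear_map_on_def)

lemma \<rho>_lin: "x \<in> L \<Longrightarrow> linear_map_on s V s V (\<rho> x)"
  using \<rho>_gl V.gl_carrier_iff by blast

lemma \<rho>_in: "x \<in> L \<Longrightarrow> \<rho> x v \<in> V"
  by (rule V.gl_in_V[OF subV \<rho>_gl])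

lemma \<rho>_out: "x \<in> L \<Longrightarrow> v \<notin> V \<Longrightarrow> \<rho> x v = 0"
  using \<rho>_gl V.gl_carrier_iff by blast

lemma \<rho>_v:
  "x \<in> L \<Longrightarrow> u \<in> V \<Longrightarrow> v \<in> V \<Longrightarrow> \<rho> x (u + v) = \<rho> x u + \<rho> x v"
  "x \<in> L \<Longrightarrow> u \<in> V \<Longrightarrow> \<rho> x (s c u) = s c (\<rho> x u)"
  "x \<in> L \<Longrightarrow> u \<in> V \<Longrightarrow> v \<in> V \<Longrightarrow> \<rho> x (u - v) = \<rho> x u - \<rho> x v"
  "x \<in> L \<Longrightarrow> \<rho> x 0 = 0"
  using \<rho>_lin V.linear_map_on_diff[OF \<rho>_lin subV] V.gl_zero[OF subV \<rho>_gl] by (auto simp: linear_map_on_def)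

lemma \<rho>_add: "x \<in> L \<Longrightarrow> y \<in> L \<Longrightarrow> \<rho> (x + y) = \<rho> x + \<rho> y"
  and \<rho>_scale: "x \<in> L \<Longrightarrow> \<rho> (sc c x) = (\<lambda>v. s c (\<rho> x v))"
  and \<rho>_br: "x \<in> L \<Longrightarrow> y \<in> L \<Longrightarrow> \<rho> (br x y) = (\<rho> x \<circ> \<rho> y) - (\<rho> y \<circ> \<rho> x)"
  using rep by (auto simp: lie_rep_def lie_hom_def linear_map_on_def gl_def pointwise_scale_def)

lemma \<rho>_zero: "\<rho> 0 = 0"
  using \<rho>_add[of 0 0] subspace_0[OF subL] by simp

lemma \<rho>_diff: "x \<in> L \<Longrightarrow> y \<in> L \<Longrightarrow> \<rho> (x - y) = \<rho> x - \<rho> y"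
  using \<rho>_add[of "x - y" y] subspace_diff[OF subL] by (simp add: eq_diff_eq)

lemma \<rho>_sum: "(\<And>i. i \<in> I \<Longrightarrow> x i \<in> L) \<Longrightarrow> \<rho> (\<Sum>i\<in>I. x i) = (\<Sum>i\<in>I. \<rho> (x i))"
proof (induction I rule: infinite_finite_induct)
  case (insert i I)
  then show ?case using \<rho>_add[of "x i" "\<Sum>i\<in>I. x i"] subspace_sum[OF subL, of I x] by simp
qed (simp_all add: \<rho>_zero)

lemma \<rho>_comp_lin: "x \<in> L \<Longrightarrow> y \<in> L \<Longrightarrow> linear_map_on s V s V (\<rho> x \<circ> \<rho> y)"
  by (rule linear_map_on_comp[OF \<rho>_lin \<rho>_lin])

lemma \<beta>_sym: "x \<in> L \<Longrightarrow> y \<in> L \<Longrightarrow> \<beta> x y = \<beta> y x"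
  unfolding \<beta>_def by (rule V.trace_on_comp_commute[OF finV finV \<rho>_lin \<rho>_lin])

lemma \<beta>_add: "x \<in> L \<Longrightarrow> y \<in> L \<Longrightarrow> z \<in> L \<Longrightarrow> \<beta> (x + y) z = \<beta> x z + \<beta> y z"
  using V.trace_on_add[OF finV \<rho>_comp_lin[of x z] \<rho>_comp_lin[of y z]]
  by (simp add: \<beta>_def \<rho>_add o_def)

lemma \<beta>_scale: "x \<in> L \<Longrightarrow> y \<in> L \<Longrightarrow> \<beta> (sc c x) y = c * \<beta> x y"
  using V.trace_on_scale[OF finV \<rho>_comp_lin[of x y]] by (simp add: \<beta>_def \<rho>_scale o_def)

lemma \<beta>_add': "x \<in> L \<Longrightarrow> y \<in> L \<Longrightarrow> z \<in> L \<Longrightarrow> \<beta> z (x + y) = \<beta> z x + \<beta> z y"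
  using \<beta>_add[of x y z] \<beta>_sym subspace_add[OF subL] by metis

lemma \<beta>_scale': "x \<in> L \<Longrightarrow> y \<in> L \<Longrightarrow> \<beta> y (sc c x) = c * \<beta> y x"
  using \<beta>_scale[of x y c] \<beta>_sym subspace_scale[OF subL] by metis

lemma \<beta>_zero: "x \<in> L \<Longrightarrow> \<beta> x 0 = 0" "x \<in> L \<Longrightarrow> \<beta> 0 x = 0"
  using \<beta>_scale[of x x 0] \<beta>_scale'[of x x 0] by simp_all

text \<open>Expanded, the left side is tr(xyz) - tr(yxz) and the right side tr(xyz) - tr(xzy);
  moving \<open>y\<close> to the end by cyclicity identifies the second terms.\<close>

lemma \<beta>_inv:
  assumes "x \<in> L" "y \<in> L" "z \<in> L"
  shows "\<beta> (br x y) z = \<beta> x (br y z)"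
proof -
  have lin: "linear_map_on s V s V (\<rho> u \<circ> (\<rho> v \<circ> \<rho> w))" if "u \<in> L" "v \<in> L" "w \<in> L" for u v w
    by (intro linear_map_on_comp[of s V s V _ s V] \<rho>_lin that)
  have "\<beta> (br x y) z = trace_on s V (\<lambda>v. (\<rho> x \<circ> (\<rho> y \<circ> \<rho> z)) v - (\<rho> y \<circ> (\<rho> x \<circ> \<rho> z)) v)"
    using assms by (simp add: \<beta>_def \<rho>_br fun_diff_def o_def)
  also have "\<dots> = trace_on s V (\<rho> x \<circ> (\<rho> y \<circ> \<rho> z)) - trace_on s V (\<rho> y \<circ> (\<rho> x \<circ> \<rho> z))"
    by (rule V.trace_on_diff[OF finV]) (intro lin assms)+
  also have "trace_on s V (\<rho> y \<circ> (\<rho> x \<circ> \<rho> z)) = trace_on s V ((\<rho> x \<circ> \<rho> z) \<circ> \<rho> y)"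
    by (rule V.trace_on_comp_commute[OF finV finV]) (use \<rho>_lin \<rho>_comp_lin assms in auto)
  also have "(\<rho> x \<circ> \<rho> z) \<circ> \<rho> y = \<rho> x \<circ> (\<rho> z \<circ> \<rho> y)" by (simp add: comp_assoc)
  also have "trace_on s V (\<rho> x \<circ> (\<rho> y \<circ> \<rho> z)) - trace_on s V (\<rho> x \<circ> (\<rho> z \<circ> \<rho> y))
      = trace_on s V (\<lambda>v. (\<rho> x \<circ> (\<rho> y \<circ> \<rho> z)) v - (\<rho> x \<circ> (\<rho> z \<circ> \<rho> y)) v)"
    by (rule V.trace_on_diff[OF finV, symmetric]) (intro lin assms)+
  also have "\<dots> = \<beta> x (br y z)"
    using assms by (simp add: \<beta>_def \<rho>_br o_def \<rho>_v(3) \<rho>_in)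
  finally show ?thesis .
qed

lemma \<rho>_ad_pow:
  assumes "x \<in> L" "y \<in> L"
  shows "((\<lambda>y. (\<rho> x \<circ> y) - (y \<circ> \<rho> x)) ^^ k) (\<rho> y) = \<rho> ((br x ^^ k) y) \<and> (br x ^^ k) y \<in> L"
  by (induction k) (use assms in \<open>simp_all add: \<rho>_br br_in\<close>)

text \<open>\<open>\<rho>\<close> turns brackets of \<open>g\<close> into commutators of operators,
  so the hypotheses of the criterion can be checked by computing in \<open>g\<close>.\<close>

lemma nilpotent_of_trace:
  assumes ab: "\<And>i. i \<in> I \<Longrightarrow> a i \<in> L" "\<And>i. i \<in> I \<Longrightarrow> b i \<in> L" and x: "x = (\<Sum>i\<in>I. br (a i) (b i))"
    and tr: "\<And>i k. i \<in> I \<Longrightarrow> \<beta> (a i) ((br x ^^ Suc k) (b i)) = 0"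
  shows "\<exists>m. \<forall>v\<in>V. (\<rho> x ^^ m) v = 0"
proof (rule trace_condition_imp_nilpotent[OF V.vector_space_axioms finV, of "\<rho> x" I "\<lambda>i. \<rho> (a i)" "\<lambda>i. \<rho> (b i)"])
  have xL: "x \<in> L" unfolding x using ab br_in by (intro subspace_sum[OF subL]) auto
  then show "\<rho> x \<in> lie_carrier (gl s V)" by (rule \<rho>_gl)
  show "\<rho> x v = (\<Sum>i\<in>I. \<rho> (a i) (\<rho> (b i) v) - \<rho> (b i) (\<rho> (a i) v))" for v
    unfolding x using ab by (subst \<rho>_sum) (simp_all add: br_in sum_fun_apply \<rho>_br)
  show "trace_on s V (\<rho> (a i) \<circ> ((\<lambda>y. (\<rho> x \<circ> y) - (y \<circ> \<rho> x)) ^^ Suc k) (\<rho> (b i))) = 0" if "i \<in> I" for i k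
    using tr[OF that, of k] \<rho>_ad_pow[OF xL ab(2)[OF that], of "Suc k"] unfolding \<beta>_def by metis
qed (use ab \<rho>_gl in auto)

end

subsection \<open>Ideals acting nilpotently\<close>

context fin_rep
begin

text \<open>For \<open>M\<close> inside \<open>L\<close>, level \<open>j\<close> consists of the
  vectors killed by every product of \<open>j\<close> operators from \<open>M\<close>. That some
  level is all of \<open>V\<close> expresses simultaneous strict triangularity without choosing a
  basis.\<close>

fun kernel_flag :: "'g set \<Rightarrow> nat \<Rightarrow> 'v set" where
  "kernel_flag M 0 = {0}"
| "kernel_flag M (Suc j) = {v \<in> V. \<forall>m\<in>M. \<rho> m v \<in> kernel_flag M j}"

lemma kernel_flag_sub: "kernel_flag M j \<subseteq> V"
  using V.subspace_0[OF subV] by (cases j) auto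

lemma kernel_flag_subspace: "M \<subseteq> L \<Longrightarrow> V.subspace (kernel_flag M j)"
proof (induction j)
  case (Suc j)
  then have "\<And>m. m \<in> M \<Longrightarrow> m \<in> L" by blast
  then show ?case
    using Suc subV V.subspace_0 V.subspace_add V.subspace_scale
    by (intro V.subspaceI) (auto simp: \<rho>_v)
qed simp

lemma kernel_flag_mono: "M \<subseteq> L \<Longrightarrow> i \<le> j \<Longrightarrow> kernel_flag M i \<subseteq> kernel_flag M j"
proof (induction i arbitrary: j)
  case 0
  then show ?case using V.subspace_0[OF kernel_flag_subspace] by auto
next
  case (Suc i)
  then obtain j' where "j = Suc j'" "i \<le> j'" by (metis Suc_le_D Suc_le_mono)
  then show ?case using Suc.IH[of j'] Suc.prems by auto
qed

lemma kernel_flag_word: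
  assumes "M \<subseteq> L" "set xs \<subseteq> M" "v \<in> kernel_flag M (length xs + j)"
  shows "foldr \<rho> xs v \<in> kernel_flag M j"
  using assms(2,3)
proof (induction xs arbitrary: j)
  case (Cons x xs)
  have "foldr \<rho> xs v \<in> kernel_flag M (Suc j)"
    by (rule Cons.IH) (use Cons.prems in \<open>simp_all del: kernel_flag.simps\<close>)
  then show ?case using Cons.prems by auto
qed simp

lemma foldr_\<rho>_in: "set xs \<subseteq> L \<Longrightarrow> v \<in> V \<Longrightarrow> foldr \<rho> xs v \<in> V"
  by (induction xs) (auto simp: \<rho>_in)

lemma foldr_\<rho>_diff:
  "set xs \<subseteq> L \<Longrightarrow> u \<in> V \<Longrightarrow> v \<in> V \<Longrightarrow> foldr \<rho> xs (u - v) = foldr \<rho> xs u - foldr \<rho> xs v"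
  by (induction xs) (auto simp: \<rho>_v foldr_\<rho>_in)

lemma foldr_\<rho>_zero: "set xs \<subseteq> L \<Longrightarrow> foldr \<rho> xs 0 = 0"
  by (induction xs) (auto simp: \<rho>_v)

text \<open>Expanding the outermost bracket puts its letter to the left or to the right of
  \<open>z\<close>. With at least \<open>2 * n\<close> letters in all, one side collects at least
  \<open>n\<close> of them, and a word of that length acts as zero. The words \<open>xs\<close> and
  \<open>ys\<close> hold the letters already placed.\<close>

lemma iterated_bracket_vanishes:
  assumes M: "M \<subseteq> L" "kernel_flag M n = V"
  shows "set ms \<subseteq> M \<Longrightarrow> z \<in> L \<Longrightarrow> set xs \<subseteq> M \<Longrightarrow> set ys \<subseteq> M \<Longrightarrow>
    length xs + length ys + length ms \<ge> 2 * n \<Longrightarrow> v \<in> V \<Longrightarrow>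
    foldr \<rho> xs (\<rho> (foldr br ms z) (foldr \<rho> ys v)) = 0"
proof (induction ms arbitrary: xs ys)
  case Nil
  have kill: "foldr \<rho> ws u = 0" if "set ws \<subseteq> M" "n \<le> length ws" "u \<in> V" for ws u
    using kernel_flag_word[OF M(1) that(1), of u 0] kernel_flag_mono[OF M(1) that(2)] M(2) that(3) by auto
  have "n \<le> length xs \<or> n \<le> length ys" using Nil by auto
  then show ?case
  proof
    assume "n \<le> length xs"
    then show ?thesis using kill[of xs] Nil \<rho>_in by simp
  next
    assume "n \<le> length ys"
    then have "foldr \<rho> ys v = 0" using kill Nil by blast
    then show ?thesis using foldr_\<rho>_zero[of xs] Nil M(1) by (auto simp: \<rho>_v)
  qed
next
  case (Cons m ms)
  define z' where "z' = foldr br ms z"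
  have mL: "m \<in> L" and msL: "set ms \<subseteq> L" and xsL: "set xs \<subseteq> L" and ysL: "set ys \<subseteq> L"
    using Cons.prems M(1) by auto
  have z'L: "z' \<in> L" unfolding z'_def using msL Cons.prems(2) by (induction ms) (auto simp: br_in)
  have "foldr \<rho> xs (\<rho> (br m z') (foldr \<rho> ys v))
      = foldr \<rho> (xs @ [m]) (\<rho> z' (foldr \<rho> ys v)) - foldr \<rho> xs (\<rho> z' (foldr \<rho> (m # ys) v))"
    using mL z'L xsL ysL Cons.prems(6) by (simp add: \<rho>_br foldr_\<rho>_diff \<rho>_in)
  also have "foldr \<rho> (xs @ [m]) (\<rho> z' (foldr \<rho> ys v)) = 0"
    unfolding z'_def by (rule Cons.IH) (use Cons.prems in auto)
  also have "foldr \<rho> xs (\<rho> z' (foldr \<rho> (m # ys) v)) = 0"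
    unfolding z'_def by (rule Cons.IH) (use Cons.prems in auto)
  finally show ?case by (simp add: z'_def)
qed

text \<open>Engel's theorem. A maximal subalgebra \<open>M\<close> of \<open>J\<close> whose flag exhausts \<open>V\<close> equals \<open>J\<close>: otherwise
  some \<open>y\<close> outside \<open>M\<close> normalises \<open>M\<close>, preserves its flag, and can be adjoined to \<open>M\<close>.\<close>

lemma engel_flag:
  assumes J: "subspace J" "J \<subseteq> L" "\<And>x y. x \<in> J \<Longrightarrow> y \<in> J \<Longrightarrow> br x y \<in> J"
    and nil: "\<And>x. x \<in> J \<Longrightarrow> \<exists>m. \<forall>v\<in>V. (\<rho> x ^^ m) v = 0"
  shows "\<exists>n. kernel_flag J n = V"
proof -
  \<comment> \<open>\<open>M\<close> is required to contain the kernel of \<open>\<rho>\<close> on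
    \<open>J\<close>, so that a bracket acting as zero is known to lie in \<open>M\<close> although
    \<open>\<rho>\<close> need not be faithful.\<close>
  define P where "P M \<longleftrightarrow> subspace M \<and> M \<subseteq> J \<and> {x \<in> J. \<rho> x = 0} \<subseteq> M \<and>
    (\<forall>x\<in>M. \<forall>y\<in>M. br x y \<in> M) \<and> (\<exists>n. kernel_flag M n = V)" for M
  have P0: "P {x \<in> J. \<rho> x = 0}"
    unfolding P_def
  proof (intro conjI ballI)
    show "subspace {x \<in> J. \<rho> x = 0}"
      using J subspace_0 subspace_add subspace_scale
      by (intro subspaceI) (auto simp: \<rho>_zero \<rho>_add \<rho>_scale subset_iff fun_eq_iff)
    show "br x y \<in> {x \<in> J. \<rho> x = 0}" if "x \<in> {x \<in> J. \<rho> x = 0}" "y \<in> {x \<in> J. \<rho> x = 0}" for x y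
      using that J by (auto simp: \<rho>_br subset_iff fun_eq_iff)
    have "kernel_flag {x \<in> J. \<rho> x = 0} (Suc 0) = V" by auto
    then show "\<exists>n. kernel_flag {x \<in> J. \<rho> x = 0} n = V" by blast
  qed auto
  have PL: "subspace W \<and> W \<subseteq> L" if "P W" for W using that J(2) unfolding P_def by blast
  obtain M where PM: "P M" and max: "\<And>U. P U \<Longrightarrow> M \<subseteq> U \<Longrightarrow> U = M"
    using maximal_subspace[where P = P, OF fin P0 PL] by blast
  have M: "subspace M" "M \<subseteq> J" "{x \<in> J. \<rho> x = 0} \<subseteq> M" "\<And>x y. x \<in> M \<Longrightarrow> y \<in> M \<Longrightarrow> br x y \<in> M"
    using PM unfolding P_def by blast+
  obtain n where n: "kernel_flag M n = V" using PM unfolding P_def by blast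
  have MsubL: "M \<subseteq> L" using M(2) J(2) by blast
  have "M = J"
  proof (rule ccontr)
    assume "M \<noteq> J"
    then obtain y0 where y0: "y0 \<in> J" "y0 \<notin> M" using M(2) by blast
    \<comment> \<open>If \<open>M\<close> could always move an element outside \<open>M\<close> to
      another one outside \<open>M\<close>, then \<open>2 * n\<close> moves would produce an element
      outside \<open>M\<close> that acts as zero, against the choice of \<open>P\<close>.\<close>
    have "\<exists>y\<in>J. y \<notin> M \<and> (\<forall>m\<in>M. br m y \<in> M)"
    proof (rule ccontr)
      assume "\<not> ?thesis"
      then have step: "\<exists>m\<in>M. br m y \<notin> M" if "y \<in> J" "y \<notin> M" for y using that by blast
      have "\<exists>ms. length ms = k \<and> set ms \<subseteq> M \<and> foldr br ms y0 \<in> J \<and> foldr br ms y0 \<notin> M" for k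
      proof (induction k)
        case (Suc k)
        then obtain ms where ms: "length ms = k" "set ms \<subseteq> M" "foldr br ms y0 \<in> J" "foldr br ms y0 \<notin> M"
          by blast
        then obtain m where "m \<in> M" "br m (foldr br ms y0) \<notin> M" using step by blast
        then show ?case using ms M(2) J(3) by (intro exI[of _ "m # ms"]) auto
      qed (use y0 in auto)
      then obtain ms where ms: "length ms = 2 * n" "set ms \<subseteq> M" "foldr br ms y0 \<in> J" "foldr br ms y0 \<notin> M"
        by blast
      have "\<rho> (foldr br ms y0) v = 0" for v
      proof (cases "v \<in> V")
        case True
        then show ?thesis
          using iterated_bracket_vanishes[OF MsubL n ms(2), of y0 "[]" "[]" v] y0 J(2) ms(1) by auto
      qed (use \<rho>_out ms(3) J(2) in blast)
      then have "\<rho> (foldr br ms y0) = 0" by (simp add: fun_eq_iff)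
      then show False using M(3) ms by blast
    qed
    then obtain y where y: "y \<in> J" "y \<notin> M" "\<And>m. m \<in> M \<Longrightarrow> br m y \<in> M" by blast
    have yL: "y \<in> L" using y(1) J(2) by blast
    define M' where "M' = {m + sc c y | m c. m \<in> M}"
    have M'J: "M' \<subseteq> J"
      unfolding M'_def using M(2) y(1) J(1) by (auto intro!: subspace_add subspace_scale)
    have M'L: "M' \<subseteq> L" using M'J J(2) by blast
    have MM': "M \<subseteq> M'"
    proof
      fix m assume "m \<in> M"
      moreover have "m = m + sc 0 y" by simp
      ultimately show "m \<in> M'" unfolding M'_def by blast
    qed
    have "y = 0 + sc 1 y" by simp
    then have yM': "y \<in> M'" unfolding M'_def using subspace_0[OF M(1)] by blast
    have subM': "subspace M'"
    proof (rule subspaceI)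
      show "0 \<in> M'" using MM' subspace_0[OF M(1)] by blast
      show "u + w \<in> M'" if uw': "u \<in> M'" "w \<in> M'" for u w
      proof -
        obtain m c m' c' where "u = m + sc c y" "w = m' + sc c' y" "m \<in> M" "m' \<in> M"
          using uw' unfolding M'_def by blast
        then have "u + w = (m + m') + sc (c + c') y" "m + m' \<in> M"
          using subspace_add[OF M(1)] by (auto simp: scale_left_distrib)
        then show ?thesis unfolding M'_def by blast
      qed
      show "sc a u \<in> M'" if u: "u \<in> M'" for a u
      proof -
        obtain m c where "u = m + sc c y" "m \<in> M" using u unfolding M'_def by blast
        then have "sc a u = sc a m + sc (a * c) y" "sc a m \<in> M"
          using subspace_scale[OF M(1)] by (auto simp: scale_right_distrib)
        then show ?thesis unfolding M'_def by blast
      qed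
    qed
    have brM': "br u w \<in> M'" if uw': "u \<in> M'" "w \<in> M'" for u w
    proof -
      obtain m c m' c' where uw: "u = m + sc c y" "w = m' + sc c' y" "m \<in> M" "m' \<in> M"
        using uw' unfolding M'_def by blast
      then have mL: "m \<in> L" "m' \<in> L" using MsubL by blast+
      have "br y m' = - br m' y" using br_anti mL yL by blast
      then have ym: "br y m' \<in> M" using y(3)[OF uw(4)] subspace_neg[OF M(1)] by simp
      have "br u w = br m m' + sc c' (br m y) + sc c (br y m')"
        using mL yL unfolding uw(1,2)
        by (simp add: br_add br_scale br_in subspace_add[OF subL] subspace_scale[OF subL] br_self)
      also have "\<dots> \<in> M"
        using ym y(3)[OF uw(3)] M(4)[OF uw(3,4)] by (intro subspace_add[OF M(1)] subspace_scale[OF M(1)])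
      finally show ?thesis using MM' by blast
    qed
    have flag_y: "\<rho> y v \<in> kernel_flag M j" if "v \<in> kernel_flag M j" for v j
      using that
    proof (induction j arbitrary: v)
      case (Suc j)
      have "\<rho> m (\<rho> y v) \<in> kernel_flag M j" if m: "m \<in> M" for m
      proof -
        have "m \<in> L" using m MsubL by blast
        then have "\<rho> m (\<rho> y v) = \<rho> y (\<rho> m v) + \<rho> (br m y) v" using yL by (simp add: \<rho>_br)
        moreover have "\<rho> y (\<rho> m v) \<in> kernel_flag M j" using Suc m by simp
        moreover have "\<rho> (br m y) v \<in> kernel_flag M j" using Suc.prems y(3)[OF m] by simp
        ultimately show ?thesis using V.subspace_add[OF kernel_flag_subspace[OF MsubL]] by simp
      qed
      then show ?case using yL by (simp add: \<rho>_in)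
    qed (use yL in \<open>simp add: \<rho>_v\<close>)
    obtain N where N: "\<And>v. v \<in> V \<Longrightarrow> (\<rho> y ^^ N) v = 0" using nil[OF y(1)] by blast
    \<comment> \<open>Every level of the old flag is refined into \<open>N\<close> levels for
      \<open>M'\<close>, where the N-th power of \<open>\<rho> y\<close> vanishes on
      \<open>V\<close>. In the claim, \<open>i\<close> bounds the number of applications of
      \<open>y\<close> that bring a vector down one old level.\<close>
    have flag_M': "kernel_flag M j \<subseteq> kernel_flag M' (j * N)" for j
    proof (induction j)
      case (Suc j)
      have claim: "v \<in> kernel_flag M' (j * N + i)"
        if "v \<in> kernel_flag M (Suc j)" "(\<rho> y ^^ i) v \<in> kernel_flag M j" for v i
        using that
      proof (induction i arbitrary: v)
        case 0
        then show ?case using Suc.IH by auto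
      next
        case (Suc i)
        have "\<rho> y v \<in> kernel_flag M' (j * N + i)"
          using Suc.IH[of "\<rho> y v"] Suc.prems flag_y[of v "Suc j"] by (simp add: funpow_swap1)
        moreover have "\<rho> m v \<in> kernel_flag M' (j * N + i)" if "m \<in> M" for m
          using Suc.prems(1) that \<open>kernel_flag M j \<subseteq> kernel_flag M' (j * N)\<close>
            kernel_flag_mono[OF M'L, of "j * N" "j * N + i"] by auto
        ultimately have "\<rho> u v \<in> kernel_flag M' (j * N + i)" if u': "u \<in> M'" for u
        proof -
          obtain m c where u: "u = m + sc c y" "m \<in> M" using u' unfolding M'_def by blast
          have "m \<in> L" using u(2) MsubL by blast
          then have "\<rho> u v = \<rho> m v + s c (\<rho> y v)"
            unfolding u(1) using yL by (simp add: \<rho>_add \<rho>_scale subspace_scale[OF subL])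
          then show ?thesis
            using \<open>\<And>m. m \<in> M \<Longrightarrow> \<rho> m v \<in> kernel_flag M' (j * N + i)\<close>[OF u(2)]
              \<open>\<rho> y v \<in> kernel_flag M' (j * N + i)\<close> kernel_flag_subspace[OF M'L]
            by (simp add: V.subspace_add V.subspace_scale)
        qed
        then show ?case using Suc.prems(1) by simp
      qed
      have "v \<in> kernel_flag M' (j * N + N)" if v: "v \<in> kernel_flag M (Suc j)" for v
      proof (rule claim[OF v])
        have "v \<in> V" using v by simp
        then show "(\<rho> y ^^ N) v \<in> kernel_flag M j"
          using N V.subspace_0[OF kernel_flag_subspace[OF MsubL]] by simp
      qed
      then show ?case by (auto simp: add.commute)
    qed simp
    have "kernel_flag M' (n * N) = V" using flag_M'[of n] n kernel_flag_sub by blast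
    then have "P M'" unfolding P_def using subM' M'J brM' M(3) MM' by blast
    then have "M' = M" using max MM' by blast
    then show False using yM' y(2) by blast
  qed
  then show ?thesis using n by blast
qed

text \<open>Take a nonzero vector of \<open>W\<close> on the lowest possible level of the flag. An
  element of \<open>J\<close> keeps it in \<open>W\<close> and lowers its level, hence sends it to
  0.\<close>

lemma engel_common_kernel:
  assumes J: "subspace J" "J \<subseteq> L" "\<And>x y. x \<in> J \<Longrightarrow> y \<in> J \<Longrightarrow> br x y \<in> J"
    and nil: "\<And>x. x \<in> J \<Longrightarrow> \<exists>m. \<forall>v\<in>V. (\<rho> x ^^ m) v = 0"
    and W: "V.subspace W" "W \<subseteq> V" "W \<noteq> {0}" "\<And>x w. x \<in> J \<Longrightarrow> w \<in> W \<Longrightarrow> \<rho> x w \<in> W"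
  obtains w where "w \<in> W" "w \<noteq> 0" "\<And>x. x \<in> J \<Longrightarrow> \<rho> x w = 0"
proof -
  obtain n where n: "kernel_flag J n = V" using engel_flag[OF J nil] by blast
  obtain w0 where w0: "w0 \<in> W" "w0 \<noteq> 0" using W(1,3) V.subspace_0 by blast
  then have ex: "\<exists>w. w \<in> W \<and> w \<noteq> 0 \<and> w \<in> kernel_flag J n" using n W(2) by blast
  define k where "k = (LEAST j. \<exists>w. w \<in> W \<and> w \<noteq> 0 \<and> w \<in> kernel_flag J j)"
  obtain w where w: "w \<in> W" "w \<noteq> 0" "w \<in> kernel_flag J k"
    using LeastI[of "\<lambda>j. \<exists>w. w \<in> W \<and> w \<noteq> 0 \<and> w \<in> kernel_flag J j", OF ex] unfolding k_def by blast
  then obtain j where j: "k = Suc j" by (cases k) auto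
  have "\<rho> x w = 0" if "x \<in> J" for x
  proof (rule ccontr)
    assume "\<rho> x w \<noteq> 0"
    moreover have "\<rho> x w \<in> kernel_flag J j" using w(3) that unfolding j by simp
    ultimately have "k \<le> j" unfolding k_def using W(4)[OF that w(1)] by (intro Least_le) blast
    then show False using j by simp
  qed
  then show ?thesis using that w by blast
qed

text \<open>In an irreducible \<open>W\<close> the vectors killed by \<open>J\<close> are a
  subrepresentation because \<open>J\<close> is an ideal, and by Engel's theorem they are not only
  0; so they are all of \<open>W\<close>. Summation over the irreducible pieces finishes.\<close>

lemma nilpotent_ideal_acts_trivially:
  assumes ss: "semisimple_rep g s V \<rho>" and J: "lie_ideal g J"
    and nil: "\<And>x. x \<in> J \<Longrightarrow> \<exists>m. \<forall>v\<in>V. (\<rho> x ^^ m) v = 0" and x: "x \<in> J"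
  shows "\<rho> x = 0"
proof -
  note J = idealD[OF J]
  obtain \<W> where \<W>: "direct_sum_of V \<W>" "\<And>W. W \<in> \<W> \<Longrightarrow> irreducible_subrep g s V \<rho> W"
    using ss unfolding semisimple_rep_def by blast
  have irr: "\<rho> x w = 0" if W: "W \<in> \<W>" and w: "w \<in> W" and x: "x \<in> J" for W w x
  proof -
    have W': "W \<subseteq> V" "V.subspace W" "W \<noteq> {0}" "\<And>x w. x \<in> L \<Longrightarrow> w \<in> W \<Longrightarrow> \<rho> x w \<in> W"
      "\<And>U. subrep g s V \<rho> U \<Longrightarrow> U \<subseteq> W \<Longrightarrow> U = {0} \<or> U = W"
      using \<W>(2)[OF W] unfolding irreducible_subrep_def subrep_def by blast+
    define U where "U = {w \<in> W. \<forall>x\<in>J. \<rho> x w = 0}"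
    have "subrep g s V \<rho> U"
      unfolding subrep_def
    proof (intro conjI ballI)
      show "V.subspace U"
        using W'(1,2) J(1) V.subspace_0 V.subspace_add V.subspace_scale unfolding U_def
        by (intro V.subspaceI) (auto simp: \<rho>_v subset_iff)
      fix y w assume y: "y \<in> L" and w: "w \<in> U"
      have "\<rho> x (\<rho> y w) = 0" if x: "x \<in> J" for x
      proof -
        have "\<rho> x (\<rho> y w) = \<rho> (br x y) w + \<rho> y (\<rho> x w)" using x y J(1) by (simp add: \<rho>_br subset_iff)
        also have "\<dots> = 0" using w x J(4)[OF y x] y by (simp add: U_def \<rho>_v)
        finally show ?thesis .
      qed
      then show "\<rho> y w \<in> U" using w y W'(4) by (simp add: U_def)
    qed (use W'(1) in \<open>auto simp: U_def\<close>)
    moreover have "U \<subseteq> W" unfolding U_def by blast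
    moreover obtain u where "u \<in> W" "u \<noteq> 0" "\<And>x. x \<in> J \<Longrightarrow> \<rho> x u = 0"
      using engel_common_kernel[OF J(2,1) _ nil W'(2,1,3)] J W'(4) by blast
    then have "U \<noteq> {0}" unfolding U_def by blast
    ultimately have "U = W" using W'(5) by blast
    then show ?thesis using w x unfolding U_def by blast
  qed
  have "\<rho> x v = 0" for v
  proof (cases "v \<in> V")
    case True
    then obtain f where f: "v = sum f \<W>" "\<forall>W\<in>\<W>. f W \<in> W"
      using \<W>(1) unfolding direct_sum_of_def by blast
    have WV: "W \<subseteq> V" if "W \<in> \<W>" for W
      using \<W>(2)[OF that] by (simp add: irreducible_subrep_def subrep_def)
    then have fV: "f W \<in> V" if "W \<in> \<W>" for W
      using f(2) that by (meson subsetD)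
    have xL: "x \<in> L" using x J(1) by (rule rev_subsetD)
    have "\<rho> x v = (\<Sum>W\<in>\<W>. \<rho> x (f W))"
      unfolding f(1) by (rule V.linear_map_on_sum[OF \<rho>_lin[OF xL] subV V.vector_space_axioms fV])
    then show ?thesis using irr f(2) x by simp
  qed (use \<rho>_out x J(1) in blast)
  then show ?thesis by (simp add: fun_eq_iff)
qed

end

subsection \<open>Faithful semisimple representations\<close>

locale faithful_ss_rep = fin_rep +
  assumes faithful: "faithful g \<rho>" and ss: "semisimple_rep g s V \<rho>"
begin

lemma nilpotent_ideal_zero:
  assumes "lie_ideal g J" "\<And>x. x \<in> J \<Longrightarrow> \<exists>m. \<forall>v\<in>V. (\<rho> x ^^ m) v = 0" "x \<in> J"
  shows "x = 0"
proof -
  have "\<rho> x = \<rho> 0" using nilpotent_ideal_acts_trivially[OF ss assms] \<rho>_zero by simp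
  then show ?thesis
    using faithful idealD(1)[OF assms(1)] assms(3) subspace_0[OF subL] unfolding faithful_def inj_on_def by blast
qed

text \<open>For \<open>x\<close> in [C, g] write \<open>x\<close> as a sum of brackets [a i, b i]
  with \<open>a i\<close> in \<open>C\<close>. As \<open>x\<close> lies in the ideal
  \<open>C\<close>, so does every bracket of \<open>x\<close> with \<open>b i\<close> and every
  further one, and \<open>\<beta>\<close> vanishes on \<open>C\<close>. Hence [C, g] acts
  nilpotently and is zero.\<close>

lemma isotropic_ideal_central:
  assumes C: "lie_ideal g C" and iso: "\<And>x y. x \<in> C \<Longrightarrow> y \<in> C \<Longrightarrow> \<beta> x y = 0"
  shows "C \<subseteq> Z"
proof -
  note CD = idealD[OF C]
  have "y = 0" if "y \<in> commutator C" for y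
  proof (rule nilpotent_ideal_zero[OF commutator_ideal[OF C] _ that])
    fix x assume x: "x \<in> commutator C"
    obtain I :: "'b set" and a b where ab: "finite I" "x = (\<Sum>i\<in>I. br (a i) (b i))"
        "\<And>i. i \<in> I \<Longrightarrow> a i \<in> C" "\<And>i. i \<in> I \<Longrightarrow> b i \<in> L"
      using commutator_sum[OF CD(2,1) x] by blast
    have xC: "x \<in> C" using x commutator_sub[OF C] by blast
    have "(br x ^^ Suc k) y \<in> C" if "y \<in> L" for y k
      by (induction k) (use xC that CD in \<open>auto simp: subset_iff\<close>)
    then show "\<exists>m. \<forall>v\<in>V. (\<rho> x ^^ m) v = 0"
      using ab(2-4) CD(1) iso by (intro nilpotent_of_trace[of I a b]) auto
  qed
  then show ?thesis using commutator_in[of _ C] CD(1) by (auto simp: lie_centre_def)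
qed

text \<open>For central \<open>x\<close> the trace condition is empty: the first bracket of
  \<open>x\<close> with \<open>b i\<close> is already 0.\<close>

lemma centre_Int_derived: "Z \<inter> S = {0}"
proof -
  have "x = 0" if "x \<in> Z \<inter> S" for x
  proof (rule nilpotent_ideal_zero[OF ideal_Int[OF centre_ideal derived_ideal] _ that])
    fix x assume x: "x \<in> Z \<inter> S"
    then have "x \<in> commutator L" by (simp add: derived_eq)
    then obtain I :: "'b set" and a b where ab: "finite I" "x = (\<Sum>i\<in>I. br (a i) (b i))"
        "\<And>i. i \<in> I \<Longrightarrow> a i \<in> L" "\<And>i. i \<in> I \<Longrightarrow> b i \<in> L"
      using commutator_sum[OF subL order_refl] by blast
    have xZ: "x \<in> Z" and xL: "x \<in> L" using x centreD(3) by auto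
    have "(br x ^^ Suc k) y = 0" if "y \<in> L" for y k
      by (induction k) (use xZ xL that in \<open>auto simp: centreD br_zero\<close>)
    then show "\<exists>m. \<forall>v\<in>V. (\<rho> x ^^ m) v = 0"
      using ab(2-4) by (intro nilpotent_of_trace[of I a b]) (auto simp: \<beta>_zero)
  qed
  moreover have "0 \<in> Z \<inter> S" using centre_ideal derived_ideal idealD(2) subspace_0 by blast
  ultimately show ?thesis by blast
qed

text \<open>The radical \<open>R\<close> of \<open>\<beta>\<close> is an isotropic ideal, hence
  central. If \<open>x\<close> is orthogonal to all brackets, invariance puts [x, a] into
  \<open>R\<close>, so it is both central and in the derived algebra, which forces it to be
  0.\<close>

lemma orthogonal_derived_central:
  assumes x: "x \<in> L" and orth: "\<And>y. y \<in> S \<Longrightarrow> \<beta> x y = 0"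
  shows "x \<in> Z"
proof -
  define R where "R = {x \<in> L. \<forall>y\<in>L. \<beta> x y = 0}"
  have "lie_ideal g R"
    unfolding lie_ideal_def
  proof (intro conjI ballI)
    show "subspace R"
      by (rule subspaceI) (auto simp: R_def subspace_0[OF subL] subspace_add[OF subL] subspace_scale[OF subL]
          \<beta>_zero \<beta>_add \<beta>_scale)
    fix a r assume a: "a \<in> L" and r: "r \<in> R"
    have rL: "r \<in> L" using r by (simp add: R_def)
    have "\<beta> (br a r) y = 0" if y: "y \<in> L" for y
    proof -
      have "\<beta> (br a r) y = \<beta> y (br a r)" using \<beta>_sym[of "br a r" y] a rL y br_in by simp
      also have "\<dots> = \<beta> (br y a) r" using \<beta>_inv[of y a r] a rL y by simp
      also have "\<dots> = \<beta> r (br y a)" using \<beta>_sym[of "br y a" r] a rL y br_in by simp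
      finally show ?thesis using r y a br_in by (simp add: R_def)
    qed
    then show "br a r \<in> R" using a rL br_in by (simp add: R_def)
  qed (auto simp: R_def)
  then have RZ: "R \<subseteq> Z" by (rule isotropic_ideal_central) (simp add: R_def)
  have "br x a = 0" if a: "a \<in> L" for a
  proof -
    have "\<beta> (br x a) b = 0" if b: "b \<in> L" for b
      using \<beta>_inv[OF x a b] orth[of "br a b"] commutator_in[OF a b] by (simp add: derived_eq)
    then have "br x a \<in> R" using x a br_in by (simp add: R_def)
    then have "br x a \<in> Z" using RZ by blast
    moreover have "br x a \<in> S" using commutator_in[OF x a] by (simp add: derived_eq)
    ultimately show ?thesis using centre_Int_derived by blast
  qed
  then show ?thesis using x by (simp add: lie_centre_def)
qed

lemma derived_nondegenerate:
  assumes "x \<in> S" "\<And>y. y \<in> S \<Longrightarrow> \<beta> x y = 0"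
  shows "x = 0"
  using orthogonal_derived_central[of x] assms idealD(1)[OF derived_ideal] centre_Int_derived by blast

lemma centre_plus_derived:
  assumes x: "x \<in> L"
  obtains z y where "z \<in> Z" "y \<in> S" "x = z + y"
proof -
  have SL: "S \<subseteq> L" and subS: "subspace S" using idealD[OF derived_ideal] by blast+
  have "\<exists>u\<in>S. \<forall>w\<in>S. \<beta> (x - u) w = 0"
    by (rule orthogonal_split[OF fin_dim_subspace[OF fin subS SL] SL \<beta>_add \<beta>_add' \<beta>_scale \<beta>_scale'
          derived_nondegenerate subL x])
  then obtain u where u: "u \<in> S" "\<And>w. w \<in> S \<Longrightarrow> \<beta> (x - u) w = 0" by blast
  have "x - u \<in> Z"
    using orthogonal_derived_central[of "x - u"] u x SL subspace_diff[OF subL] by blast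
  then show ?thesis using that[of "x - u" u] u(1) by simp
qed

end

section \<open>Direct sums of representations\<close>

lemma direct_sum_of_zero: "direct_sum_of {0} {}"
  by (simp add: direct_sum_of_def)

lemma direct_sum_of_single: "direct_sum_of U {U}"
proof -
  have "\<exists>f. u = f U \<and> f U \<in> U" if "u \<in> U" for u
    using that by (intro exI[of _ "\<lambda>_. u"]) simp
  then show ?thesis by (auto simp: direct_sum_of_def)
qed

lemma direct_sum_of_member_subset:
  assumes "direct_sum_of U \<A>" "\<And>A. A \<in> \<A> \<Longrightarrow> 0 \<in> A" "A \<in> \<A>"
  shows "A \<subseteq> U"
proof
  fix a assume a: "a \<in> A"
  have fin: "finite \<A>" and U: "U = {sum f \<A> | f. \<forall>W\<in>\<A>. f W \<in> W}"
    using assms(1) unfolding direct_sum_of_def by blast+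
  define f where "f W = (if W = A then a else 0)" for W
  have "sum f \<A> = a" using fin assms(3) unfolding f_def by simp
  moreover have "\<forall>W\<in>\<A>. f W \<in> W" using assms(2) a by (simp add: f_def)
  ultimately show "a \<in> U" unfolding U by blast
qed

text \<open>Families of summands are sets, so sums over the union split only if the families are
  disjoint. A common member would lie in both \<open>U\<close> and \<open>W\<close>; excluding zero
  summands rules this out.\<close>

lemma (in vector_space) direct_sum_of_union:
  assumes ds: "direct_sum2 V U W" and UW: "subspace U" "subspace W"
    and A: "direct_sum_of U \<A>" "\<And>A. A \<in> \<A> \<Longrightarrow> 0 \<in> A \<and> A \<noteq> {0}"
    and B: "direct_sum_of W \<B>" "\<And>B. B \<in> \<B> \<Longrightarrow> 0 \<in> B \<and> B \<noteq> {0}"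
  shows "direct_sum_of V (\<A> \<union> \<B>)"
proof -
  have V: "V = {u + w | u w. u \<in> U \<and> w \<in> W}" and int: "U \<inter> W = {0}"
    using ds by (auto simp: direct_sum2_def)
  have finA: "finite \<A>" and finB: "finite \<B>"
    and U: "U = {sum f \<A> | f. \<forall>W\<in>\<A>. f W \<in> W}" and W: "W = {sum f \<B> | f. \<forall>W\<in>\<B>. f W \<in> W}"
    and indA: "\<And>f. (\<forall>W\<in>\<A>. f W \<in> W) \<and> sum f \<A> = 0 \<longrightarrow> (\<forall>W\<in>\<A>. f W = 0)"
    and indB: "\<And>f. (\<forall>W\<in>\<B>. f W \<in> W) \<and> sum f \<B> = 0 \<longrightarrow> (\<forall>W\<in>\<B>. f W = 0)"
    using A(1) B(1) unfolding direct_sum_of_def by blast+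
  have AU: "T \<subseteq> U" if "T \<in> \<A>" for T using direct_sum_of_member_subset[OF A(1)] A(2) that by blast
  have BW: "T \<subseteq> W" if "T \<in> \<B>" for T using direct_sum_of_member_subset[OF B(1)] B(2) that by blast
  have disj: "\<A> \<inter> \<B> = {}"
  proof (rule ccontr)
    assume "\<A> \<inter> \<B> \<noteq> {}"
    then obtain T where "T \<in> \<A>" "T \<in> \<B>" by blast
    then show False using AU BW int A(2)[of T] by blast
  qed
  have sum_un: "sum f (\<A> \<union> \<B>) = sum f \<A> + sum f \<B>" for f :: "'b set \<Rightarrow> 'b"
    by (rule sum.union_disjoint[OF finA finB disj])
  show ?thesis
    unfolding direct_sum_of_def
  proof (intro conjI allI impI)
    show "finite (\<A> \<union> \<B>)" using finA finB by simp
    show "V = {sum f (\<A> \<union> \<B>) | f. \<forall>W\<in>\<A> \<union> \<B>. f W \<in> W}"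
    proof (intro equalityI subsetI)
      fix v assume "v \<in> V"
      then obtain u w where uw: "v = u + w" "u \<in> U" "w \<in> W" using V by blast
      obtain f where f: "u = sum f \<A>" "\<forall>W\<in>\<A>. f W \<in> W" using uw(2) U by blast
      obtain h where h: "w = sum h \<B>" "\<forall>W\<in>\<B>. h W \<in> W" using uw(3) W by blast
      define k where "k T = (if T \<in> \<A> then f T else h T)" for T
      have "sum k \<A> = u" unfolding f(1) by (rule sum.cong) (simp_all add: k_def)
      moreover have "sum k \<B> = w" unfolding h(1) by (rule sum.cong) (use disj in \<open>auto simp: k_def\<close>)
      ultimately have "v = sum k (\<A> \<union> \<B>)" by (simp add: sum_un uw(1))
      moreover have "\<forall>W\<in>\<A> \<union> \<B>. k W \<in> W" using f(2) h(2) by (auto simp: k_def)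
      ultimately show "v \<in> {sum f (\<A> \<union> \<B>) | f. \<forall>W\<in>\<A> \<union> \<B>. f W \<in> W}" by blast
    next
      fix v assume "v \<in> {sum f (\<A> \<union> \<B>) | f. \<forall>W\<in>\<A> \<union> \<B>. f W \<in> W}"
      then obtain f where f: "v = sum f \<A> + sum f \<B>" "\<forall>W\<in>\<A> \<union> \<B>. f W \<in> W" by (auto simp: sum_un)
      have "sum f \<A> \<in> U" "sum f \<B> \<in> W" using f(2) U W by blast+
      then show "v \<in> V" using f(1) V by blast
    qed
    fix f assume f: "(\<forall>W\<in>\<A> \<union> \<B>. f W \<in> W) \<and> sum f (\<A> \<union> \<B>) = 0"
    have inU: "sum f \<A> \<in> U" and inW: "sum f \<B> \<in> W" using f U W by blast+
    have "sum f \<A> = - sum f \<B>" using f by (simp add: sum_un eq_neg_iff_add_eq_0)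
    then have "sum f \<A> \<in> W" using inW subspace_neg[OF UW(2)] by simp
    then have "sum f \<A> = 0" using inU int by blast
    moreover from this have "sum f \<B> = 0" using f by (simp add: sum_un)
    ultimately show "\<forall>W\<in>\<A> \<union> \<B>. f W = 0" using indA[of f] indB[of f] f by blast
  qed
qed

section \<open>Gluing and cutting representations\<close>

context fin_lie
begin

lemma rep_imp_fin_rep: "lie_rep g s V \<rho> \<Longrightarrow> fin_rep g s V \<rho>"
  by unfold_locales

lemma lie_repI:
  assumes "vector_space s" "fin_dim s V"
    and "\<And>x v. x \<in> L \<Longrightarrow> v \<in> V \<Longrightarrow> \<rho> x v \<in> V"
    and "\<And>x u v. x \<in> L \<Longrightarrow> u \<in> V \<Longrightarrow> v \<in> V \<Longrightarrow> \<rho> x (u + v) = \<rho> x u + \<rho> x v"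
    and "\<And>x c v. x \<in> L \<Longrightarrow> v \<in> V \<Longrightarrow> \<rho> x (s c v) = s c (\<rho> x v)"
    and out: "\<And>x v. x \<in> L \<Longrightarrow> v \<notin> V \<Longrightarrow> \<rho> x v = 0"
    and "\<And>x y v. x \<in> L \<Longrightarrow> y \<in> L \<Longrightarrow> v \<in> V \<Longrightarrow> \<rho> (x + y) v = \<rho> x v + \<rho> y v"
    and "\<And>x c v. x \<in> L \<Longrightarrow> v \<in> V \<Longrightarrow> \<rho> (sc c x) v = s c (\<rho> x v)"
    and "\<And>x y v. x \<in> L \<Longrightarrow> y \<in> L \<Longrightarrow> v \<in> V \<Longrightarrow> \<rho> (br x y) v = \<rho> x (\<rho> y v) - \<rho> y (\<rho> x v)"
  shows "lie_rep g s V \<rho>"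
proof -
  interpret V: vector_space s by fact
  have subV: "V.subspace V" using assms(2) by (rule V.fin_dim_imp_subspace)
  have zero: "\<rho> x 0 = 0" if "x \<in> L" for x
    using assms(5)[OF that V.subspace_0[OF subV], of 0] by simp
  show ?thesis
    unfolding lie_rep_def lie_hom_def linear_map_on_def
  proof (intro conjI ballI allI)
    fix x assume x: "x \<in> L"
    show "\<rho> x \<in> lie_carrier (gl s V)"
      unfolding V.gl_carrier_iff linear_map_on_def using assms x by blast
    show "\<rho> (sc c x) = lie_scale (gl s V) c (\<rho> x)" for c
    proof
      fix v show "\<rho> (sc c x) v = lie_scale (gl s V) c (\<rho> x) v"
        using assms x subspace_scale[OF subL x] by (cases "v \<in> V") (simp_all add: gl_def pointwise_scale_def)
    qed
    fix y assume y: "y \<in> L"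
    show "\<rho> (x + y) = \<rho> x + \<rho> y"
    proof
      fix v show "\<rho> (x + y) v = (\<rho> x + \<rho> y) v"
        using assms x y subspace_add[OF subL x y] by (cases "v \<in> V") simp_all
    qed
    show "\<rho> (br x y) = lie_bracket (gl s V) (\<rho> x) (\<rho> y)"
    proof
      fix v show "\<rho> (br x y) v = lie_bracket (gl s V) (\<rho> x) (\<rho> y) v"
        using assms x y br_in zero by (cases "v \<in> V") (simp_all add: gl_def)
    qed
  qed (use assms subV in auto)
qed

text \<open>A vector \<open>v\<close> is treated as the pair of \<open>v - p v\<close> in
  \<open>W\<close> and \<open>p v\<close> in the range of \<open>p\<close>. Building the sum inside
  the given \<open>V\<close> lets it replace another representation on the same space.\<close>

lemma rep_direct_sum:
  assumes vs: "vector_space s" and V: "fin_dim s V"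
    and W: "module.subspace s W" "W \<subseteq> V"
    and p: "linear_map_on s V s V p" "\<And>v. v \<in> V \<Longrightarrow> p (p v) = p v" "\<And>v. v \<in> V \<Longrightarrow> p v = 0 \<longleftrightarrow> v \<in> W"
    and rep1: "lie_rep g s W \<rho>1" and rep2: "lie_rep g s (p ` V) \<rho>2"
  defines "\<rho> \<equiv> \<lambda>x v. if v \<in> V then \<rho>1 x (v - p v) + \<rho>2 x (p v) else 0"
  shows "lie_rep g s V \<rho>"
    and "\<And>x y. x \<in> L \<Longrightarrow> y \<in> L \<Longrightarrow> trace_on s V (\<rho> x \<circ> \<rho> y) =
           trace_on s W (\<rho>1 x \<circ> \<rho>1 y) + trace_on s (p ` V) (\<rho>2 x \<circ> \<rho>2 y)"
    and "semisimple_rep g s W \<rho>1 \<Longrightarrow> semisimple_rep g s (p ` V) \<rho>2 \<Longrightarrow> semisimple_rep g s V \<rho>"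
proof -
  interpret V: vector_space s by fact
  interpret R1: fin_rep g s W \<rho>1 using rep1 by (rule rep_imp_fin_rep)
  interpret R2: fin_rep g s "p ` V" \<rho>2 using rep2 by (rule rep_imp_fin_rep)
  define C where "C = p ` V"
  have subV: "V.subspace V" using V by (rule V.fin_dim_imp_subspace)
  note subW = W(1) and subC = R2.subV[folded C_def]
  have pV: "p v \<in> V" if "v \<in> V" for v using p(1) that by (simp add: linear_map_on_def)
  have CV: "C \<subseteq> V" unfolding C_def using pV by blast
  have padd: "p (u + v) = p u + p v" if "u \<in> V" "v \<in> V" for u v using p(1) that by (simp add: linear_map_on_def)
  have pscale: "p (s c u) = s c (p u)" if "u \<in> V" for u c using p(1) that by (simp add: linear_map_on_def)
  have pC: "p c = c" if "c \<in> C" for c using that p(2) unfolding C_def by auto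
  have pW: "p w = 0" if "w \<in> W" for w using that p(3) W(2) by blast
  have qW: "v - p v \<in> W" if "v \<in> V" for v
  proof -
    have "p (v - p v) = 0" using V.linear_map_on_diff[OF p(1) subV that pV[OF that]] p(2)[OF that] by simp
    then show ?thesis using p(3)[of "v - p v"] V.subspace_diff[OF subV that pV[OF that]] by blast
  qed
  have \<rho>_on: "\<rho> x v = \<rho>1 x (v - p v) + \<rho>2 x (p v)" if "v \<in> V" for x v
    using that by (simp add: \<rho>_def)
  note R2in = R2.\<rho>_in[folded C_def]
  have onW: "\<rho> x w = \<rho>1 x w" if "x \<in> L" "w \<in> W" for x w
    using that W(2) pW by (auto simp: \<rho>_def R2.\<rho>_v(4))
  have onC: "\<rho> x c = \<rho>2 x c" if "x \<in> L" "c \<in> C" for x c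
    using that CV pC by (auto simp: \<rho>_def R1.\<rho>_v(4))
  have p\<rho>: "p (\<rho> x v) = \<rho>2 x (p v)" if "x \<in> L" "v \<in> V" for x v
  proof -
    have "\<rho>1 x (v - p v) \<in> W" "\<rho>2 x (p v) \<in> C" using R1.\<rho>_in R2in that(1) by blast+
    then show ?thesis using padd pW pC W(2) CV that(2) unfolding \<rho>_def by (simp add: subset_iff)
  qed
  have q\<rho>: "\<rho> x v - p (\<rho> x v) = \<rho>1 x (v - p v)" if "x \<in> L" "v \<in> V" for x v
    unfolding p\<rho>[OF that] using that by (simp add: \<rho>_def)
  have \<rho>V: "\<rho> x v \<in> V" if "x \<in> L" "v \<in> V" for x v
    using R1.\<rho>_in[OF that(1)] R2in[OF that(1)] W(2) CV that(2) V.subspace_add[OF subV]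
    by (simp add: \<rho>_def subset_iff)
  show rep: "lie_rep g s V \<rho>"
  proof (rule lie_repI[OF vs V])
    fix x y u v c assume x: "x \<in> L" and y: "y \<in> L"
    show "\<rho> x v \<in> V" if "v \<in> V" for v using \<rho>V[OF x that] .
    show "\<rho> x (u + v) = \<rho> x u + \<rho> x v" if "u \<in> V" "v \<in> V" for u v
    proof -
      have "u + v - (p u + p v) = (u - p u) + (v - p v)" by simp
      then have 1: "\<rho>1 x (u + v - (p u + p v)) = \<rho>1 x (u - p u) + \<rho>1 x (v - p v)"
        using R1.\<rho>_v(1)[OF x qW[OF that(1)] qW[OF that(2)]] by (simp only:)
      have 2: "\<rho>2 x (p u + p v) = \<rho>2 x (p u) + \<rho>2 x (p v)" using R2.\<rho>_v(1)[OF x] that by blast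
      show ?thesis using that V.subspace_add[OF subV that] by (simp add: \<rho>_on padd 1 2)
    qed
    show "\<rho> x (s c v) = s c (\<rho> x v)" if "v \<in> V" for c v
    proof -
      have "s c v - s c (p v) = s c (v - p v)" by (simp add: V.scale_right_diff_distrib)
      then have 1: "\<rho>1 x (s c v - s c (p v)) = s c (\<rho>1 x (v - p v))"
        using R1.\<rho>_v(2)[OF x qW[OF that]] by (simp only:)
      have 2: "\<rho>2 x (s c (p v)) = s c (\<rho>2 x (p v))" using R2.\<rho>_v(2)[OF x] that by blast
      show ?thesis
        using that V.subspace_scale[OF subV that] by (simp add: \<rho>_on pscale 1 2 V.scale_right_distrib)
    qed
    show "\<rho> x v = 0" if "v \<notin> V" for v using that by (simp add: \<rho>_def)
    show "\<rho> (x + y) v = \<rho> x v + \<rho> y v" if "v \<in> V" for v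
      using that x y by (simp add: \<rho>_def R1.\<rho>_add R2.\<rho>_add)
    show "\<rho> (sc c x) v = s c (\<rho> x v)" if "v \<in> V" for c v
      using that x by (simp add: \<rho>_def R1.\<rho>_scale R2.\<rho>_scale V.scale_right_distrib)
    show "\<rho> (br x y) v = \<rho> x (\<rho> y v) - \<rho> y (\<rho> x v)" if "v \<in> V" for v
    proof -
      have "\<rho> x (\<rho> y v) = \<rho>1 x (\<rho>1 y (v - p v)) + \<rho>2 x (\<rho>2 y (p v))" if "x \<in> L" "y \<in> L" for x y
        using q\<rho>[OF that(2) \<open>v \<in> V\<close>] p\<rho>[OF that(2) \<open>v \<in> V\<close>] \<rho>V[OF that(2) \<open>v \<in> V\<close>] by (simp add: \<rho>_on)
      then show ?thesis using that x y by (simp add: \<rho>_on R1.\<rho>_br R2.\<rho>_br)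
    qed
  qed
  then interpret R: fin_rep g s V \<rho> by (rule rep_imp_fin_rep)
  show "trace_on s V (\<rho> x \<circ> \<rho> y) =
      trace_on s W (\<rho>1 x \<circ> \<rho>1 y) + trace_on s (p ` V) (\<rho>2 x \<circ> \<rho>2 y)"
    if x: "x \<in> L" and y: "y \<in> L" for x y
  proof -
    have "trace_on s V (\<rho> x \<circ> \<rho> y) = trace_on s W (\<rho> x \<circ> \<rho> y) + trace_on s (p ` V) (p \<circ> (\<rho> x \<circ> \<rho> y))"
      by (rule V.trace_on_split[OF V R.\<rho>_comp_lin[OF x y] W _ p]) (use x y onW R1.\<rho>_in in auto)
    also have "trace_on s W (\<rho> x \<circ> \<rho> y) = trace_on s W (\<rho>1 x \<circ> \<rho>1 y)"
      by (rule V.trace_on_cong[OF R1.finV]) (use x y onW R1.\<rho>_in in auto)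
    also have "trace_on s (p ` V) (p \<circ> (\<rho> x \<circ> \<rho> y)) = trace_on s (p ` V) (\<rho>2 x \<circ> \<rho>2 y)"
    proof (rule V.trace_on_cong[OF R2.finV])
      fix v assume "v \<in> p ` V"
      then have v: "v \<in> C" by (simp add: C_def)
      then show "(p \<circ> (\<rho> x \<circ> \<rho> y)) v = (\<rho>2 x \<circ> \<rho>2 y) v"
        using onC[OF y v] onC[OF x R2in[OF y]] pC[OF R2in[OF x]] by simp
    qed
    finally show ?thesis .
  qed
  show "semisimple_rep g s V \<rho>" if ss: "semisimple_rep g s W \<rho>1" "semisimple_rep g s (p ` V) \<rho>2"
  proof -
    obtain \<A> \<B> where A: "direct_sum_of W \<A>" "\<And>A. A \<in> \<A> \<Longrightarrow> irreducible_subrep g s W \<rho>1 A"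
      and B: "direct_sum_of C \<B>" "\<And>A. A \<in> \<B> \<Longrightarrow> irreducible_subrep g s C \<rho>2 A"
      using ss unfolding semisimple_rep_def C_def by blast
    \<comment> \<open>\<open>\<rho>\<close> and \<open>\<sigma>\<close> agree on \<open>T\<close>,
      so inside \<open>A\<close> they have the same subrepresentations; irreducibility carries
      over.\<close>
    have lift: "irreducible_subrep g s V \<rho> A \<and> 0 \<in> A \<and> A \<noteq> {0}"
      if irr: "irreducible_subrep g s T \<sigma> A" and T: "T \<subseteq> V" "\<And>x w. x \<in> L \<Longrightarrow> w \<in> T \<Longrightarrow> \<rho> x w = \<sigma> x w"
      for T \<sigma> A
    proof -
      have A: "A \<subseteq> T" "V.subspace A" "A \<noteq> {0}" "\<And>x w. x \<in> L \<Longrightarrow> w \<in> A \<Longrightarrow> \<sigma> x w \<in> A"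
        "\<And>U. subrep g s T \<sigma> U \<Longrightarrow> U \<subseteq> A \<Longrightarrow> U = {0} \<or> U = A"
        using irr unfolding irreducible_subrep_def subrep_def by blast+
      have "subrep g s T \<sigma> U" if "subrep g s V \<rho> U" "U \<subseteq> A" for U
        unfolding subrep_def
      proof (intro conjI ballI)
        show "U \<subseteq> T" using that(2) A(1) by blast
        show "V.subspace U" using that(1) by (simp add: subrep_def)
        fix x w assume xw: "x \<in> L" "w \<in> U"
        then have "\<rho> x w \<in> U" using that(1) by (simp add: subrep_def)
        moreover have "w \<in> T" using xw(2) that(2) A(1) by blast
        ultimately show "\<sigma> x w \<in> U" using T(2)[OF xw(1)] by simp
      qed
      moreover have "subrep g s V \<rho> A"
        unfolding subrep_def
      proof (intro conjI ballI)
        show "A \<subseteq> V" using A(1) T(1) by blast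
        fix x w assume xw: "x \<in> L" "w \<in> A"
        then have "w \<in> T" using A(1) by blast
        then show "\<rho> x w \<in> A" using T(2)[OF xw(1)] A(4)[OF xw] by simp
      qed (rule A(2))
      ultimately show ?thesis
        using A(3,5) V.subspace_0[OF A(2)] unfolding irreducible_subrep_def by blast
    qed
    have liftA: "irreducible_subrep g s V \<rho> A \<and> 0 \<in> A \<and> A \<noteq> {0}" if "A \<in> \<A>" for A
      by (rule lift[OF A(2)[OF that] W(2) onW])
    have liftB: "irreducible_subrep g s V \<rho> A \<and> 0 \<in> A \<and> A \<noteq> {0}" if "A \<in> \<B>" for A
      by (rule lift[OF B(2)[OF that] CV onC])
    have "direct_sum2 V W C"
      unfolding direct_sum2_def
    proof
      show "V = {u + w |u w. u \<in> W \<and> w \<in> C}"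
      proof (intro equalityI subsetI)
        fix v assume v: "v \<in> V"
        have "v = (v - p v) + p v" by simp
        moreover have "p v \<in> C" using v by (simp add: C_def)
        ultimately show "v \<in> {u + w |u w. u \<in> W \<and> w \<in> C}" using qW[OF v] by blast
      qed (use W(2) CV V.subspace_add[OF subV] in auto)
      show "W \<inter> C = {0}" using pW pC V.subspace_0[OF subW] V.subspace_0[OF subC] by force
    qed
    then have "direct_sum_of V (\<A> \<union> \<B>)"
      using liftA liftB by (intro V.direct_sum_of_union[OF _ subW subC A(1) _ B(1)]) auto
    then show ?thesis unfolding semisimple_rep_def using liftA liftB by blast
  qed
qed

lemma subrep_restrict:
  assumes "lie_rep g s V \<rho>" and W: "subrep g s V \<rho> W"
  shows "lie_rep g s W (\<lambda>x v. if v \<in> W then \<rho> x v else 0)"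
proof -
  interpret R: fin_rep g s V \<rho> using assms(1) by (rule rep_imp_fin_rep)
  have W: "W \<subseteq> V" "R.V.subspace W" "\<And>x w. x \<in> L \<Longrightarrow> w \<in> W \<Longrightarrow> \<rho> x w \<in> W"
    using W by (auto simp: subrep_def)
  have WV: "w \<in> V" if "w \<in> W" for w using that W(1) by blast
  show ?thesis
    by (rule lie_repI[OF R.V.vector_space_axioms R.V.fin_dim_subspace[OF R.finV W(2,1)]])
      (simp_all add: W WV R.\<rho>_v R.\<rho>_add R.\<rho>_scale R.\<rho>_br R.V.subspace_add[OF W(2)] R.V.subspace_scale[OF W(2)])
qed

text \<open>The complement \<open>p ` V\<close> of a subrepresentation \<open>W\<close> carries the quotient representation \<open>V / W\<close>.\<close>

lemma quotient_rep:
  assumes "lie_rep g s V \<rho>" and W: "subrep g s V \<rho> W"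
    and p: "linear_map_on s V s V p" "\<And>v. v \<in> V \<Longrightarrow> p (p v) = p v" "\<And>v. v \<in> V \<Longrightarrow> p v = 0 \<longleftrightarrow> v \<in> W"
  shows "lie_rep g s (p ` V) (\<lambda>x v. if v \<in> p ` V then p (\<rho> x v) else 0)"
    and "\<And>x v. x \<in> L \<Longrightarrow> v \<in> V \<Longrightarrow> p (\<rho> x (p v)) = p (\<rho> x v)"
proof -
  interpret R: fin_rep g s V \<rho> using assms(1) by (rule rep_imp_fin_rep)
  have W: "W \<subseteq> V" "R.V.subspace W" "\<And>x w. x \<in> L \<Longrightarrow> w \<in> W \<Longrightarrow> \<rho> x w \<in> W"
    using W by (auto simp: subrep_def)
  have pV: "p v \<in> V" if "v \<in> V" for v using p(1) that by (simp add: linear_map_on_def)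
  have padd: "p (u + v) = p u + p v" if "u \<in> V" "v \<in> V" for u v using p(1) that by (simp add: linear_map_on_def)
  have pscale: "p (s c u) = s c (p u)" if "u \<in> V" for u c using p(1) that by (simp add: linear_map_on_def)
  note pdiff = R.V.linear_map_on_diff[OF p(1) R.subV]
  have subC: "R.V.subspace (p ` V)" using R.V.subspace_image_on[OF p(1) R.V.vector_space_axioms R.subV R.subV] by simp
  have CV: "v \<in> V" if "v \<in> p ` V" for v using that pV by blast
  show p\<rho>: "p (\<rho> x (p v)) = p (\<rho> x v)" if x: "x \<in> L" and v: "v \<in> V" for x v
  proof -
    have d: "v - p v \<in> V" using R.V.subspace_diff[OF R.subV v pV[OF v]] .
    have "p (v - p v) = 0" using pdiff[OF v pV[OF v]] p(2)[OF v] by simp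
    then have "v - p v \<in> W" using p(3)[OF d] by blast
    then have "\<rho> x (v - p v) \<in> W" by (rule W(3)[OF x])
    then have "p (\<rho> x (v - p v)) = 0" using p(3) W(1) by blast
    then show ?thesis
      using R.\<rho>_v(3)[OF x v pV[OF v]] pdiff[OF R.\<rho>_in[OF x] R.\<rho>_in[OF x], of v "p v"] by simp
  qed
  show "lie_rep g s (p ` V) (\<lambda>x v. if v \<in> p ` V then p (\<rho> x v) else 0)"
  proof (rule lie_repI[OF R.V.vector_space_axioms R.V.fin_dim_subspace[OF R.finV subC]])
    show "p ` V \<subseteq> V" using pV by blast
    fix x y v assume x: "x \<in> L" and y: "y \<in> L" and v: "v \<in> p ` V"
    have "p (\<rho> (br x y) v) = p (\<rho> x (\<rho> y v)) - p (\<rho> y (\<rho> x v))"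
      using x y by (simp add: R.\<rho>_br pdiff R.\<rho>_in)
    then show "(if v \<in> p ` V then p (\<rho> (br x y) v) else 0)
        = (if (if v \<in> p ` V then p (\<rho> y v) else 0) \<in> p ` V then p (\<rho> x (if v \<in> p ` V then p (\<rho> y v) else 0)) else 0)
        - (if (if v \<in> p ` V then p (\<rho> x v) else 0) \<in> p ` V then p (\<rho> y (if v \<in> p ` V then p (\<rho> x v) else 0)) else 0)"
      using v x y by (simp add: p\<rho> R.\<rho>_in)
  qed (simp_all add: CV R.\<rho>_in R.\<rho>_v R.\<rho>_add R.\<rho>_scale padd pscale R.V.subspace_add[OF subC] R.V.subspace_scale[OF subC])
qed

text \<open>The trace of an operator that preserves \<open>W\<close> depends only on the operators
  induced on \<open>W\<close> and on V / W. Replacing \<open>V\<close> by the direct sum of these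
  two therefore keeps the trace form, and both have smaller dimension.\<close>

lemma semisimplification:
  assumes "lie_rep g s V \<rho>"
  shows "\<exists>\<rho>'. lie_rep g s V \<rho>' \<and> semisimple_rep g s V \<rho>' \<and>
    (\<forall>x\<in>L. \<forall>y\<in>L. trace_on s V (\<rho>' x \<circ> \<rho>' y) = trace_on s V (\<rho> x \<circ> \<rho> y))"
  using assms
proof (induction "vector_space.dim s V" arbitrary: V \<rho> rule: less_induct)
  case (less V \<rho>)
  interpret R: fin_rep g s V \<rho> using less.prems by (rule rep_imp_fin_rep)
  have self: "subrep g s V \<rho> V" by (simp add: subrep_def R.subV R.\<rho>_in)
  consider "V = {0}" | "V \<noteq> {0}" "irreducible_subrep g s V \<rho> V"
    | W where "subrep g s V \<rho> W" "W \<noteq> {0}" "W \<noteq> V"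
    using self unfolding irreducible_subrep_def by blast
  then show ?case
  proof cases
    case 1
    have "semisimple_rep g s V \<rho>" unfolding semisimple_rep_def 1 using direct_sum_of_zero by blast
    then show ?thesis using less.prems by blast
  next
    case 2
    have "semisimple_rep g s V \<rho>" unfolding semisimple_rep_def using 2 direct_sum_of_single by blast
    then show ?thesis using less.prems by blast
  next
    case 3
    have W: "W \<subseteq> V" "R.V.subspace W" "\<And>x w. x \<in> L \<Longrightarrow> w \<in> W \<Longrightarrow> \<rho> x w \<in> W"
      using 3 by (auto simp: subrep_def)
    obtain p where p: "linear_map_on s V s V p" "\<And>v. v \<in> V \<Longrightarrow> p (p v) = p v"
        "\<And>v. v \<in> V \<Longrightarrow> p v = 0 \<longleftrightarrow> v \<in> W"
      using R.V.projection_along[OF R.finV W(2,1)] by blast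
    define \<rho>W where "\<rho>W = (\<lambda>x v. if v \<in> W then \<rho> x v else 0)"
    define \<rho>C where "\<rho>C = (\<lambda>x v. if v \<in> p ` V then p (\<rho> x v) else 0)"
    have pV: "p v \<in> V" if "v \<in> V" for v using p(1) that by (simp add: linear_map_on_def)
    have subC: "R.V.subspace (p ` V)" using R.V.subspace_image_on[OF p(1) R.V.vector_space_axioms R.subV R.subV] by simp
    have repW: "lie_rep g s W \<rho>W" unfolding \<rho>W_def by (rule subrep_restrict[OF less.prems 3(1)])
    have repC: "lie_rep g s (p ` V) \<rho>C" unfolding \<rho>C_def by (rule quotient_rep(1)[OF less.prems 3(1) p])
    have dimW: "R.V.dim W < R.V.dim V" using R.V.dim_less[OF R.finV W(2)] W(1) 3(3) by blast
    obtain w where "w \<in> W" "w \<noteq> 0" using 3(2) R.V.subspace_0[OF W(2)] by blast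
    moreover have "w \<notin> p ` V"
    proof
      assume "w \<in> p ` V"
      then have "p w = w" using p(2) by auto
      then show False using p(3)[of w] \<open>w \<in> W\<close> \<open>w \<noteq> 0\<close> W(1) by auto
    qed
    ultimately have "p ` V \<subset> V" using pV W(1) by blast
    then have dimC: "R.V.dim (p ` V) < R.V.dim V" by (rule R.V.dim_less[OF R.finV subC])
    obtain \<rho>1 where \<rho>1: "lie_rep g s W \<rho>1" "semisimple_rep g s W \<rho>1"
        "\<And>x y. x \<in> L \<Longrightarrow> y \<in> L \<Longrightarrow> trace_on s W (\<rho>1 x \<circ> \<rho>1 y) = trace_on s W (\<rho>W x \<circ> \<rho>W y)"
      using less.hyps[OF dimW repW] by blast
    obtain \<rho>2 where \<rho>2: "lie_rep g s (p ` V) \<rho>2" "semisimple_rep g s (p ` V) \<rho>2"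
        "\<And>x y. x \<in> L \<Longrightarrow> y \<in> L \<Longrightarrow> trace_on s (p ` V) (\<rho>2 x \<circ> \<rho>2 y) = trace_on s (p ` V) (\<rho>C x \<circ> \<rho>C y)"
      using less.hyps[OF dimC repC] by blast
    have "trace_on s V (\<rho> x \<circ> \<rho> y) = trace_on s W (\<rho>1 x \<circ> \<rho>1 y) + trace_on s (p ` V) (\<rho>2 x \<circ> \<rho>2 y)"
      if x: "x \<in> L" and y: "y \<in> L" for x y
    proof -
      have "trace_on s V (\<rho> x \<circ> \<rho> y) = trace_on s W (\<rho> x \<circ> \<rho> y) + trace_on s (p ` V) (p \<circ> (\<rho> x \<circ> \<rho> y))"
        by (rule R.V.trace_on_split[OF R.finV R.\<rho>_comp_lin[OF x y] W(2,1) _ p]) (use x y W(3) in auto)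
      also have "trace_on s W (\<rho> x \<circ> \<rho> y) = trace_on s W (\<rho>W x \<circ> \<rho>W y)"
        by (rule R.V.trace_on_cong[OF R.V.fin_dim_subspace[OF R.finV W(2,1)]]) (use x y W(3) in \<open>auto simp: \<rho>W_def\<close>)
      also have "trace_on s (p ` V) (p \<circ> (\<rho> x \<circ> \<rho> y)) = trace_on s (p ` V) (\<rho>C x \<circ> \<rho>C y)"
      proof (rule R.V.trace_on_cong)
        show "fin_dim s (p ` V)" using R.V.fin_dim_subspace[OF R.finV subC] pV by blast
        fix v assume "v \<in> p ` V"
        then show "(p \<circ> (\<rho> x \<circ> \<rho> y)) v = (\<rho>C x \<circ> \<rho>C y) v"
          using quotient_rep(2)[OF less.prems 3(1) p x R.\<rho>_in[OF y]] R.\<rho>_in[OF y] by (simp add: \<rho>C_def)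
      qed
      finally show ?thesis unfolding \<rho>1(3)[OF x y] \<rho>2(3)[OF x y] .
    qed
    moreover define \<rho>' where "\<rho>' = (\<lambda>x v. if v \<in> V then \<rho>1 x (v - p v) + \<rho>2 x (p v) else 0)"
    have "lie_rep g s V \<rho>'"
      unfolding \<rho>'_def by (rule rep_direct_sum(1)[OF R.V.vector_space_axioms R.finV W(2,1) p \<rho>1(1) \<rho>2(1)])
    moreover have "trace_on s V (\<rho>' x \<circ> \<rho>' y) = trace_on s W (\<rho>1 x \<circ> \<rho>1 y) + trace_on s (p ` V) (\<rho>2 x \<circ> \<rho>2 y)"
      if "x \<in> L" "y \<in> L" for x y
      unfolding \<rho>'_def
      by (rule rep_direct_sum(2)[OF R.V.vector_space_axioms R.finV W(2,1) p \<rho>1(1) \<rho>2(1) that])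
    moreover have "semisimple_rep g s V \<rho>'"
      unfolding \<rho>'_def
      by (rule rep_direct_sum(3)[OF R.V.vector_space_axioms R.finV W(2,1) p \<rho>1(1) \<rho>2(1) \<rho>1(2) \<rho>2(2)])
    ultimately show ?thesis by (intro exI[of _ \<rho>'] conjI ballI) simp_all
  qed
qed

end

section \<open>Trace forms\<close>

context fin_lie
begin

lemma trace_form_add:
  assumes "trace_form g \<beta>1" "trace_form g \<beta>2"
  shows "trace_form g (\<lambda>x y. \<beta>1 x y + \<beta>2 x y)"
proof -
  obtain V1 \<rho>1 where r1: "lie_rep g seq_scale V1 \<rho>1"
      "\<And>x y. x \<in> L \<Longrightarrow> y \<in> L \<Longrightarrow> \<beta>1 x y = trace_on seq_scale V1 (\<rho>1 x \<circ> \<rho>1 y)"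
    using assms(1) unfolding trace_form_def by blast
  obtain V2 \<rho>2 where r2: "lie_rep g seq_scale V2 \<rho>2"
      "\<And>x y. x \<in> L \<Longrightarrow> y \<in> L \<Longrightarrow> \<beta>2 x y = trace_on seq_scale V2 (\<rho>2 x \<circ> \<rho>2 y)"
    using assms(2) unfolding trace_form_def by blast
  define s where "s = (seq_scale :: 'f \<Rightarrow> _)"
  interpret V: vector_space s unfolding s_def by (rule vector_space_function_scale)
  \<comment> \<open>the two representation spaces are made independent by moving them to the even and odd coordinates\<close>
  define \<phi>1 where "\<phi>1 f = (\<lambda>n. if even n then f (n div 2) else 0)" for f :: "nat \<Rightarrow> 'f"
  define \<phi>2 where "\<phi>2 f = (\<lambda>n. if odd n then f (n div 2) else 0)" for f :: "nat \<Rightarrow> 'f"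
  have lin: "Vector_Spaces.linear s s \<phi>1" "Vector_Spaces.linear s s \<phi>2"
    unfolding Vector_Spaces.linear_iff
    by (auto simp: V.vector_space_axioms) (auto simp: \<phi>1_def \<phi>2_def s_def pointwise_scale_def fun_eq_iff)
  have inj: "inj_on \<phi>1 V1" "inj_on \<phi>2 V2"
  proof -
    show "inj_on \<phi>1 V1"
    proof (rule inj_onI)
      fix f h assume "\<phi>1 f = \<phi>1 h"
      then have "\<phi>1 f (2 * n) = \<phi>1 h (2 * n)" for n by simp
      then show "f = h" by (auto simp: \<phi>1_def fun_eq_iff)
    qed
    show "inj_on \<phi>2 V2"
    proof (rule inj_onI)
      fix f h assume "\<phi>2 f = \<phi>2 h"
      then have "\<phi>2 f (2 * n + 1) = \<phi>2 h (2 * n + 1)" for n by simp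
      then show "f = h" by (auto simp: \<phi>2_def fun_eq_iff)
    qed
  qed
  define W where "W = \<phi>1 ` V1"
  define C where "C = \<phi>2 ` V2"
  define \<sigma>1 where "\<sigma>1 = (\<lambda>x w. if w \<in> W then \<phi>1 (\<rho>1 x (inv_into V1 \<phi>1 w)) else 0)"
  define \<sigma>2 where "\<sigma>2 = (\<lambda>x w. if w \<in> C then \<phi>2 (\<rho>2 x (inv_into V2 \<phi>2 w)) else 0)"
  note t1 = lie_rep_transport(1)[OF lin(1) inj(1) r1(1)[folded s_def], folded W_def, folded \<sigma>1_def]
  note t2 = lie_rep_transport(1)[OF lin(2) inj(2) r2(1)[folded s_def], folded C_def, folded \<sigma>2_def]
  have fW: "fin_dim s W" and fC: "fin_dim s C" using t1 t2 by (auto simp: lie_rep_def)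
  define V where "V = {w + c | w c. w \<in> W \<and> c \<in> C}"
  obtain B1 B2 where "finite B1" "V.span B1 = W" "finite B2" "V.span B2 = C"
    using fW fC by (auto simp: fin_dim_def)
  then have fV: "fin_dim s V" unfolding fin_dim_def V_def
    by (intro exI[of _ "B1 \<union> B2"]) (auto simp: V.span_Un)
  have subW: "V.subspace W" and subC: "V.subspace C" using V.fin_dim_imp_subspace fW fC by blast+
  have oddW: "w n = 0" if "w \<in> W" "odd n" for w n using that by (auto simp: W_def \<phi>1_def)
  have evenC: "w n = 0" if "w \<in> C" "even n" for w n using that by (auto simp: C_def \<phi>2_def)
  \<comment> \<open>\<open>W\<close> occupies the even and \<open>C\<close> the odd places, so
    clearing the even places projects \<open>V\<close> to \<open>C\<close> along
    \<open>W\<close>.\<close>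
  define p where "p v = (\<lambda>n. if odd n then v n else 0)" for v :: "nat \<Rightarrow> 'f"
  have p: "p (w + c) = c" if "w \<in> W" "c \<in> C" for w c
    using oddW[OF that(1)] evenC[OF that(2)] by (auto simp: p_def fun_eq_iff)
  have WV: "W \<subseteq> V"
  proof
    fix w assume "w \<in> W"
    moreover have "w = w + 0" by simp
    ultimately show "w \<in> V" unfolding V_def using V.subspace_0[OF subC] by blast
  qed
  have CV: "C \<subseteq> V"
  proof
    fix c assume "c \<in> C"
    moreover have "c = 0 + c" by simp
    ultimately show "c \<in> V" unfolding V_def using V.subspace_0[OF subW] by blast
  qed
  have pC: "p c = c" if "c \<in> C" for c using p[OF V.subspace_0[OF subW] that] by simp
  have pV: "p v \<in> C" if "v \<in> V" for v using that p unfolding V_def by auto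
  have pim: "p ` V = C"
  proof (intro equalityI subsetI)
    fix c assume "c \<in> C"
    then show "c \<in> p ` V" using pC CV by (metis imageI subsetD)
  qed (use pV in auto)
  have plin: "linear_map_on s V s V p"
    unfolding linear_map_on_def using pV CV
    by (auto simp: p_def s_def pointwise_scale_def fun_eq_iff subset_iff)
  have pidem: "p (p v) = p v" for v by (auto simp: p_def)
  have pker: "p v = 0 \<longleftrightarrow> v \<in> W" if v: "v \<in> V" for v
  proof -
    obtain w c where wc: "v = w + c" "w \<in> W" "c \<in> C" using v unfolding V_def by blast
    have "c = 0" if "v \<in> W"
    proof
      fix n show "c n = 0 n"
        using oddW[OF that, of n] oddW[OF wc(2), of n] evenC[OF wc(3), of n] wc(1) by (cases "even n") auto
    qed
    then show ?thesis using p[OF wc(2,3)] wc by auto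
  qed
  define \<rho> where "\<rho> = (\<lambda>x v. if v \<in> V then \<sigma>1 x (v - p v) + \<sigma>2 x (p v) else 0)"
  have rep2: "lie_rep g s (p ` V) \<sigma>2" unfolding pim by (rule t2)
  have rep: "lie_rep g s V \<rho>"
    unfolding \<rho>_def
    by (rule rep_direct_sum(1)[OF V.vector_space_axioms fV subW WV plin _ _ t1 rep2]) (use pidem pker in auto)
  moreover have "\<beta>1 x y + \<beta>2 x y = trace_on s V (\<rho> x \<circ> \<rho> y)" if x: "x \<in> L" and y: "y \<in> L" for x y
  proof -
    have "trace_on s V (\<rho> x \<circ> \<rho> y) = trace_on s W (\<sigma>1 x \<circ> \<sigma>1 y) + trace_on s (p ` V) (\<sigma>2 x \<circ> \<sigma>2 y)"
      unfolding \<rho>_def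
      by (rule rep_direct_sum(2)[OF V.vector_space_axioms fV subW WV plin _ _ t1 rep2 x y]) (use pidem pker in auto)
    also have "trace_on s W (\<sigma>1 x \<circ> \<sigma>1 y) = \<beta>1 x y"
      unfolding r1(2)[OF x y, folded s_def] \<sigma>1_def W_def
      by (rule lie_rep_transport(4)[OF lin(1) inj(1) r1(1)[folded s_def] x y])
    also have "trace_on s (p ` V) (\<sigma>2 x \<circ> \<sigma>2 y) = \<beta>2 x y"
      unfolding pim r2(2)[OF x y, folded s_def] \<sigma>2_def C_def
      by (rule lie_rep_transport(4)[OF lin(2) inj(2) r2(1)[folded s_def] x y])
    finally show ?thesis ..
  qed
  ultimately show ?thesis unfolding trace_form_def s_def by blast
qed

text \<open>A functional that vanishes on brackets is a representation on the field itself, where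
  the trace of a composition is the product of the scalars.\<close>

lemma trace_form_of_character:
  assumes l: "linear_map_on sc L (*) UNIV l" and br0: "\<And>x y. x \<in> L \<Longrightarrow> y \<in> L \<Longrightarrow> l (br x y) = 0"
  shows "trace_form g (\<lambda>x y. l x * l y)"
proof (rule trace_formI)
  define t where "t = ((*) :: 'f \<Rightarrow> 'f \<Rightarrow> 'f)"
  interpret F: vector_space t unfolding t_def by unfold_locales (auto simp: algebra_simps)
  have "F.span {1} = range (\<lambda>k. t k 1)" by (rule F.span_singleton)
  also have "\<dots> = UNIV" by (simp add: t_def)
  finally have basis: "is_basis t UNIV {1}" by (simp add: is_basis_def)
  show rep: "lie_rep g (*) UNIV (\<lambda>x v. l x * v)"
    unfolding t_def[symmetric]
    by (rule lie_repI[OF F.vector_space_axioms F.is_basis_fin_dim[OF basis]])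
      (use l br0 in \<open>auto simp: t_def linear_map_on_def algebra_simps\<close>)
  fix x y assume "x \<in> L" "y \<in> L"
  have lin: "linear_map_on t UNIV t UNIV ((\<lambda>v. l x * v) \<circ> (\<lambda>v. l y * v))"
    by (auto simp: linear_map_on_def t_def algebra_simps)
  have "F.representation {1} (t (l x * l y) 1) 1 = l x * l y"
    using basis F.representation_scale[of "{1}" 1 "l x * l y"] F.representation_basis[of "{1}" 1]
    unfolding is_basis_def by simp
  then show "l x * l y = trace_on (*) UNIV ((\<lambda>v. l x * v) \<circ> (\<lambda>v. l y * v))"
    using trace_on_eq[OF F.vector_space_axioms basis lin] by (simp add: t_def)
qed

lemma trace_form_sum_of_characters:
  assumes "finite B" "\<And>b. b \<in> B \<Longrightarrow> linear_map_on sc L (*) UNIV (l b)"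
    and "\<And>b x y. b \<in> B \<Longrightarrow> x \<in> L \<Longrightarrow> y \<in> L \<Longrightarrow> l b (br x y) = 0"
  shows "trace_form g (\<lambda>x y. \<Sum>b\<in>B. l b x * l b y)"
  using assms
proof (induction B)
  case empty
  show ?case using trace_form_of_character[of "\<lambda>_. 0"] by (simp add: linear_map_on_def)
next
  case (insert b B)
  then have "trace_form g (\<lambda>x y. l b x * l b y + (\<Sum>b\<in>B. l b x * l b y))"
    by (intro trace_form_add trace_form_of_character) auto
  then show ?case using insert by simp
qed

lemma rep_pullback:
  assumes "lie_rep g s V \<rho>" and "lie_hom g g \<pi>"
  shows "lie_rep g s V (\<lambda>x. \<rho> (\<pi> x))"
  using assms unfolding lie_rep_def lie_hom_def linear_map_on_def by auto

end

section \<open>Orthogonality of the centre and the derived algebra\<close>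

context fin_rep
begin

text \<open>Invariance moves one factor of a bracket over to the central element, where the bracket
  vanishes. The context is a bare representation since the theorem claims this for every
  nondegenerate trace form.\<close>

lemma centre_orthogonal_derived:
  assumes z: "z \<in> Z" and x: "x \<in> S"
  shows "\<beta> z x = 0"
proof -
  have zL: "z \<in> L" using z by (rule centreD(3))
  have "x \<in> commutator L" using x by (simp add: derived_eq)
  then have "\<beta> z x = 0 \<and> x \<in> L" unfolding commutator_def
  proof (induction x rule: span_induct_alt)
    case base
    then show ?case using zL by (simp add: \<beta>_zero subspace_0[OF subL])
  next
    case (step c u y)
    then obtain a b where u: "u = br a b" "a \<in> L" "b \<in> L" by blast
    have "\<beta> z u = \<beta> (br z a) b" unfolding u(1) using \<beta>_inv[OF zL u(2,3)] by simp
    also have "\<dots> = 0" using centreD(1)[OF z u(2)] u(3) \<beta>_zero by simp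
    finally have "\<beta> z u = 0" .
    moreover have "u \<in> L" using u br_in by simp
    ultimately show ?case
      using step.IH zL by (simp add: \<beta>_add' \<beta>_scale' subspace_add[OF subL] subspace_scale[OF subL])
  qed
  then show ?thesis ..
qed

end

section \<open>The projection to the derived algebra and a nondegenerate trace form\<close>

context faithful_ss_rep
begin

text \<open>The projection to [g, g] along the centre. The choice is unique because the two
  subspaces meet only in 0.\<close>

definition \<pi> :: "'b \<Rightarrow> 'b" where
  "\<pi> x = (SOME y. y \<in> S \<and> x - y \<in> Z)"

lemma SL: "S \<subseteq> L" and subS: "subspace S" and ZL: "Z \<subseteq> L" and subZ: "subspace Z"
  using idealD(1,2)[OF derived_ideal] idealD(1,2)[OF centre_ideal] by blast+

lemma \<pi>: "x \<in> L \<Longrightarrow> \<pi> x \<in> S \<and> x - \<pi> x \<in> Z"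
proof -
  assume "x \<in> L"
  then obtain z y where "z \<in> Z" "y \<in> S" "x = z + y" by (rule centre_plus_derived)
  then have "y \<in> S \<and> x - y \<in> Z" by simp
  then show ?thesis unfolding \<pi>_def by (rule someI)
qed

lemma \<pi>_eqI: "x \<in> L \<Longrightarrow> y \<in> S \<Longrightarrow> x - y \<in> Z \<Longrightarrow> \<pi> x = y"
proof -
  assume a: "x \<in> L" "y \<in> S" "x - y \<in> Z"
  have "\<pi> x - y \<in> S" using \<pi>[OF a(1)] a(2) subspace_diff[OF subS] by blast
  moreover have "(x - y) - (x - \<pi> x) \<in> Z" using \<pi>[OF a(1)] a(3) subspace_diff[OF subZ] by blast
  then have "\<pi> x - y \<in> Z" by simp
  ultimately show ?thesis using centre_Int_derived by (metis Int_iff eq_iff_diff_eq_0 singletonD)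
qed

lemma \<pi>_S: "y \<in> S \<Longrightarrow> \<pi> y = y"
  using \<pi>_eqI[of y y] SL subspace_0[OF subZ] by auto

lemma \<pi>_Z: "z \<in> Z \<Longrightarrow> \<pi> z = 0"
  using \<pi>_eqI[of z 0] ZL subspace_0[OF subS] by auto

text \<open>Central components drop out of brackets. Through this, statements about arbitrary
  elements of \<open>g\<close> reduce to elements of [g, g], and \<open>\<pi>\<close> becomes a
  homomorphism.\<close>

lemma br_\<pi>:
  assumes "x \<in> L" "y \<in> L"
  shows "br x y = br (\<pi> x) (\<pi> y)"
proof -
  have L: "\<pi> x \<in> L" "\<pi> y \<in> L" using \<pi> assms SL by blast+
  have "br (x - \<pi> x) y = 0" "br (\<pi> x) (y - \<pi> y) = 0"
    using centreD(1)[of "x - \<pi> x" y] centreD(2)[of "y - \<pi> y" "\<pi> x"] \<pi> assms L by blast+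
  then show ?thesis using br_diff(1)[of x "\<pi> x" y] br_diff(2)[of y "\<pi> y" "\<pi> x"] assms L by simp
qed

lemma br_in_S: "x \<in> L \<Longrightarrow> y \<in> L \<Longrightarrow> br x y \<in> S"
  unfolding derived_eq by (rule commutator_in)

lemma \<pi>_hom: "lie_hom g g \<pi>"
  unfolding lie_hom_def linear_map_on_def
proof (intro conjI ballI allI)
  fix x assume x: "x \<in> L"
  show "\<pi> x \<in> L" using \<pi>[OF x] SL by blast
  show "\<pi> (sc c x) = sc c (\<pi> x)" for c
  proof (rule \<pi>_eqI)
    have "sc c (x - \<pi> x) \<in> Z" using \<pi>[OF x] subspace_scale[OF subZ] by blast
    then show "sc c x - sc c (\<pi> x) \<in> Z" by (simp add: scale_right_diff_distrib)
  qed (use \<pi>[OF x] x subspace_scale[OF subS] subspace_scale[OF subL] in auto)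
  fix y assume y: "y \<in> L"
  show "\<pi> (x + y) = \<pi> x + \<pi> y"
  proof (rule \<pi>_eqI)
    have "(x - \<pi> x) + (y - \<pi> y) \<in> Z" using \<pi>[OF x] \<pi>[OF y] subspace_add[OF subZ] by blast
    then show "x + y - (\<pi> x + \<pi> y) \<in> Z" by (simp add: algebra_simps)
  qed (use \<pi>[OF x] \<pi>[OF y] x y subspace_add[OF subS] subspace_add[OF subL] in auto)
  show "\<pi> (br x y) = br (\<pi> x) (\<pi> y)"
    using \<pi>_S[OF br_in_S[OF x y]] br_\<pi>[OF x y] by simp
qed

text \<open>The form \<open>\<beta>\<close> is pulled back along \<open>\<pi>\<close>, which
  discards its values on the centre. On the centre it is replaced by the standard scalar product in
  coordinates, which is nondegenerate over every field.\<close>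

lemma nondegenerate_trace_form_exists: "\<exists>\<beta>'. trace_form g \<beta>' \<and> nondegenerate g \<beta>'"
proof -
  obtain B where B: "is_basis sc Z B" using fin_dim_obtain_basis[OF fin_dim_subspace[OF fin subZ ZL]] .
  have B': "finite B" "independent B" "span B = Z" using B by (auto simp: is_basis_def)
  \<comment> \<open>The coordinates of the central part of \<open>x\<close>. They vanish on [g, g],
    hence are characters.\<close>
  define l where "l b x = representation B (x - \<pi> x) b" for b x
  have \<pi>add: "\<pi> (x + y) = \<pi> x + \<pi> y" and \<pi>scale: "\<pi> (sc c x) = sc c (\<pi> x)" if "x \<in> L" "y \<in> L" for x y c
    using \<pi>_hom that by (auto simp: lie_hom_def linear_map_on_def)
  have l_lin: "linear_map_on sc L (*) UNIV (l b)" for b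
    unfolding linear_map_on_def
  proof (intro conjI ballI allI)
    fix x assume x: "x \<in> L"
    have "sc c x - \<pi> (sc c x) = sc c (x - \<pi> x)" for c using \<pi>scale[OF x x] by (simp add: scale_right_diff_distrib)
    then show "l b (sc c x) = c * l b x" for c
      using \<pi>[OF x] B' by (simp add: l_def representation_scale)
    fix y assume y: "y \<in> L"
    have eq: "x + y - \<pi> (x + y) = (x - \<pi> x) + (y - \<pi> y)" using \<pi>add[OF x y] by simp
    show "l b (x + y) = l b x + l b y"
      unfolding l_def eq by (subst representation_add) (use \<pi>[OF x] \<pi>[OF y] B' in auto)
  qed simp
  have l_S: "l b x = 0" if "x \<in> S" for b x
    using \<pi>_S[OF that] by (simp add: l_def representation_zero)
  have form1: "trace_form g (\<lambda>x y. \<beta> (\<pi> x) (\<pi> y))"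
    by (rule trace_formI[OF rep_pullback[OF rep \<pi>_hom]]) (simp add: \<beta>_def)
  have form2: "trace_form g (\<lambda>x y. \<Sum>b\<in>B. l b x * l b y)"
    by (rule trace_form_sum_of_characters[OF B'(1) l_lin l_S[OF br_in_S]])
  define \<gamma> where "\<gamma> x y = \<beta> (\<pi> x) (\<pi> y) + (\<Sum>b\<in>B. l b x * l b y)" for x y
  have "trace_form g \<gamma>" unfolding \<gamma>_def by (rule trace_form_add[OF form1 form2])
  moreover have "nondegenerate g \<gamma>"
    unfolding nondegenerate_def
  proof (intro ballI impI)
    fix x assume x: "x \<in> L" and orth: "\<forall>y\<in>L. \<gamma> x y = 0"
    have \<pi>xL: "\<pi> x \<in> L" using \<pi>[OF x] SL by blast
    have "\<beta> (\<pi> x) y = 0" if y: "y \<in> S" for y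
      using bspec[OF orth, of y] y SL l_S[OF y] \<pi>_S[OF y] by (auto simp: \<gamma>_def)
    then have \<pi>x: "\<pi> x = 0" using derived_nondegenerate \<pi>[OF x] by blast
    have "l b x = 0" if b: "b \<in> B" for b
    proof -
      have bZ: "b \<in> Z" using is_basis_in[OF B b] .
      have "l c b = (if c = b then 1 else 0)" for c
        using \<pi>_Z[OF bZ] representation_basis[OF B'(2) b] by (auto simp: l_def)
      \<comment> \<open>Testing against a basis vector of the centre isolates one coordinate, so no
        positivity of a sum of squares is required.\<close>
      then have "\<gamma> x b = (\<Sum>c\<in>B. if c = b then l b x else 0)"
        using \<pi>_Z[OF bZ] \<beta>_zero(1)[OF \<pi>xL] by (auto simp: \<gamma>_def intro!: sum.cong)
      also have "\<dots> = l b x" using B'(1) b by simp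
      finally show ?thesis using orth bZ ZL by auto
    qed
    then have "representation B x b = 0" if "b \<in> B" for b using that by (simp add: l_def \<pi>x)
    then show "x = 0" using is_basis_expand[OF B, of x] \<pi>[OF x] \<pi>x by simp
  qed
  ultimately show ?thesis by blast
qed

end

section \<open>The derived algebra\<close>

lemma (in fin_lie) ad_rep: "lie_rep g sc L (ad g)"
proof (rule lie_repI[OF vector_space_axioms fin])
  fix x y v assume "x \<in> L" "y \<in> L" "v \<in> L"
  then show "ad g (br x y) v = ad g x (ad g y v) - ad g y (ad g x v)"
    using jacobi[of x y v] by (simp add: ad_def br_in)
qed (simp_all add: ad_def br_in br_add br_scale subspace_add[OF subL] subspace_scale[OF subL])

section \<open>Ideals inside the derived algebra\<close>

context faithful_ss_rep
begin

definition orth :: "'b set \<Rightarrow> 'b set" where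
  "orth T = {x \<in> S. \<forall>t\<in>T. \<beta> x t = 0}"

lemma orth_ideal:
  assumes T: "lie_ideal g T"
  shows "lie_ideal g (orth T)"
  unfolding lie_ideal_def
proof (intro conjI ballI)
  note TD = idealD[OF T]
  have TL: "t \<in> L" if "t \<in> T" for t using that TD(1) by blast
  have SL': "x \<in> L" if "x \<in> S" for x using that SL by blast
  show "orth T \<subseteq> L" using SL by (auto simp: orth_def)
  show "subspace (orth T)"
    by (rule subspaceI) (auto simp: orth_def subspace_0[OF subS] subspace_add[OF subS] subspace_scale[OF subS]
        TL SL' \<beta>_zero \<beta>_add \<beta>_scale)
  fix a x assume a: "a \<in> L" and x: "x \<in> orth T"
  have xL: "x \<in> L" using x SL by (auto simp: orth_def)
  have "\<beta> (br a x) t = 0" if t: "t \<in> T" for t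
  proof -
    have "br a x = sc (- 1) (br x a)" using br_anti[OF a xL] by simp
    then have "\<beta> (br a x) t = - \<beta> x (br a t)"
      using \<beta>_scale[of "br x a" t "- 1"] \<beta>_inv[OF xL a TL[OF t]] br_in[OF xL a] TL[OF t] by simp
    then show ?thesis using x TD(3)[OF a t] by (simp add: orth_def)
  qed
  then show "br a x \<in> orth T" using br_in_S[OF a xL] by (simp add: orth_def)
qed

context
  fixes T
  assumes T: "lie_ideal g T" and TS: "T \<subseteq> S"
begin

lemma T_props: "subspace T" "T \<subseteq> L" "\<And>x y. x \<in> L \<Longrightarrow> y \<in> T \<Longrightarrow> br x y \<in> T" "\<And>x y. x \<in> L \<Longrightarrow> y \<in> T \<Longrightarrow> br y x \<in> T"
  using idealD[OF T] by blast+

text \<open>The intersection is an isotropic ideal, hence central, and it lies in the derived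
  algebra.\<close>

lemma Int_orth: "T \<inter> orth T = {0}"
proof -
  have "T \<inter> orth T \<subseteq> Z"
    by (rule isotropic_ideal_central[OF ideal_Int[OF T orth_ideal[OF T]]]) (auto simp: orth_def)
  moreover have "0 \<in> T \<inter> orth T"
    using idealD(2)[OF ideal_Int[OF T orth_ideal[OF T]]] by (rule subspace_0)
  ultimately show ?thesis using TS centre_Int_derived by blast
qed

lemma orth_split:
  assumes x: "x \<in> S"
  shows "\<exists>u\<in>T. x - u \<in> orth T"
proof -
  have nd: "u = 0" if u: "u \<in> T" "\<And>w. w \<in> T \<Longrightarrow> \<beta> u w = 0" for u
  proof -
    have "u \<in> T \<inter> orth T" using u TS by (auto simp: orth_def)
    then show ?thesis using Int_orth by blast
  qed
  have xL: "x \<in> L" using x SL by blast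
  have "\<exists>u\<in>T. \<forall>w\<in>T. \<beta> (x - u) w = 0"
    by (rule orthogonal_split[OF fin_dim_subspace[OF fin T_props(1,2)] T_props(2) \<beta>_add \<beta>_add' \<beta>_scale \<beta>_scale'
          nd subL xL])
  then obtain u where u: "u \<in> T" "\<forall>w\<in>T. \<beta> (x - u) w = 0" by blast
  have "x - u \<in> S" using x u(1) TS subspace_diff[OF subS] by blast
  then show ?thesis using u by (auto simp: orth_def)
qed

text \<open>Modulo the centre, \<open>x\<close> is the sum of some \<open>u\<close> in
  \<open>T\<close> and an element of \<open>orth T\<close>. The latter commutes with
  \<open>T\<close>, because such brackets lie in both ideals. Consequently \<open>T\<close> alone
  decides which of its subspaces are ideals of \<open>g\<close>.\<close>

lemma br_inner:
  assumes x: "x \<in> L"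
  shows "\<exists>u\<in>T. \<forall>t\<in>T. br x t = br u t"
proof -
  obtain u where u: "u \<in> T" "\<pi> x - u \<in> orth T" using orth_split[of "\<pi> x"] \<pi>[OF x] by blast
  have \<pi>L: "\<pi> x \<in> L" using \<pi>[OF x] SL by blast
  have "br x t = br u t" if t: "t \<in> T" for t
  proof -
    have tL: "t \<in> L" and tS: "t \<in> S" and uL: "u \<in> L" using t TS T_props(2) u(1) by blast+
    have d: "\<pi> x - u \<in> L" using subspace_diff[OF subL \<pi>L uL] .
    have "br (\<pi> x - u) t \<in> T" by (rule T_props(3)[OF d t])
    moreover have "br (\<pi> x - u) t \<in> orth T" by (rule idealD(4)[OF orth_ideal[OF T] tL u(2)])
    ultimately have "br (\<pi> x - u) t = 0" using Int_orth by blast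
    then have "br (\<pi> x) t = br u t" using br_diff(1)[OF \<pi>L uL tL] by simp
    then show ?thesis using br_\<pi>[OF x tL] \<pi>_S[OF tS] by simp
  qed
  then show ?thesis using u(1) by blast
qed

lemma ideal_of_sub_lie:
  assumes I: "lie_ideal (sub_lie g T) I"
  shows "lie_ideal g I"
proof -
  have I: "I \<subseteq> T" "subspace I" "\<And>x y. x \<in> T \<Longrightarrow> y \<in> I \<Longrightarrow> br x y \<in> I"
    using I by (auto simp: lie_ideal_def sub_lie_def)
  have "br x y \<in> I" if x: "x \<in> L" and y: "y \<in> I" for x y
  proof -
    obtain u where u: "u \<in> T" "\<forall>t\<in>T. br x t = br u t" using br_inner[OF x] by blast
    then show ?thesis using I(1,3) y by auto
  qed
  then show ?thesis using I T_props(2) unfolding lie_ideal_def by blast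
qed

text \<open>An abelian \<open>T\<close> would be central, since every element of \<open>g\<close>
  acts on \<open>T\<close> like an element of \<open>T\<close>; this contradicts
  \<open>T \<noteq> {0}\<close>. The same fact turns ideals of \<open>T\<close> into ideals of
  \<open>g\<close>, where minimality applies.\<close>

lemma minimal_ideal_simple:
  assumes T0: "T \<noteq> {0}" and min: "\<And>I. lie_ideal g I \<Longrightarrow> I \<subseteq> T \<Longrightarrow> I = {0} \<or> I = T"
  shows "simple_lie (sub_lie g T)"
  unfolding simple_lie_def
proof (intro conjI allI impI)
  show "\<not> lie_abelian (sub_lie g T)"
  proof
    assume ab: "lie_abelian (sub_lie g T)"
    have "t = 0" if t: "t \<in> T" for t
    proof -
      have tL: "t \<in> L" using t T_props(2) by blast
      have "br t x = 0" if x: "x \<in> L" for x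
      proof -
        obtain u where u: "u \<in> T" "\<forall>t\<in>T. br x t = br u t" using br_inner[OF x] by blast
        then have "br x t = 0" using ab t by (simp add: lie_abelian_def sub_lie_def)
        then show ?thesis using br_anti[OF tL x] by simp
      qed
      then have "t \<in> Z" using tL by (simp add: lie_centre_def)
      then show ?thesis using t TS centre_Int_derived by blast
    qed
    then show False using T0 subspace_0[OF T_props(1)] by blast
  qed
  fix I assume I: "lie_ideal (sub_lie g T) I"
  then have "I \<subseteq> T" by (simp add: lie_ideal_def sub_lie_def)
  then show "I = {0} \<or> I = lie_carrier (sub_lie g T)"
    using min[OF ideal_of_sub_lie[OF I]] by (simp add: sub_lie_def)
qed

end

definition minimal_ideal :: "'b set \<Rightarrow> bool" where
  "minimal_ideal T \<longleftrightarrow> lie_ideal g T \<and> T \<subseteq> S \<and> T \<noteq> {0} \<and> (\<forall>I. lie_ideal g I \<and> I \<subseteq> T \<longrightarrow> I = {0} \<or> I = T)"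

text \<open>Peel off a minimal ideal \<open>T\<close> inside \<open>A\<close>; its complement in
  \<open>A\<close> is \<open>A \<inter> orth T\<close>, again an ideal and of smaller
  dimension.\<close>

lemma ideal_decomposition:
  assumes "lie_ideal g A" "A \<subseteq> S"
  shows "\<exists>\<S>. direct_sum_of A \<S> \<and> (\<forall>T\<in>\<S>. minimal_ideal T)"
  using assms
proof (induction "dim A" arbitrary: A rule: less_induct)
  case (less A)
  note AD = idealD[OF less.prems(1)]
  show ?case
  proof (cases "A = {0}")
    case True
    then show ?thesis using direct_sum_of_zero by blast
  next
    case False
    define P where "P T \<longleftrightarrow> lie_ideal g T \<and> T \<subseteq> A \<and> T \<noteq> {0}" for T
    have PA: "P A" using less.prems(1) False by (simp add: P_def)
    have PL: "subspace T \<and> T \<subseteq> L" if "P T" for T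
      using that idealD(1,2) unfolding P_def by blast
    obtain T where PT: "P T" and min: "\<And>U. P U \<Longrightarrow> U \<subseteq> T \<Longrightarrow> U = T"
      using minimal_subspace[where P = P, OF fin PA PL] by blast
    have T: "lie_ideal g T" "T \<subseteq> A" "T \<noteq> {0}" using PT by (auto simp: P_def)
    have TS: "T \<subseteq> S" using T(2) less.prems(2) by blast
    have "I = {0} \<or> I = T" if "lie_ideal g I" "I \<subseteq> T" for I
      using min[of I] that T(2) by (auto simp: P_def)
    then have minT: "minimal_ideal T" using T TS unfolding minimal_ideal_def by blast
    define A' where "A' = A \<inter> orth T"
    have A': "lie_ideal g A'" "A' \<subseteq> S"
      using ideal_Int[OF less.prems(1) orth_ideal[OF T(1)]] less.prems(2) by (auto simp: A'_def)
    note subT = idealD(2)[OF T(1)] and subA' = idealD(2)[OF A'(1)]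
    have TA': "T \<inter> A' = {0}" using Int_orth[OF T(1) TS] T(2) unfolding A'_def by blast
    have "A' \<noteq> A" using TA' T(2,3) subspace_0[OF subT] by blast
    then have "A' \<subset> A" by (auto simp: A'_def)
    then have "dim A' < dim A" using dim_less[OF fin_dim_subspace[OF fin AD(2,1)] subA'] by blast
    then obtain \<S> where \<S>: "direct_sum_of A' \<S>" "\<And>T. T \<in> \<S> \<Longrightarrow> minimal_ideal T"
      using less.hyps A' by blast
    have "direct_sum2 A T A'"
      unfolding direct_sum2_def
    proof
      show "A = {u + w |u w. u \<in> T \<and> w \<in> A'}"
      proof (intro equalityI subsetI)
        fix x assume x: "x \<in> A"
        then obtain u where u: "u \<in> T" "x - u \<in> orth T" using orth_split[OF T(1) TS] less.prems(2) by blast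
        have "x - u \<in> A'" using u x T(2) subspace_diff[OF AD(2)] by (auto simp: A'_def)
        moreover have "x = u + (x - u)" by simp
        ultimately show "x \<in> {u + w |u w. u \<in> T \<and> w \<in> A'}" using u(1) by blast
      next
        fix x assume "x \<in> {u + w |u w. u \<in> T \<and> w \<in> A'}"
        then show "x \<in> A" using T(2) subspace_add[OF AD(2)] by (auto simp: A'_def)
      qed
    qed (rule TA')
    moreover have "0 \<in> U \<and> U \<noteq> {0}" if "U \<in> \<S>" for U
      using \<S>(2)[OF that] idealD(2) subspace_0 unfolding minimal_ideal_def by blast
    ultimately have "direct_sum_of A ({T} \<union> \<S>)"
      using T(3) subspace_0[OF subT]
      by (intro direct_sum_of_union[OF _ subT subA' direct_sum_of_single _ \<S>(1)]) auto
    then show ?thesis using minT \<S>(2) by (intro exI[of _ "{T} \<union> \<S>"]) auto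
  qed
qed

lemma derived_decomposition: "\<exists>\<S>. direct_sum_of S \<S> \<and> (\<forall>T\<in>\<S>. minimal_ideal T)"
  by (rule ideal_decomposition[OF derived_ideal order_refl])

lemma derived_semisimple: "semisimple_lie (sub_lie g S)"
proof -
  obtain \<S> where \<S>: "direct_sum_of S \<S>" "\<And>T. T \<in> \<S> \<Longrightarrow> minimal_ideal T"
    using derived_decomposition by blast
  have "lie_ideal (sub_lie g S) T \<and> simple_lie (sub_lie (sub_lie g S) T)" if "T \<in> \<S>" for T
  proof
    have T: "lie_ideal g T" "T \<subseteq> S" "T \<noteq> {0}" "\<And>I. lie_ideal g I \<Longrightarrow> I \<subseteq> T \<Longrightarrow> I = {0} \<or> I = T"
      using \<S>(2)[OF that] unfolding minimal_ideal_def by blast+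
    show "lie_ideal (sub_lie g S) T"
      using T(1,2) SL by (auto simp: lie_ideal_def sub_lie_def)
    have "simple_lie (sub_lie g T)" by (rule minimal_ideal_simple[OF T])
    then show "simple_lie (sub_lie (sub_lie g S) T)" by (simp add: sub_lie_def)
  qed
  then show ?thesis using \<S>(1) unfolding semisimple_lie_def by (auto simp: sub_lie_def)
qed

section \<open>The adjoint representation of the derived algebra\<close>

abbreviation "g' \<equiv> sub_lie g S"

lemma derived_simps: "lie_carrier g' = S" "lie_scale g' = sc" "lie_bracket g' = br"
  by (simp_all add: sub_lie_def)

lemma fin_lie_derived: "fin_lie g'"
proof
  show "lie_algebra g'"
    using SL br_in_S by (intro lie_algebra_sub_lie[OF lie SL subS]) blast
  show "fin_dim (lie_scale g') (lie_carrier g')"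
    unfolding derived_simps by (rule fin_dim_subspace[OF fin subS SL])
qed

lemma derived_centralizer_zero:
  assumes x: "x \<in> S" and "\<And>w. w \<in> S \<Longrightarrow> br x w = 0"
  shows "x = 0"
proof -
  have xL: "x \<in> L" using x SL by blast
  have "br x y = 0" if y: "y \<in> L" for y
    using br_\<pi>[OF xL y] \<pi>_S[OF x] assms(2)[of "\<pi> y"] \<pi>[OF y] by simp
  then have "x \<in> Z" using xL by (simp add: lie_centre_def)
  then show ?thesis using x centre_Int_derived by blast
qed

lemma ad_derived_apply: "w \<in> S \<Longrightarrow> ad g' x w = br x w"
  by (simp add: ad_def derived_simps)

lemma ad_derived_inj: "inj_on (ad g') S"
proof (rule inj_onI)
  fix x y assume x: "x \<in> S" and y: "y \<in> S" and eq: "ad g' x = ad g' y"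
  have xL: "x \<in> L" and yL: "y \<in> L" using x y SL by blast+
  have "br (x - y) w = 0" if w: "w \<in> S" for w
    using fun_cong[OF eq, of w] w br_diff(1)[OF xL yL, of w] SL by (auto simp: ad_derived_apply)
  then show "x = y" using derived_centralizer_zero[of "x - y"] subspace_diff[OF subS x y] by simp
qed

text \<open>Subrepresentations of the adjoint representation of \<open>g'\<close> are exactly the
  ideals of \<open>g\<close> inside [g, g], since central components act trivially; so minimal
  ideals are irreducible. All results about faithful semisimple representations thus apply once
  more, with the Killing form of \<open>g'\<close> as trace form.\<close>

lemma ad_derived_rep: "faithful_ss_rep g' sc S (ad g')"
proof -
  interpret s: fin_lie g' by (rule fin_lie_derived)
  have rep: "lie_rep g' sc S (ad g')" using s.ad_rep unfolding derived_simps .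
  have "faithful g' (ad g')" unfolding faithful_def derived_simps by (rule ad_derived_inj)
  moreover have "semisimple_rep g' sc S (ad g')"
  proof -
    obtain \<S> where \<S>: "direct_sum_of S \<S>" "\<And>T. T \<in> \<S> \<Longrightarrow> minimal_ideal T"
      using derived_decomposition by blast
    have "irreducible_subrep g' sc S (ad g') T" if "T \<in> \<S>" for T
    proof -
      have T: "lie_ideal g T" "T \<subseteq> S" "T \<noteq> {0}" "\<And>I. lie_ideal g I \<Longrightarrow> I \<subseteq> T \<Longrightarrow> I = {0} \<or> I = T"
        using \<S>(2)[OF that] unfolding minimal_ideal_def by blast+
      have iff: "subrep g' sc S (ad g') U \<longleftrightarrow> lie_ideal g U" if US: "U \<subseteq> S" for U
      proof
        assume U: "subrep g' sc S (ad g') U"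
        have "br x u \<in> U" if x: "x \<in> L" and u: "u \<in> U" for x u
        proof -
          have uS: "u \<in> S" and uL: "u \<in> L" using u US SL by blast+
          have "ad g' (\<pi> x) u \<in> U" using U \<pi>[OF x] u by (simp add: subrep_def derived_simps)
          then show ?thesis using br_\<pi>[OF x uL] \<pi>_S[OF uS] uS by (simp add: ad_derived_apply)
        qed
        then show "lie_ideal g U" using U US SL unfolding lie_ideal_def subrep_def by blast
      next
        assume "lie_ideal g U"
        then show "subrep g' sc S (ad g') U"
          using US SL by (auto simp: subrep_def lie_ideal_def derived_simps ad_def subset_iff)
      qed
      show ?thesis
        unfolding irreducible_subrep_def using iff T by (metis order_trans)
    qed
    then show ?thesis using \<S>(1) unfolding semisimple_rep_def by blast
  qed
  ultimately show ?thesis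
    using rep by (intro faithful_ss_rep.intro fin_rep.intro fin_lie_derived fin_rep_axioms.intro
        faithful_ss_rep_axioms.intro)
qed

subsection \<open>Derivations of the derived algebra\<close>

text \<open>Choose \<open>x\<close> such that \<open>F = D - ad x\<close> is orthogonal to \<open>ad [g, g]\<close> for the trace form on
  \<open>gl([g, g])\<close>. Since \<open>ad (F y) = [F, ad y]\<close>, every \<open>F y\<close> lies in the radical of the Killing form.\<close>

lemma derivation_inner:
  assumes D: "D \<in> lie_carrier (der g')"
  shows "\<exists>x\<in>S. D = ad g' x"
proof -
  interpret K: faithful_ss_rep g' sc S "ad g'" by (rule ad_derived_rep)
  define ps where "ps = (pointwise_scale sc :: _ \<Rightarrow> ('b \<Rightarrow> 'b) \<Rightarrow> _)"
  interpret E: vector_space ps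
    unfolding ps_def by (rule vector_space_pointwise_scale) unfold_locales
  define E where "E = lie_carrier (gl sc S)"
  have subE: "E.subspace E" unfolding E_def ps_def by (rule gl_subspace[OF subS])
  have D_E: "D \<in> E" and leib: "\<And>x y. x \<in> S \<Longrightarrow> y \<in> S \<Longrightarrow> D (br x y) = br (D x) y + br x (D y)"
    using D by (auto simp: der_def sub_lie_def E_def)
  have Elin: "linear_map_on sc S sc S f" if "f \<in> E" for f using that by (simp add: E_def gl_carrier_iff)
  have Eout: "f v = 0" if "f \<in> E" "v \<notin> S" for f v using that by (simp add: E_def gl_carrier_iff)
  note Ein = gl_in_V[OF subS, folded E_def] and E0 = gl_zero[OF subS, folded E_def]
    and Ecomp = gl_comp[OF subS, folded E_def] and Eminus = gl_diff[OF subS, folded E_def]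
  have finS: "fin_dim sc S" by (rule fin_dim_subspace[OF fin subS SL])
  have adE: "ad g' x \<in> E" if "x \<in> S" for x using K.\<rho>_gl[of x] that by (simp add: E_def derived_simps)
  define \<tau> where "\<tau> f h = trace_on sc S (f \<circ> h)" for f h :: "'b \<Rightarrow> 'b"
  have \<tau>_sym: "\<tau> f h = \<tau> h f" if "f \<in> E" "h \<in> E" for f h
    unfolding \<tau>_def by (rule trace_on_comp_commute[OF finS finS Elin[OF that(2)] Elin[OF that(1)]])
  have \<tau>_add: "\<tau> (f + h) k = \<tau> f k + \<tau> h k" if "f \<in> E" "h \<in> E" "k \<in> E" for f h k
  proof -
    have "(f + h) \<circ> k = (\<lambda>v. (f \<circ> k) v + (h \<circ> k) v)" by (simp add: fun_eq_iff)
    then show ?thesis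
      unfolding \<tau>_def using trace_on_add[OF finS Elin[OF Ecomp[OF that(1,3)]] Elin[OF Ecomp[OF that(2,3)]]] by (simp only:)
  qed
  have \<tau>_scale: "\<tau> (ps c f) k = c * \<tau> f k" if "f \<in> E" "k \<in> E" for c f k
  proof -
    have "ps c f \<circ> k = (\<lambda>v. sc c ((f \<circ> k) v))" by (simp add: fun_eq_iff ps_def pointwise_scale_def)
    then show ?thesis
      unfolding \<tau>_def using trace_on_scale[OF finS Elin[OF Ecomp[OF that]]] by (simp only:)
  qed
  have \<tau>_add': "\<tau> k (f + h) = \<tau> k f + \<tau> k h" if "f \<in> E" "h \<in> E" "k \<in> E" for f h k
    using \<tau>_add[OF that] \<tau>_sym that E.subspace_add[OF subE] by simp
  have \<tau>_scale': "\<tau> k (ps c f) = c * \<tau> k f" if "f \<in> E" "k \<in> E" for c f k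
    using \<tau>_scale[OF that] \<tau>_sym that E.subspace_scale[OF subE] by simp
  have \<tau>_diff: "\<tau> (f - h) k = \<tau> f k - \<tau> h k" if "f \<in> E" "h \<in> E" "k \<in> E" for f h k
    using \<tau>_add[OF Eminus[OF that(1,2)] that(2,3)] by simp
  \<comment> \<open>The earlier argument, read in the adjoint representation of \<open>g'\<close>:
    an element orthogonal to the derived algebra of \<open>g'\<close> is central in
    \<open>g'\<close>, and the centre of \<open>g'\<close> is 0.\<close>
  have killing_nondeg: "x = 0" if x: "x \<in> S" "\<And>y. y \<in> S \<Longrightarrow> \<tau> (ad g' x) (ad g' y) = 0" for x
  proof -
    have "K.\<beta> x y = 0" if "y \<in> lie_derived g'" for y
      using x(2)[of y] that K.SL by (auto simp: K.\<beta>_def \<tau>_def derived_simps)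
    then have "x \<in> lie_centre g'" using K.orthogonal_derived_central[of x] x(1) by (simp add: derived_simps)
    then show ?thesis using derived_centralizer_zero[OF x(1)] by (simp add: lie_centre_def derived_simps)
  qed
  have ad_lin: "linear_map_on sc S ps E (ad g')"
    using K.rep by (simp add: lie_rep_def lie_hom_def derived_simps E_def ps_def gl_def[THEN arg_cong[of _ _ lie_scale]])
  \<comment> \<open>For the split only the restriction of \<open>\<tau>\<close> to the inner
    derivations has to be nondegenerate, and there it is the Killing form.\<close>
  have "\<exists>u\<in>ad g' ` S. \<forall>w\<in>ad g' ` S. \<tau> (D - u) w = 0"
  proof (rule E.orthogonal_split[where L = E])
    show "fin_dim ps (ad g' ` S)" by (rule fin_dim_image_on[OF ad_lin E.vector_space_axioms finS])
    show "ad g' ` S \<subseteq> E" using adE by blast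
    show "u = 0" if u: "u \<in> ad g' ` S" "\<And>w. w \<in> ad g' ` S \<Longrightarrow> \<tau> u w = 0" for u
    proof -
      obtain x where x: "x \<in> S" "u = ad g' x" using u(1) by blast
      have "x = 0" by (rule killing_nondeg[OF x(1)]) (use u(2) x(2) in blast)
      then show ?thesis using x(2) K.\<rho>_zero by simp
    qed
  qed (fact \<tau>_add \<tau>_add' \<tau>_scale \<tau>_scale' subE D_E)+
  then obtain x where x: "x \<in> S" "\<And>y. y \<in> S \<Longrightarrow> \<tau> (D - ad g' x) (ad g' y) = 0" by blast
  define F where "F = D - ad g' x"
  have FE: "F \<in> E" unfolding F_def by (rule Eminus[OF D_E adE[OF x(1)]])
  have xL: "x \<in> L" using x(1) SL by blast
  have F_leib: "F (br y w) = br (F y) w + br y (F w)" if y: "y \<in> S" and w: "w \<in> S" for y w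
  proof -
    have yL: "y \<in> L" and wL: "w \<in> L" using y w SL by blast+
    have DL: "D y \<in> L" "D w \<in> L" using Ein[OF D_E] SL by blast+
    have "F (br y w) = D (br y w) - br x (br y w)"
      using br_in_S[OF yL wL] by (simp add: F_def ad_derived_apply)
    also have "\<dots> = br (D y) w + br y (D w) - (br (br x y) w + br y (br x w))"
      using leib[OF y w] jacobi[OF xL yL wL] by simp
    also have "\<dots> = br (D y - br x y) w + br y (D w - br x w)"
      using yL wL xL DL br_in by (simp add: br_diff)
    finally show ?thesis using y w by (simp add: F_def ad_derived_apply)
  qed
  have "F y = 0" if y: "y \<in> S" for y
  proof (rule killing_nondeg[OF Ein[OF FE]])
    fix w assume w: "w \<in> S"
    have yL: "y \<in> L" and wL: "w \<in> L" using y w SL by blast+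
    note a = adE[OF y] and b = adE[OF w]
    have "ad g' (F y) = (F \<circ> ad g' y) - (ad g' y \<circ> F)"
    proof
      fix v show "ad g' (F y) v = ((F \<circ> ad g' y) - (ad g' y \<circ> F)) v"
      proof (cases "v \<in> S")
        case True
        then show ?thesis using F_leib[OF y True] Ein[OF FE] by (simp add: ad_derived_apply)
      next
        case False
        then show ?thesis
          using Eout[OF adE[OF Ein[OF FE]]] Eout[OF FE] Eout[OF a] E0[OF FE] E0[OF a] by simp
      qed
    qed
    \<comment> \<open>Cyclicity shifts the commutator from \<open>F\<close> and
      \<open>ad g' y\<close> to the two inner derivations, whose commutator is again inner;
      \<open>F\<close> was chosen orthogonal to it.\<close>
    then have "\<tau> (ad g' (F y)) (ad g' w) = \<tau> (F \<circ> ad g' y) (ad g' w) - \<tau> (ad g' y \<circ> F) (ad g' w)"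
      using \<tau>_diff[OF Ecomp[OF FE a] Ecomp[OF a FE] b] by simp
    also have "\<tau> (F \<circ> ad g' y) (ad g' w) = \<tau> (ad g' y \<circ> ad g' w) F"
      using \<tau>_sym[OF FE Ecomp[OF a b]] by (simp add: \<tau>_def comp_assoc)
    also have "\<tau> (ad g' y \<circ> F) (ad g' w) = \<tau> (ad g' w \<circ> ad g' y) F"
      using \<tau>_sym[OF Ecomp[OF a FE] b] by (simp add: \<tau>_def comp_assoc)
    also have "\<tau> (ad g' y \<circ> ad g' w) F - \<tau> (ad g' w \<circ> ad g' y) F = \<tau> ((ad g' y \<circ> ad g' w) - (ad g' w \<circ> ad g' y)) F"
      using \<tau>_diff[OF Ecomp[OF a b] Ecomp[OF b a] FE] by simp
    also have "(ad g' y \<circ> ad g' w) - (ad g' w \<circ> ad g' y) = ad g' (br y w)"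
      using K.\<rho>_br[of y w] y w by (simp add: derived_simps)
    also have "\<tau> (ad g' (br y w)) F = \<tau> F (ad g' (br y w))"
      by (rule \<tau>_sym[OF adE[OF br_in_S[OF yL wL]] FE])
    also have "\<dots> = 0" unfolding F_def by (rule x(2)[OF br_in_S[OF yL wL]])
    finally show "\<tau> (ad g' (F y)) (ad g' w) = 0" .
  qed
  then have "F = 0" using Eout[OF FE] by (auto simp: fun_eq_iff)
  then have "D = ad g' x" by (simp add: F_def)
  then show ?thesis using x(1) by blast
qed

end

section \<open>Transport of semisimplicity\<close>

lemma direct_sum_of_image:
  assumes vs: "vector_space s" "vector_space t" and V: "module.subspace s V"
    and \<phi>: "linear_map_on s V t W \<phi>" and inj: "inj_on \<phi> V"
    and ds: "direct_sum_of V \<S>" and sub: "\<And>T. T \<in> \<S> \<Longrightarrow> T \<subseteq> V"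
  shows "direct_sum_of (\<phi> ` V) ((`) \<phi> ` \<S>)"
proof -
  interpret s: vector_space s by fact
  have fin: "finite \<S>" and V_eq: "V = {sum f \<S> | f. \<forall>W\<in>\<S>. f W \<in> W}"
    and ind: "\<And>f. \<forall>W\<in>\<S>. f W \<in> W \<Longrightarrow> sum f \<S> = 0 \<Longrightarrow> \<forall>W\<in>\<S>. f W = 0"
    using ds unfolding direct_sum_of_def by blast+
  have \<phi>0: "\<phi> 0 = 0" by (rule s.linear_map_on_zero[OF \<phi> V vs(2)])
  have \<phi>_sum: "\<phi> (sum h \<S>) = (\<Sum>T\<in>\<S>. \<phi> (h T))" if "\<forall>T\<in>\<S>. h T \<in> T" for h
    by (rule s.linear_map_on_sum[OF \<phi> V vs(2)]) (use that sub in blast)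
  have injS: "inj_on ((`) \<phi>) \<S>"
    using sub inj by (intro inj_onI) (metis inj_on_image_eq_iff)
  have pull: "\<exists>h. (\<forall>T\<in>\<S>. h T \<in> T \<and> f (\<phi> ` T) = \<phi> (h T)) \<and> sum f ((`) \<phi> ` \<S>) = \<phi> (sum h \<S>)"
    if f: "\<forall>T\<in>(`) \<phi> ` \<S>. f T \<in> T" for f
  proof -
    have "\<forall>T\<in>\<S>. \<exists>w. w \<in> T \<and> f (\<phi> ` T) = \<phi> w" using f by auto
    then obtain h where h: "\<forall>T\<in>\<S>. h T \<in> T \<and> f (\<phi> ` T) = \<phi> (h T)" by metis
    then have "sum f ((`) \<phi> ` \<S>) = \<phi> (sum h \<S>)"
      using injS \<phi>_sum[of h] by (simp add: sum.reindex)
    with h show ?thesis by blast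
  qed
  show ?thesis
    unfolding direct_sum_of_def
  proof (intro conjI allI impI)
    show "finite ((`) \<phi> ` \<S>)" using fin by simp
    show "\<phi> ` V = {sum f ((`) \<phi> ` \<S>) |f. \<forall>W\<in>(`) \<phi> ` \<S>. f W \<in> W}"
    proof (intro equalityI subsetI)
      fix w assume "w \<in> \<phi> ` V"
      then obtain f where f: "\<forall>W\<in>\<S>. f W \<in> W" "w = \<phi> (sum f \<S>)" using V_eq by blast
      let ?f = "\<lambda>U. \<phi> (f (inv_into \<S> ((`) \<phi>) U))"
      have "sum ?f ((`) \<phi> ` \<S>) = w"
        using f injS \<phi>_sum[of f] by (simp add: sum.reindex)
      moreover have "\<forall>W\<in>(`) \<phi> ` \<S>. ?f W \<in> W" using f injS by simp
      ultimately show "w \<in> {sum f ((`) \<phi> ` \<S>) |f. \<forall>W\<in>(`) \<phi> ` \<S>. f W \<in> W}" by blast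
    next
      fix w assume "w \<in> {sum f ((`) \<phi> ` \<S>) |f. \<forall>W\<in>(`) \<phi> ` \<S>. f W \<in> W}"
      then obtain f where "\<forall>W\<in>(`) \<phi> ` \<S>. f W \<in> W" "w = sum f ((`) \<phi> ` \<S>)" by blast
      with pull obtain h where "\<forall>W\<in>\<S>. h W \<in> W" "w = \<phi> (sum h \<S>)" by metis
      then show "w \<in> \<phi> ` V" using V_eq by blast
    qed
    fix f assume f: "(\<forall>W\<in>(`) \<phi> ` \<S>. f W \<in> W) \<and> sum f ((`) \<phi> ` \<S>) = 0"
    then obtain h where h: "\<forall>W\<in>\<S>. h W \<in> W \<and> f (\<phi> ` W) = \<phi> (h W)" "\<phi> (sum h \<S>) = 0"
      using pull[of f] by auto
    have "sum h \<S> \<in> V" using h V_eq by blast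
    then have "sum h \<S> = 0"
      using h(2) inj_onD[OF inj, of "sum h \<S>" 0] \<phi>0 s.subspace_0[OF V] by simp
    then have "\<forall>W\<in>\<S>. h W = 0" using ind[of h] h(1) by blast
    then show "\<forall>W\<in>(`) \<phi> ` \<S>. f W = 0" using h(1) \<phi>0 by auto
  qed
qed

text \<open>The simple ideals are mapped forward; for the simplicity of an image, its ideals are
  pulled back along \<open>\<phi>\<close>.\<close>

lemma semisimple_lie_transport:
  assumes g: "lie_algebra g" and h: "vector_space (lie_scale h)"
    and hom: "lie_hom g h \<phi>" and bij: "bij_betw \<phi> (lie_carrier g) (lie_carrier h)"
    and ss: "semisimple_lie g"
  shows "semisimple_lie h"
proof -
  interpret s: vector_space "lie_scale g" using g by (simp add: lie_algebra_def)
  interpret t: vector_space "lie_scale h" by (rule h)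
  let ?L = "lie_carrier g"
  have subL: "s.subspace ?L" using g by (simp add: lie_algebra_def)
  have lin: "linear_map_on (lie_scale g) ?L (lie_scale h) (lie_carrier h) \<phi>"
    and br: "\<And>x y. x \<in> ?L \<Longrightarrow> y \<in> ?L \<Longrightarrow> \<phi> (lie_bracket g x y) = lie_bracket h (\<phi> x) (\<phi> y)"
    using hom by (auto simp: lie_hom_def)
  have inj: "inj_on \<phi> ?L" and im: "\<phi> ` ?L = lie_carrier h" using bij by (auto simp: bij_betw_def)
  have \<phi>0: "\<phi> 0 = 0" by (rule s.linear_map_on_zero[OF lin subL h])
  obtain \<S> where \<S>: "direct_sum_of ?L \<S>" "\<And>T. T \<in> \<S> \<Longrightarrow> lie_ideal g T"
      "\<And>T. T \<in> \<S> \<Longrightarrow> simple_lie (sub_lie g T)"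
    using ss unfolding semisimple_lie_def by blast
  have ideal: "T \<subseteq> ?L" "s.subspace T" "\<And>x y. x \<in> ?L \<Longrightarrow> y \<in> T \<Longrightarrow> lie_bracket g x y \<in> T" if "T \<in> \<S>" for T
    using \<S>(2)[OF that] unfolding lie_ideal_def by blast+
  have "lie_ideal h (\<phi> ` T) \<and> simple_lie (sub_lie h (\<phi> ` T))" if T: "T \<in> \<S>" for T
  proof
    note TL = ideal(1)[OF T] and subT = ideal(2)[OF T]
    show "lie_ideal h (\<phi> ` T)"
      unfolding lie_ideal_def
    proof (intro conjI ballI)
      show "\<phi> ` T \<subseteq> lie_carrier h" using TL im by blast
      show "t.subspace (\<phi> ` T)" by (rule s.subspace_image_on[OF lin h subL subT TL])
      fix x y assume "x \<in> lie_carrier h" "y \<in> \<phi> ` T"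
      then obtain x' y' where "x' \<in> ?L" "x = \<phi> x'" "y' \<in> T" "y = \<phi> y'" using im by blast
      then have "lie_bracket h x y = \<phi> (lie_bracket g x' y')" "lie_bracket g x' y' \<in> T"
        using br TL ideal(3)[OF T] by auto
      then show "lie_bracket h x y \<in> \<phi> ` T" by blast
    qed
    have simple: "\<not> lie_abelian (sub_lie g T)" "\<And>I. lie_ideal (sub_lie g T) I \<Longrightarrow> I = {0} \<or> I = T"
      using \<S>(3)[OF T] by (auto simp: simple_lie_def sub_lie_def)
    show "simple_lie (sub_lie h (\<phi> ` T))"
      unfolding simple_lie_def
    proof (intro conjI allI impI notI)
      assume ab: "lie_abelian (sub_lie h (\<phi> ` T))"
      obtain x y where xy: "x \<in> T" "y \<in> T" "lie_bracket g x y \<noteq> 0"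
        using simple(1) by (auto simp: lie_abelian_def sub_lie_def)
      then have L: "x \<in> ?L" "y \<in> ?L" using TL by blast+
      have "\<phi> (lie_bracket g x y) = \<phi> 0" using ab xy br[OF L] \<phi>0 by (simp add: lie_abelian_def sub_lie_def)
      moreover have "lie_bracket g x y \<in> ?L" using ideal(3)[OF T L(1) xy(2)] TL by blast
      ultimately show False using inj_onD[OF inj] s.subspace_0[OF subL] xy(3) by blast
    next
      fix I assume "lie_ideal (sub_lie h (\<phi> ` T)) I"
      then have I: "I \<subseteq> \<phi> ` T" "t.subspace I" "\<And>x y. x \<in> \<phi> ` T \<Longrightarrow> y \<in> I \<Longrightarrow> lie_bracket h x y \<in> I"
        by (auto simp: lie_ideal_def sub_lie_def)
      define J where "J = {x \<in> T. \<phi> x \<in> I}"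
      have imJ: "\<phi> ` J = I" using I(1) unfolding J_def by blast
      have add: "\<phi> (x + y) = \<phi> x + \<phi> y" and scl: "\<phi> (lie_scale g c x) = lie_scale h c (\<phi> x)"
        if "x \<in> T" "y \<in> T" for x y c
        using lin that TL by (auto simp: linear_map_on_def subset_iff)
      have "lie_ideal (sub_lie g T) J"
        unfolding lie_ideal_def
      proof (intro conjI ballI)
        have "s.subspace J"
          by (rule s.subspaceI)
            (auto simp: J_def \<phi>0 add scl s.subspace_0[OF subT] s.subspace_add[OF subT] s.subspace_scale[OF subT]
              t.subspace_0[OF I(2)] t.subspace_add[OF I(2)] t.subspace_scale[OF I(2)])
        then show "module.subspace (lie_scale (sub_lie g T)) J" by (simp add: sub_lie_def)
        fix x y assume "x \<in> lie_carrier (sub_lie g T)" and y: "y \<in> J"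
        then have x: "x \<in> T" by (simp add: sub_lie_def)
        have L: "x \<in> ?L" "y \<in> ?L" using x y TL by (auto simp: J_def)
        have "lie_bracket g x y \<in> T" using ideal(3)[OF T L(1)] y by (simp add: J_def)
        moreover have "\<phi> (lie_bracket g x y) \<in> I" using I(3) br[OF L] x y by (simp add: J_def)
        ultimately show "lie_bracket (sub_lie g T) x y \<in> J" by (simp add: J_def sub_lie_def)
      qed (auto simp: J_def sub_lie_def)
      then have "J = {0} \<or> J = T" by (rule simple(2))
      then show "I = {0} \<or> I = lie_carrier (sub_lie h (\<phi> ` T))"
        using imJ \<phi>0 by (auto simp: sub_lie_def)
    qed
  qed
  moreover have "direct_sum_of (lie_carrier h) ((`) \<phi> ` \<S>)"
    unfolding im[symmetric]
    by (rule direct_sum_of_image[OF s.vector_space_axioms h subL lin inj \<S>(1) ideal(1)])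
  ultimately show ?thesis unfolding semisimple_lie_def by (intro exI[of _ "(`) \<phi> ` \<S>"]) auto
qed

section \<open>Reductive Lie algebras\<close>

lemma der_carrier:
  "lie_carrier (der h) = {D \<in> lie_carrier (gl (lie_scale h) (lie_carrier h)). \<forall>x\<in>lie_carrier h. \<forall>y\<in>lie_carrier h.
     D (lie_bracket h x y) = lie_bracket h (D x) y + lie_bracket h x (D y)}"
  by (simp add: der_def sub_lie_def)

lemma der_ops:
  "lie_scale (der h) = pointwise_scale (lie_scale h)" "lie_bracket (der h) = (\<lambda>f k. (f \<circ> k) - (k \<circ> f))"
  by (simp_all add: der_def sub_lie_def gl_def)

lemma ad_lie_ops:
  "lie_carrier (ad_lie h) = ad h ` lie_carrier h" "lie_scale (ad_lie h) = pointwise_scale (lie_scale h)"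
  "lie_bracket (ad_lie h) = (\<lambda>f k. (f \<circ> k) - (k \<circ> f))"
  by (simp_all add: ad_lie_def der_def sub_lie_def gl_def)

lemma (in fin_lie) ad_in_der: "x \<in> L \<Longrightarrow> ad g x \<in> lie_carrier (der g)"
proof -
  assume x: "x \<in> L"
  interpret A: fin_rep g sc L "ad g" by (rule rep_imp_fin_rep[OF ad_rep])
  have "ad g x (br y z) = br (ad g x y) z + br y (ad g x z)" if "y \<in> L" "z \<in> L" for y z
    using jacobi[OF x that] that x by (simp add: ad_def br_in)
  then show ?thesis using A.\<rho>_gl[OF x] by (simp add: der_carrier)
qed

context faithful_ss_rep
begin

lemma direct_sum_centre_derived: "direct_sum2 L Z S"
  unfolding direct_sum2_def
proof
  show "L = {z + y |z y. z \<in> Z \<and> y \<in> S}"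
  proof (intro equalityI subsetI)
    fix x assume "x \<in> L"
    then show "x \<in> {z + y |z y. z \<in> Z \<and> y \<in> S}" by (rule centre_plus_derived) blast
  next
    fix x assume "x \<in> {z + y |z y. z \<in> Z \<and> y \<in> S}"
    then show "x \<in> L" using ZL SL subspace_add[OF subL] by auto
  qed
qed (rule centre_Int_derived)

lemma ad_\<pi>: "x \<in> L \<Longrightarrow> ad g x = ad g (\<pi> x)"
proof -
  assume x: "x \<in> L"
  have \<pi>x: "\<pi> x \<in> S" "\<pi> x \<in> L" using \<pi>[OF x] SL by blast+
  have "br x y = br (\<pi> x) y" if "y \<in> L" for y
    using br_\<pi>[OF x that] br_\<pi>[OF \<pi>x(2) that] \<pi>_S[OF \<pi>x(1)] by simp
  then show ?thesis by (auto simp: ad_def)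
qed

text \<open>This links the adjoint representations of \<open>g\<close> and \<open>g'\<close>. The
  injectivity claims below reduce through it to the injectivity of \<open>ad g'\<close> on
  [g, g].\<close>

lemma ad_restrict:
  assumes "x \<in> L"
  shows "(\<lambda>v. if v \<in> S then ad g x v else 0) = ad g' (\<pi> x)"
proof
  fix v show "(if v \<in> S then ad g x v else 0) = ad g' (\<pi> x) v"
  proof (cases "v \<in> S")
    case True
    then have "v \<in> L" using SL by blast
    then show ?thesis using True br_\<pi>[OF assms] \<pi>_S[OF True] by (simp add: ad_def derived_simps)
  qed (simp add: ad_def derived_simps)
qed

lemma ad_hom_derived: "lie_hom g' (ad_lie g) (ad g)"
proof -
  interpret A: fin_rep g sc L "ad g" by (rule rep_imp_fin_rep[OF ad_rep])
  show ?thesis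
    unfolding lie_hom_def linear_map_on_def derived_simps ad_lie_ops
    using SL A.\<rho>_add A.\<rho>_scale A.\<rho>_br by (auto simp: pointwise_scale_def subset_iff)
qed

lemma ad_bij_derived: "bij_betw (ad g) S (lie_carrier (ad_lie g))"
  unfolding bij_betw_def ad_lie_ops
proof
  show "inj_on (ad g) S"
  proof (rule inj_onI)
    fix x y assume x: "x \<in> S" and y: "y \<in> S" and "ad g x = ad g y"
    then have "ad g' (\<pi> x) = ad g' (\<pi> y)" using ad_restrict SL by (metis subsetD)
    then show "x = y" using ad_derived_inj \<pi>_S x y by (auto dest: inj_onD)
  qed
  show "ad g ` S = ad g ` L" using SL ad_\<pi> \<pi> by (auto simp: image_iff)
qed

text \<open>By the Leibniz rule \<open>D\<close> preserves [g, g], where it is inner, given by some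
  \<open>x\<close>. Then \<open>D\<close> and \<open>ad g x\<close> agree on [g, g] and both vanish
  on the centre, and these two subspaces span \<open>g\<close>.\<close>

lemma derivation_extends:
  assumes D: "D \<in> lie_carrier (der g)" and DZ: "\<And>z. z \<in> Z \<Longrightarrow> D z = 0"
  shows "D \<in> ad g ` L"
proof -
  have lin: "linear_map_on sc L sc L D" and out: "\<And>v. v \<notin> L \<Longrightarrow> D v = 0"
    and leib: "\<And>x y. x \<in> L \<Longrightarrow> y \<in> L \<Longrightarrow> D (br x y) = br (D x) y + br x (D y)"
    using D by (auto simp: der_carrier gl_carrier_iff)
  have DL: "D x \<in> L" if "x \<in> L" for x using lin that by (simp add: linear_map_on_def)
  have DS: "D x \<in> S" if "x \<in> S" for x
  proof -
    have "x \<in> commutator L" using that by (simp add: derived_eq)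
    then obtain I :: "'b set" and a b where ab: "finite I" "x = (\<Sum>i\<in>I. br (a i) (b i))"
        "\<And>i. i \<in> I \<Longrightarrow> a i \<in> L" "\<And>i. i \<in> I \<Longrightarrow> b i \<in> L"
      using commutator_sum[OF subL order_refl] by blast
    have "D x = (\<Sum>i\<in>I. D (br (a i) (b i)))"
      unfolding ab(2) by (rule linear_map_on_sum[OF lin subL vector_space_axioms]) (use ab br_in in blast)
    also have "\<dots> \<in> S"
      using ab(3,4) br_in_S DL by (intro subspace_sum[OF subS]) (simp add: leib subspace_add[OF subS])
    finally show ?thesis .
  qed
  define R where "R = (\<lambda>v. if v \<in> S then D v else 0)"
  have "R \<in> lie_carrier (der g')"
    unfolding der_carrier derived_simps gl_carrier_iff
    using lin leib DS SL br_in_S subspace_add[OF subS] subspace_scale[OF subS]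
    by (auto simp: R_def linear_map_on_def subset_iff)
  then obtain x where x: "x \<in> S" "R = ad g' x" using derivation_inner by blast
  have xL: "x \<in> L" using x(1) SL by blast
  have "D y = ad g x y" for y
  proof (cases "y \<in> L")
    case True
    have \<pi>y: "\<pi> y \<in> S" "\<pi> y \<in> L" "y - \<pi> y \<in> Z" using \<pi>[OF True] SL by blast+
    have "D y - D (\<pi> y) = 0" using linear_map_on_diff[OF lin subL True \<pi>y(2)] DZ[OF \<pi>y(3)] by simp
    moreover have "D (\<pi> y) = br x (\<pi> y)"
      using fun_cong[OF x(2), of "\<pi> y"] \<pi>y(1) by (simp add: R_def ad_derived_apply)
    ultimately show ?thesis using br_\<pi>[OF xL True] \<pi>_S[OF x(1)] True by (simp add: ad_def)
  qed (simp add: out ad_def)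
  then have "D = ad g x" by (rule ext)
  then show ?thesis using xL by blast
qed

lemma ad_carrier_eq: "lie_carrier (ad_lie g) = {D \<in> lie_carrier (der g). \<forall>z\<in>Z. D z = 0}"
  unfolding ad_lie_ops
proof (intro equalityI subsetI)
  fix D assume "D \<in> ad g ` L"
  then obtain x where x: "x \<in> L" "D = ad g x" by blast
  then have "D z = 0" if "z \<in> Z" for z using centreD(2,3)[OF that] x by (simp add: ad_def)
  then show "D \<in> {D \<in> lie_carrier (der g). \<forall>z\<in>Z. D z = 0}" using ad_in_der x by simp
qed (use derivation_extends in blast)

lemma restrict_hom: "lie_hom (ad_lie g) (der g') (\<lambda>D v. if v \<in> S then D v else 0)"
proof -
  interpret s: fin_lie g' by (rule fin_lie_derived)
  have in_der: "(\<lambda>v. if v \<in> S then f v else 0) \<in> lie_carrier (der g')" if f: "f \<in> ad g ` L" for f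
  proof -
    obtain x where x: "x \<in> L" "f = ad g x" using f by blast
    show ?thesis
      unfolding x(2) ad_restrict[OF x(1)] using s.ad_in_der[of "\<pi> x"] \<pi>[OF x(1)] by (simp add: derived_simps)
  qed
  have inS: "f v \<in> S" if f: "f \<in> ad g ` L" and v: "v \<in> S" for f v
  proof -
    obtain x where "x \<in> L" "f = ad g x" using f by blast
    then show ?thesis using br_in_S v SL by (auto simp: ad_def)
  qed
  have zero: "f 0 = 0" if "f \<in> ad g ` L" for f
    using that br_zero(1) by (auto simp: ad_def)
  show ?thesis
    unfolding lie_hom_def linear_map_on_def ad_lie_ops der_ops derived_simps
  proof (intro conjI ballI allI)
    fix f h assume f: "f \<in> ad g ` L" and h: "h \<in> ad g ` L"
    show "(\<lambda>v. if v \<in> S then ((f \<circ> h) - (h \<circ> f)) v else 0) =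
        ((\<lambda>v. if v \<in> S then f v else 0) \<circ> (\<lambda>v. if v \<in> S then h v else 0)) -
        ((\<lambda>v. if v \<in> S then h v else 0) \<circ> (\<lambda>v. if v \<in> S then f v else 0))"
      using inS[OF f] inS[OF h] zero[OF f] zero[OF h] by (simp add: fun_eq_iff)
  qed (use in_der in \<open>auto simp: fun_eq_iff pointwise_scale_def\<close>)
qed

text \<open>Restriction takes \<open>ad g x\<close> to \<open>ad g' (\<pi> x)\<close>. It is
  injective since \<open>\<pi> x\<close> determines \<open>ad g x\<close>, and surjective since
  every derivation of \<open>g'\<close> is inner.\<close>

lemma restrict_bij: "bij_betw (\<lambda>D v. if v \<in> S then D v else 0) (lie_carrier (ad_lie g)) (lie_carrier (der g'))"
  unfolding bij_betw_def ad_lie_ops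
proof
  interpret s: fin_lie g' by (rule fin_lie_derived)
  let ?R = "\<lambda>D v. if v \<in> S then D v else (0 :: 'b)"
  have R: "?R (ad g x) = ad g' (\<pi> x)" if "x \<in> L" for x by (rule ad_restrict[OF that])
  show "inj_on ?R (ad g ` L)"
  proof (rule inj_onI)
    fix f h assume "f \<in> ad g ` L" "h \<in> ad g ` L" and eq: "?R f = ?R h"
    then obtain x y where xy: "x \<in> L" "f = ad g x" "y \<in> L" "h = ad g y" by blast
    have "ad g' (\<pi> x) = ad g' (\<pi> y)" using eq R[OF xy(1)] R[OF xy(3)] unfolding xy(2,4) by simp
    then have "\<pi> x = \<pi> y" using ad_derived_inj \<pi>[OF xy(1)] \<pi>[OF xy(3)] by (auto dest: inj_onD)
    then show "f = h" using ad_\<pi>[OF xy(1)] ad_\<pi>[OF xy(3)] xy(2,4) by simp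
  qed
  show "?R ` ad g ` L = lie_carrier (der g')"
  proof (intro equalityI subsetI)
    fix D assume "D \<in> ?R ` ad g ` L"
    then obtain x where "x \<in> L" "D = ad g' (\<pi> x)" using R by auto
    then show "D \<in> lie_carrier (der g')" using s.ad_in_der[of "\<pi> x"] \<pi>[of x] by (simp add: derived_simps)
  next
    fix D assume "D \<in> lie_carrier (der g')"
    then obtain x where x: "x \<in> S" "D = ad g' x" using derivation_inner by blast
    then have "D = ?R (ad g x)" using R[of x] SL \<pi>_S[of x] by auto
    then show "D \<in> ?R ` ad g ` L" using x(1) SL by blast
  qed
qed

lemma reductive_structure:
  "direct_sum2 L Z S" "g' \<cong>\<^sub>L ad_lie g" "ad_lie g \<cong>\<^sub>L der g'"
  "semisimple_lie g'" "semisimple_lie (ad_lie g)" "semisimple_lie (der g')"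
proof -
  interpret s: fin_lie g' by (rule fin_lie_derived)
  interpret A: fin_rep g sc L "ad g" by (rule rep_imp_fin_rep[OF ad_rep])
  show "direct_sum2 L Z S" by (rule direct_sum_centre_derived)
  show "g' \<cong>\<^sub>L ad_lie g" unfolding lie_isomorphic_def using ad_hom_derived ad_bij_derived by (auto simp: derived_simps)
  show "ad_lie g \<cong>\<^sub>L der g'" unfolding lie_isomorphic_def using restrict_hom restrict_bij by blast
  show ss: "semisimple_lie g'" by (rule derived_semisimple)
  have vs: "vector_space (pointwise_scale sc :: _ \<Rightarrow> ('b \<Rightarrow> 'b) \<Rightarrow> _)"
    by (rule vector_space_pointwise_scale) unfold_locales
  show ss_ad: "semisimple_lie (ad_lie g)"
    by (rule semisimple_lie_transport[OF s.lie _ ad_hom_derived _ ss])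
      (use vs ad_bij_derived in \<open>simp_all add: derived_simps ad_lie_ops\<close>)
  have "lie_algebra (ad_lie g)"
    unfolding ad_lie_def
  proof (rule lie_algebra_sub_lie[OF lie_algebra_der[OF lie]])
    show "ad g ` L \<subseteq> lie_carrier (der g)" using ad_in_der by blast
    have lin: "linear_map_on sc L (pointwise_scale sc) UNIV (ad g)"
      using A.\<rho>_add A.\<rho>_scale by (auto simp: linear_map_on_def pointwise_scale_def)
    show "module.subspace (lie_scale (der g)) (ad g ` L)"
      unfolding der_ops by (rule subspace_image_on[OF lin vs subL subL order_refl])
    fix f h assume "f \<in> ad g ` L" "h \<in> ad g ` L"
    then show "lie_bracket (der g) f h \<in> ad g ` L"
      unfolding der_ops using A.\<rho>_br br_in by (auto simp: image_iff) (metis)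
  qed
  then show "semisimple_lie (der g')"
    by (rule semisimple_lie_transport[OF _ _ restrict_hom restrict_bij ss_ad]) (use vs in \<open>simp add: der_ops derived_simps\<close>)
qed

end

theorem theorem2p20:
  fixes g :: "('f::field_char_0, 'g::ab_group_add) lie"
  assumes "lie_algebra g"
    and "fin_dim (lie_scale g) (lie_carrier g)"
  shows "(reductive g \<longleftrightarrow> (\<exists>\<beta>. trace_form g \<beta> \<and> nondegenerate g \<beta>)) \<and>
         (reductive g \<longrightarrow>
            direct_sum2 (lie_carrier g) (lie_centre g) (lie_derived g)
          \<and> (\<forall>\<beta>. trace_form g \<beta> \<and> nondegenerate g \<beta> \<longrightarrow>
               (\<forall>z\<in>lie_centre g. \<forall>x\<in>lie_derived g. \<beta> z x = 0))
          \<and> sub_lie g (lie_derived g) \<cong>\<^sub>L ad_lie g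
          \<and> lie_carrier (ad_lie g) = {D \<in> lie_carrier (der g). \<forall>z\<in>lie_centre g. D z = 0}
          \<and> ad_lie g \<cong>\<^sub>L der (sub_lie g (lie_derived g))
          \<and> semisimple_lie (sub_lie g (lie_derived g))
          \<and> semisimple_lie (ad_lie g)
          \<and> semisimple_lie (der (sub_lie g (lie_derived g))))"
proof (intro conjI impI iffI allI ballI)
  interpret G: fin_lie g using assms by unfold_locales
  have faithful_ss: "\<exists>V \<rho>. faithful_ss_rep g seq_scale V \<rho>" if red: "reductive g"
  proof -
    obtain V \<rho> where "lie_rep g seq_scale V \<rho>" "faithful g \<rho>" "semisimple_rep g seq_scale V \<rho>"
      using red unfolding reductive_def by blast
    then show ?thesis
      using faithful_ss_rep.intro[OF G.rep_imp_fin_rep] faithful_ss_rep_axioms.intro by blast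
  qed
  {
    assume "reductive g"
    then obtain V \<rho> where "faithful_ss_rep g seq_scale V \<rho>" using faithful_ss by blast
    then interpret faithful_ss_rep g seq_scale V \<rho> .
    show "\<exists>\<beta>. trace_form g \<beta> \<and> nondegenerate g \<beta>" by (rule nondegenerate_trace_form_exists)
    show "direct_sum2 (lie_carrier g) (lie_centre g) (lie_derived g)"
      "sub_lie g (lie_derived g) \<cong>\<^sub>L ad_lie g"
      "ad_lie g \<cong>\<^sub>L der (sub_lie g (lie_derived g))"
      "semisimple_lie (sub_lie g (lie_derived g))"
      "semisimple_lie (ad_lie g)"
      "semisimple_lie (der (sub_lie g (lie_derived g)))"
      by (rule reductive_structure)+
    show "lie_carrier (ad_lie g) = {D \<in> lie_carrier (der g). \<forall>z\<in>lie_centre g. D z = 0}"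
      by (rule ad_carrier_eq)
  }
  {
    fix \<beta> z x assume \<beta>: "trace_form g \<beta> \<and> nondegenerate g \<beta>"
      and z: "z \<in> lie_centre g" and x: "x \<in> lie_derived g"
    obtain V \<rho> where \<rho>: "lie_rep g seq_scale V \<rho>"
        "\<And>x y. x \<in> lie_carrier g \<Longrightarrow> y \<in> lie_carrier g \<Longrightarrow> \<beta> x y = trace_on seq_scale V (\<rho> x \<circ> \<rho> y)"
      using \<beta> unfolding trace_form_def by blast
    \<comment> \<open>The form is arbitrary here, so the representation that defines it is taken,
      not the faithful semisimple one.\<close>
    interpret R: fin_rep g seq_scale V \<rho> by (rule G.rep_imp_fin_rep[OF \<rho>(1)])
    have "z \<in> lie_carrier g" "x \<in> lie_carrier g"
      using z x G.centreD(3) G.idealD(1)[OF G.derived_ideal] by blast+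
    then show "\<beta> z x = 0" using \<rho>(2) R.centre_orthogonal_derived[OF z x] by (simp add: R.\<beta>_def)
  }
  assume "\<exists>\<beta>. trace_form g \<beta> \<and> nondegenerate g \<beta>"
  then obtain \<beta> V \<rho> where nd: "nondegenerate g \<beta>" and \<rho>: "lie_rep g seq_scale V \<rho>"
      "\<And>x y. x \<in> lie_carrier g \<Longrightarrow> y \<in> lie_carrier g \<Longrightarrow> \<beta> x y = trace_on seq_scale V (\<rho> x \<circ> \<rho> y)"
    unfolding trace_form_def by blast
  obtain \<rho>' where \<rho>': "lie_rep g seq_scale V \<rho>'" "semisimple_rep g seq_scale V \<rho>'"
      "\<And>x y. x \<in> lie_carrier g \<Longrightarrow> y \<in> lie_carrier g \<Longrightarrow>
        trace_on seq_scale V (\<rho>' x \<circ> \<rho>' y) = trace_on seq_scale V (\<rho> x \<circ> \<rho> y)"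
    using G.semisimplification[OF \<rho>(1)] by blast
  interpret R: fin_rep g seq_scale V \<rho>' by (rule G.rep_imp_fin_rep[OF \<rho>'(1)])
  have "faithful g \<rho>'"
    unfolding faithful_def
  proof (rule inj_onI)
    fix x y assume x: "x \<in> lie_carrier g" and y: "y \<in> lie_carrier g" and eq: "\<rho>' x = \<rho>' y"
    have d: "x - y \<in> lie_carrier g" using G.subspace_diff[OF G.subL x y] .
    have "\<rho>' (x - y) = \<rho>' 0" using R.\<rho>_diff[OF x y] eq R.\<rho>_zero by simp
    then have "\<beta> (x - y) w = 0" if "w \<in> lie_carrier g" for w
      using \<rho>(2)[OF d that] \<rho>'(3)[OF d that] R.\<beta>_zero(2)[OF that] by (simp add: R.\<beta>_def)
    then have "x - y = 0" using nd d unfolding nondegenerate_def by blast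
    then show "x = y" by simp
  qed
  then show "reductive g" using \<rho>'(1,2) unfolding reductive_def by blast
qed

end
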